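(* Suppose $(u_0,v_0)\in \mathrm{L}^2(\mathbb{R})$ and, for each $\tau>0$, let $(u^{(\tau)},v^{(\tau)})$ be the time-splitting solution (defined in the context) whose piecewise constant initial data $(u^{(\tau)},v^{(\tau)})(\cdot,0)$ satisfy $$\lim_{\tau\to0+}\Big(\|u^{(\tau)}(\cdot,0)-u_0\|_{\mathrm{L}^2(\mathbb{R})}+\|v^{(\tau)}(\cdot,0)-v_0\|_{\mathrm{L}^2(\mathbb{R})}\Big)=0.$$ Let $(u,v)\in \mathrm{C}([0,\infty);\mathrm{L}^2(\mathbb{R}))$ be the unique strong solution of the NLDE with initial data $(u_0,v_0)$. Then for every $T>0$, $$\lim_{\tau\to0+}\Big(\sup_{t\in[0,T]}\|u^{(\tau)}(\cdot,t)-u(\cdot,t)\|_{\mathrm{L}^2(\mathbb{R})}+\sup_{t\in[0,T]}\|v^{(\tau)}(\cdot,t)-v(\cdot,t)\|_{\mathrm{L}^2(\mathbb{R})}\Big)=0.$$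
   Context: Fix constants $m\ge 0$ and $\alpha,\beta\in\mathbb{R}$. The nonlinear Dirac equation (NLDE) for $(u,v):\mathbb{R}\times[0,\infty)\to\mathbb{C}^2$ is $$u_t+u_x=imv+i\alpha u|v|^2+2i\beta(\bar u v+u\bar v)v,\qquad v_t-v_x=imu+i\alpha v|u|^2+2i\beta(\bar u v+u\bar v)u,$$ with $(u,v)(\cdot,0)=(u_0,v_0)$. Let (N) denote the ODE system on $\mathbb{C}^2$: $\frac{du}{ds}=imv+i\alpha u|v|^2+2i\beta(\bar u v+u\bar v)v$, $\frac{dv}{ds}=imu+i\alpha v|u|^2+2i\beta(\bar u v+u\bar v)u$. Strong solution: $(u,v)\in \mathrm{C}([0,\infty);\mathrm{L}^2(\mathbb{R}))$ is a strong solution of the NLDE with data $(u_0,v_0)$ if there is a sequence of smooth solutions $(u_k,v_k)$ of the NLDE with $\|u_k(\cdot,0)-u_0\|_{\mathrm{L}^2}+\|v_k(\cdot,0)-v_0\|_{\mathrm{L}^2}\to0$ and, for every $T>0$, $\|u_k-u\|_{\mathrm{L}^2(\mathbb{R}\times[0,T])}+\|v_k-v\|_{\mathrm{L}^2(\mathbb{R}\times[0,T])}\to0$. (It is known that for $(u_0,v_0)\in\mathrm{L}^2$ a strong solution exists globally and is unique.) Time-splitting scheme with mesh $\tau>0$: given $(u_j^0,v_j^0)_{j\in\mathbb{Z}}\subset\mathbb{C}^2$ with $\sum_j(|u_j^0|^2+|v_j^0|^2)<\infty$, set $(u^{(\tau)},v^{(\tau)})(x,0)=(u_j^0,v_j^0)$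 for $x\in[j\tau,(j+1)\tau)$. Inductively, once $(u^{(\tau)},v^{(\tau)})(\cdot,n\tau)$ is defined, set for $t\in[n\tau,(n+1)\tau)$: $u^{(\tau)}(x,t)=u^{(\tau)}(x-(t-n\tau),n\tau)$, $v^{(\tau)}(x,t)=v^{(\tau)}(x+(t-n\tau),n\tau)$ (exact solution of $u_t+u_x=0$, $v_t-v_x=0$); let $(u^{(\tau)},v^{(\tau)})(x,(n+1)\tau-)$ be the left limit in $t$, i.e. $(u^{(\tau)}(x-\tau,n\tau),v^{(\tau)}(x+\tau,n\tau))$; and for each $x$ define $(u^{(\tau)},v^{(\tau)})(x,(n+1)\tau)$ as the value at $s=\tau$ of the solution of (N) with value $(u^{(\tau)},v^{(\tau)})(x,(n+1)\tau-)$ at $s=0$. The resulting function is called the time-splitting solution. *)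

theory Defs
  imports "HOL-Analysis.Analysis"
begin

definition memL2 :: "'a measure \<Rightarrow> ('a \<Rightarrow> complex) \<Rightarrow> bool" where
  "memL2 M f \<longleftrightarrow> f \<in> borel_measurable M \<and> integrable M (\<lambda>x. (cmod (f x))\<^sup>2)"

definition L2norm :: "'a measure \<Rightarrow> ('a \<Rightarrow> complex) \<Rightarrow> real" where
  "L2norm M f = sqrt (\<integral>x. (cmod (f x))\<^sup>2 \<partial>M)"

definition strip :: "real \<Rightarrow> (real \<times> real) measure" where
  "strip T = restrict_space lborel (UNIV \<times> {0..T})"

definition N1 :: "real \<Rightarrow> real \<Rightarrow> real \<Rightarrow> complex \<Rightarrow> complex \<Rightarrow> complex" where
  "N1 m \<alpha> \<beta> u v = \<i> * of_real m * v + \<i> * of_real \<alpha> * u * of_real ((cmod v)\<^sup>2)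
      + 2 * \<i> * of_real \<beta> * (cnj u * v + u * cnj v) * v"

definition N2 :: "real \<Rightarrow> real \<Rightarrow> real \<Rightarrow> complex \<Rightarrow> complex \<Rightarrow> complex" where
  "N2 m \<alpha> \<beta> u v = \<i> * of_real m * u + \<i> * of_real \<alpha> * v * of_real ((cmod u)\<^sup>2)
      + 2 * \<i> * of_real \<beta> * (cnj u * v + u * cnj v) * u"

definition Nvec :: "real \<Rightarrow> real \<Rightarrow> real \<Rightarrow> complex \<times> complex \<Rightarrow> complex \<times> complex" where
  "Nvec m \<alpha> \<beta> w = (N1 m \<alpha> \<beta> (fst w) (snd w), N2 m \<alpha> \<beta> (fst w) (snd w))"

fun Ck :: "nat \<Rightarrow> (real \<times> real \<Rightarrow> complex) \<Rightarrow> bool" where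
  "Ck 0 f = continuous_on UNIV f"
| "Ck (Suc n) f = (\<exists>D. (\<forall>p. (f has_derivative D p) (at p))
        \<and> Ck n (\<lambda>p. D p (1, 0)) \<and> Ck n (\<lambda>p. D p (0, 1)))"

definition smooth2 :: "(real \<times> real \<Rightarrow> complex) \<Rightarrow> bool" where
  "smooth2 f \<longleftrightarrow> (\<forall>n. Ck n f)"

text \<open>Functions are written u x t. A smooth solution is C^infinity on R^2 (equivalently,
  by Seeley extension, smooth up to the boundary of R x [0,inf)) and satisfies the NLDE
  classically for t >= 0.\<close>
definition smooth_sol :: "real \<Rightarrow> real \<Rightarrow> real \<Rightarrow> (real \<Rightarrow> real \<Rightarrow> complex)
    \<Rightarrow> (real \<Rightarrow> real \<Rightarrow> complex) \<Rightarrow> bool" where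
  "smooth_sol m \<alpha> \<beta> u v \<longleftrightarrow>
     smooth2 (\<lambda>(x, t). u x t) \<and> smooth2 (\<lambda>(x, t). v x t) \<and>
     (\<forall>x t. t \<ge> 0 \<longrightarrow>
        (\<exists>ut ux vt vx.
           ((\<lambda>s. u x s) has_vector_derivative ut) (at t) \<and>
           ((\<lambda>y. u y t) has_vector_derivative ux) (at x) \<and>
           ((\<lambda>s. v x s) has_vector_derivative vt) (at t) \<and>
           ((\<lambda>y. v y t) has_vector_derivative vx) (at x) \<and>
           ut + ux = N1 m \<alpha> \<beta> (u x t) (v x t) \<and>
           vt - vx = N2 m \<alpha> \<beta> (u x t) (v x t)))"

definition strong_sol :: "real \<Rightarrow> real \<Rightarrow> real \<Rightarrow> (real \<Rightarrow> complex) \<Rightarrow> (real \<Rightarrow> complex)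
    \<Rightarrow> (real \<Rightarrow> real \<Rightarrow> complex) \<Rightarrow> (real \<Rightarrow> real \<Rightarrow> complex) \<Rightarrow> bool" where
  "strong_sol m \<alpha> \<beta> u0 v0 u v \<longleftrightarrow>
     \<comment> \<open>(u,v) in C([0,inf); L2(R))\<close>
     (\<forall>t\<ge>0. memL2 lborel (\<lambda>x. u x t) \<and> memL2 lborel (\<lambda>x. v x t)) \<and>
     (\<forall>t0\<ge>0. ((\<lambda>t. L2norm lborel (\<lambda>x. u x t - u x t0)) \<longlongrightarrow> 0) (at t0 within {0..}) \<and>
              ((\<lambda>t. L2norm lborel (\<lambda>x. v x t - v x t0)) \<longlongrightarrow> 0) (at t0 within {0..})) \<and>
     \<comment> \<open>approximation by smooth solutions\<close>
     (\<exists>uk vk. (\<forall>k. smooth_sol m \<alpha> \<beta> (uk k) (vk k)) \<and>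
        eventually (\<lambda>k. memL2 lborel (\<lambda>x. uk k x 0 - u0 x) \<and> memL2 lborel (\<lambda>x. vk k x 0 - v0 x))
          sequentially \<and>
        (\<lambda>k. L2norm lborel (\<lambda>x. uk k x 0 - u0 x) + L2norm lborel (\<lambda>x. vk k x 0 - v0 x))
          \<longlonglongrightarrow> 0 \<and>
        (\<forall>T>0.
           eventually (\<lambda>k. memL2 (strip T) (\<lambda>(x, t). uk k x t - u x t) \<and>
                          memL2 (strip T) (\<lambda>(x, t). vk k x t - v x t)) sequentially \<and>
           (\<lambda>k. L2norm (strip T) (\<lambda>(x, t). uk k x t - u x t)
               + L2norm (strip T) (\<lambda>(x, t). vk k x t - v x t)) \<longlonglongrightarrow> 0))"

text \<open>Characterisation of the time-splitting solution with mesh tau and grid data a, b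
  (cell j is [j tau, (j+1) tau), i.e. the cell of x is floor(x/tau)). Only t >= 0 matters.\<close>
definition ts_sol :: "real \<Rightarrow> real \<Rightarrow> real \<Rightarrow> real \<Rightarrow> (int \<Rightarrow> complex) \<Rightarrow> (int \<Rightarrow> complex)
    \<Rightarrow> (real \<Rightarrow> real \<Rightarrow> complex) \<Rightarrow> (real \<Rightarrow> real \<Rightarrow> complex) \<Rightarrow> bool" where
  "ts_sol m \<alpha> \<beta> \<tau> a b U V \<longleftrightarrow>
     (\<lambda>j. (cmod (a j))\<^sup>2 + (cmod (b j))\<^sup>2) summable_on UNIV \<and>
     (\<forall>x. U x 0 = a \<lfloor>x / \<tau>\<rfloor> \<and> V x 0 = b \<lfloor>x / \<tau>\<rfloor>) \<and>
     (\<forall>n::nat. \<forall>x. \<forall>t \<in> {real n * \<tau> ..< (real n + 1) * \<tau>}.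
        U x t = U (x - (t - real n * \<tau>)) (real n * \<tau>) \<and>
        V x t = V (x + (t - real n * \<tau>)) (real n * \<tau>)) \<and>
     (\<forall>n::nat. \<forall>x. \<exists>y :: real \<Rightarrow> complex \<times> complex.
        y 0 = (U (x - \<tau>) (real n * \<tau>), V (x + \<tau>) (real n * \<tau>)) \<and>
        (\<forall>s\<in>{0..\<tau>}. (y has_vector_derivative Nvec m \<alpha> \<beta> (y s)) (at s within {0..\<tau>})) \<and>
        (U x ((real n + 1) * \<tau>), V x ((real n + 1) * \<tau>)) = y \<tau>)"

end

theory Submission
  imports Defs
begin

text \<open>
  The nonlinearity of each component is linear in that component and quadratic in the other one, so
  the growth of the difference of two solutions is controlled by products \<open>|\<Delta>u|\<^sup>2 |v|\<^sup>2 + |u|\<^sup>2 |\<Delta>v|\<^sup>2\<close>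
  of a right-moving and a left-moving density. On a short interval with small charge the Glimm-Bony
  interaction potential \<open>\<Sum>\<^bsub>i<k\<^esub> (|\<Delta>u\<^sub>i|\<^sup>2 |v\<^sub>k|\<^sup>2 + |u\<^sub>i|\<^sup>2 |\<Delta>v\<^sub>k|\<^sup>2)\<close> decreases by exactly such products at
  every step of the scheme, which yields an \<open>L\<^sup>2\<close> stability estimate on characteristic cones that
  does not depend on the mesh. Sampled on the lattice, a smooth solution is a time-splitting solution
  up to a small forcing on compact sets, so the estimate compares the scheme with each approximating
  smooth solution; charge conservation on cones controls the tails, and comparing two smooth
  solutions through the scheme shows that they form a Cauchy sequence. The length of the time step is
  dictated by the equi-integrability of the strong solution, which is locally uniform in time because
  the solution is continuous into \<open>L\<^sup>2\<close>; the Bolzano induction principle joins the steps.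
\<close>

subsection \<open>The nonlinearity\<close>

text \<open>The cubic terms are not Lipschitz in L^2: a direct Gronwall argument would need a
  supremum bound on the solution, and such a bound is lost in the limit of the smooth
  approximations. What survives is the sum of the crossing products over all sites and all steps,
  because two particles of opposite velocity cross only once. This amount is controlled in total and
  not step by step, so the rate in the discrete Gronwall inequality varies with the step and is
  merely summable. Small charge is needed because the potential is itself fed by the interactions,
  and its decrease has to outweigh that source. The constants of the stability estimate depend on m,
  \<alpha>, \<beta> alone, whereas the admissible mesh depends on the modulus of continuity of the
  smooth solution in the comparison. Hence each smooth approximation is fixed before the mesh tends
  to zero. The strong solution is given through convergence in space-time L^2, which says nothing
  about a single time; uniformity in time has to be gained from the comparison itself. All errors
  are squared norms, so each triangle inequality costs factors of two.\<close>

lemma gronwall_differential: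
  fixes f f' :: "real \<Rightarrow> real"
  assumes der: "\<And>s. s \<in> {0..T} \<Longrightarrow> (f has_real_derivative f' s) (at s within {0..T})"
    and le: "\<And>s. s \<in> {0..T} \<Longrightarrow> f' s \<le> A * f s + B"
    and AB: "0 \<le> A" "0 \<le> B" and t: "t \<in> {0..T}"
  shows "f t \<le> exp (A * t) * (f 0 + B * t)"
proof -
  \<comment> \<open>Subtracting \<open>B * s\<close> instead of solving the linear equation exactly
    avoids a division by \<open>A\<close>, so that \<open>A = 0\<close> (plain integration) stays
    included.\<close>
  define g where "g s = exp (- (A * s)) * f s - B * s" for s
  define g' where "g' s = exp (- (A * s)) * (f' s - A * f s) - B" for s
  have dg: "(g has_real_derivative g' s) (at s within {0..t})" if "s \<in> {0..t}" for s
  proof -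
    have "(f has_real_derivative f' s) (at s within {0..t})"
      using der[of s] that t by (auto intro: DERIV_subset)
    then show ?thesis unfolding g_def g'_def
      by (auto intro!: derivative_eq_intros simp: algebra_simps)
  qed
  have neg: "g' s \<le> 0" if "s \<in> {0..t}" for s
  proof -
    have "f' s - A * f s \<le> B" using le[of s] that t by auto
    then have "exp (- (A * s)) * (f' s - A * f s) \<le> exp (- (A * s)) * B" by (intro mult_left_mono) auto
    also have "\<dots> \<le> 1 * B" using that AB by (intro mult_right_mono) auto
    finally show ?thesis by (simp add: g'_def)
  qed
  have "g t \<le> g 0"
  proof (cases "t = 0")
    case False
    then have "0 < t" using t by auto
    moreover have "(g has_derivative (\<lambda>h. g' x * h)) (at x within {0..t})" if "0 \<le> x" "x \<le> t" for x
      using dg[of x] that by (auto simp: has_field_derivative_def)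
    ultimately obtain x where x: "x \<in> {0<..<t}" "g t - g 0 = (t - 0) * g' x"
      using mvt_simple[of 0 t g "\<lambda>x h. g' x * h"] by auto
    then show ?thesis using neg[of x] \<open>0 < t\<close> mult_nonneg_nonpos[of t "g' x"] by auto
  qed auto
  then have "exp (- (A * t)) * f t \<le> f 0 + B * t" by (simp add: g_def)
  then have "exp (A * t) * (exp (- (A * t)) * f t) \<le> exp (A * t) * (f 0 + B * t)"
    by (intro mult_left_mono) auto
  then show ?thesis by (simp add: exp_minus field_simps)
qed

text \<open>The coupling factor \<open>cnj u * v + u * cnj v\<close> is symmetric, so exchanging the
  components exchanges the equations. Through this symmetry the bounds on the first component of the
  ODE step carry over to the second.\<close>

lemma N2_eq_N1: "N2 m \<alpha> \<beta> u v = N1 m \<alpha> \<beta> v u"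
  by (simp add: N1_def N2_def algebra_simps)

lemma Nvec_swap: "Nvec m \<alpha> \<beta> (prod.swap w) = prod.swap (Nvec m \<alpha> \<beta> w)"
  by (simp add: Nvec_def N2_eq_N1)

lemma Nvec_0 [simp]: "Nvec m \<alpha> \<beta> 0 = 0"
  by (simp add: Nvec_def N1_def N2_def zero_prod_def)

text \<open>The charge is conserved because the two components exchange it.\<close>
lemma inner_Nvec: "w \<bullet> Nvec m \<alpha> \<beta> w = 0"
proof -
  have "Re (cnj a * N1 m \<alpha> \<beta> a b) + Re (cnj b * N1 m \<alpha> \<beta> b a) = 0" for a b
    by (simp add: N1_def cmod_power2) algebra
  then show ?thesis
    by (cases w) (simp add: Nvec_def N2_eq_N1 inner_complex_def inner_prod_def)
qed

text \<open>The cubic part is a combination of \<open>a * (b * cnj b)\<close> and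
  \<open>cnj a * (b * b)\<close>, of degree one in \<open>a\<close> and two in \<open>b\<close>;
  hence no square of \<open>a\<close> or \<open>a'\<close> appears on the right. The \<beta>-term
  expands into both monomials with factor 2 each, which gives the coefficient 4.\<close>

lemma norm_N1_diff:
  "cmod (N1 m \<alpha> \<beta> a b - N1 m \<alpha> \<beta> a' b') \<le> \<bar>m\<bar> * cmod (b - b')
    + (\<bar>\<alpha>\<bar> + 4 * \<bar>\<beta>\<bar>) * (cmod (a - a') * (cmod b)\<^sup>2 + cmod a' * (cmod (b - b') * (cmod b + cmod b')))"
proof -
  let ?X = "cmod (a - a') * (cmod b)\<^sup>2 + cmod a' * (cmod (b - b') * (cmod b + cmod b'))"
  have sq: "(of_real ((cmod z)\<^sup>2) :: complex) = z * cnj z" for z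
    by (metis complex_norm_square)
  define p where "p = a * (b * cnj b) - a' * (b' * cnj b')"
  define q where "q = cnj a * (b * b) - cnj a' * (b' * b')"
  have p: "cmod p \<le> ?X"
  proof -
    have "p = (a - a') * (b * cnj b) + a' * ((b - b') * cnj b + b' * cnj (b - b'))"
      by (simp add: p_def algebra_simps)
    also have "cmod \<dots> \<le> cmod ((a - a') * (b * cnj b)) + cmod (a' * ((b - b') * cnj b + b' * cnj (b - b')))"
      by (rule norm_triangle_ineq)
    also have "cmod (a' * ((b - b') * cnj b + b' * cnj (b - b'))) \<le> cmod a' * (cmod (b - b') * (cmod b + cmod b'))"
      unfolding norm_mult
      by (intro mult_left_mono order.trans[OF norm_triangle_ineq])
         (simp_all add: norm_mult distrib_left mult.commute flip: complex_cnj_diff)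
    finally show ?thesis by (simp add: norm_mult power2_eq_square)
  qed
  have q: "cmod q \<le> ?X"
  proof -
    have "q = cnj (a - a') * (b * b) + cnj a' * ((b - b') * b + b' * (b - b'))"
      by (simp add: q_def algebra_simps)
    also have "cmod \<dots> \<le> cmod (cnj (a - a') * (b * b)) + cmod (cnj a' * ((b - b') * b + b' * (b - b')))"
      by (rule norm_triangle_ineq)
    also have "cmod (cnj a' * ((b - b') * b + b' * (b - b'))) \<le> cmod a' * (cmod (b - b') * (cmod b + cmod b'))"
      unfolding norm_mult complex_mod_cnj
      by (intro mult_left_mono order.trans[OF norm_triangle_ineq])
         (simp_all add: norm_mult distrib_left mult.commute)
    finally show ?thesis by (simp add: norm_mult power2_eq_square del: complex_cnj_diff)
  qed
  have "N1 m \<alpha> \<beta> a b - N1 m \<alpha> \<beta> a' b' = \<i> * of_real m * (b - b') + \<i> * of_real \<alpha> * p + 2 * \<i> * of_real \<beta> * (p + q)"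
    unfolding N1_def sq p_def q_def by (simp add: algebra_simps)
  also have "cmod \<dots> \<le> cmod (\<i> * of_real m * (b - b')) + cmod (\<i> * of_real \<alpha> * p) + cmod (2 * \<i> * of_real \<beta> * (p + q))"
    by (intro order.trans[OF norm_triangle_ineq] add_mono order.refl)
  also have "\<dots> = \<bar>m\<bar> * cmod (b - b') + \<bar>\<alpha>\<bar> * cmod p + 2 * \<bar>\<beta>\<bar> * cmod (p + q)"
    by (simp add: norm_mult)
  also have "\<dots> \<le> \<bar>m\<bar> * cmod (b - b') + \<bar>\<alpha>\<bar> * ?X + 2 * \<bar>\<beta>\<bar> * (?X + ?X)"
    using p q norm_triangle_ineq[of p q] by (intro add_mono mult_left_mono) auto
  finally show ?thesis by (simp add: algebra_simps)
qed

text \<open>Each squared difference is multiplied only by the density of the other component. A term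
  such as \<open>r * d1\<close> would couple particles that travel together and never cross, and an
  interaction potential could not absorb it.\<close>

lemma inner_N1_diff:
  fixes a b a' b' :: complex
  defines "d1 \<equiv> (cmod (a - a'))\<^sup>2" and "d2 \<equiv> (cmod (b - b'))\<^sup>2"
    and "r \<equiv> (cmod a)\<^sup>2 + (cmod a')\<^sup>2" and "s \<equiv> (cmod b)\<^sup>2 + (cmod b')\<^sup>2"
  shows "(a - a') \<bullet> (N1 m \<alpha> \<beta> a b - N1 m \<alpha> \<beta> a' b')
    \<le> (\<bar>m\<bar> + 2 * \<bar>\<alpha>\<bar> + 8 * \<bar>\<beta>\<bar>) * ((1 + s) * d1 + (1 + r) * d2)"
proof -
  define x y where "x = cmod (a - a')" and "y = cmod (b - b')"
  define B B' A' where "B = cmod b" and "B' = cmod b'" and "A' = cmod a'"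
  have nn: "0 \<le> x" "0 \<le> y" "0 \<le> B" "0 \<le> B'" "0 \<le> A'" by (auto simp: x_def y_def B_def B'_def A'_def)
  define X where "X = x * B\<^sup>2 + A' * (y * (B + B'))"
  have "(a - a') \<bullet> (N1 m \<alpha> \<beta> a b - N1 m \<alpha> \<beta> a' b') \<le> x * cmod (N1 m \<alpha> \<beta> a b - N1 m \<alpha> \<beta> a' b')"
    unfolding x_def by (rule norm_cauchy_schwarz)
  also have "\<dots> \<le> x * (\<bar>m\<bar> * y + (\<bar>\<alpha>\<bar> + 4 * \<bar>\<beta>\<bar>) * X)"
    using norm_N1_diff[of m \<alpha> \<beta> a b a' b'] nn(1)
    unfolding x_def y_def B_def B'_def A'_def X_def by (intro mult_left_mono) auto
  also have "\<dots> = \<bar>m\<bar> * (x * y) + (\<bar>\<alpha>\<bar> + 4 * \<bar>\<beta>\<bar>) * (x * X)" by (simp add: algebra_simps)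
  also have "\<dots> \<le> \<bar>m\<bar> * ((1 + s) * d1 + (1 + r) * d2) + (\<bar>\<alpha>\<bar> + 4 * \<bar>\<beta>\<bar>) * (2 * ((1 + s) * d1 + (1 + r) * d2))"
  proof -
    have rs: "0 \<le> r" "0 \<le> s" "0 \<le> d1" "0 \<le> d2" by (auto simp: r_def s_def d1_def d2_def)
    have base: "d1 + d2 + s * d1 + r * d2 = (1 + s) * d1 + (1 + r) * d2" by (simp add: algebra_simps)
    have "x * y \<le> d1 + d2"
      using sum_squares_bound[of x y] mult_nonneg_nonneg[OF nn(1,2)]
      unfolding d1_def d2_def x_def[symmetric] y_def[symmetric] by linarith
    then have 1: "x * y \<le> (1 + s) * d1 + (1 + r) * d2"
      using rs unfolding base[symmetric] by (smt (verit) mult_nonneg_nonneg)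
    \<comment> \<open>The mixed term is grouped so that Young's inequality yields
      \<open>s * d1\<close> and \<open>r * d2\<close>; any other grouping would produce products of
      densities with the same velocity.\<close>
    have "2 * ((x * (B + B')) * (A' * y)) \<le> (x * (B + B'))\<^sup>2 + (A' * y)\<^sup>2"
      using sum_squares_bound[of "x * (B + B')" "A' * y"] by simp
    moreover have "(B + B')\<^sup>2 \<le> 2 * s"
      using sum_squares_bound[of B B'] by (simp add: s_def B_def[symmetric] B'_def[symmetric] power2_sum)
    then have "(x * (B + B'))\<^sup>2 \<le> d1 * (2 * s)"
      unfolding power_mult_distrib d1_def x_def by (intro mult_left_mono) auto
    moreover have "(A' * y)\<^sup>2 \<le> r * d2"
      unfolding power_mult_distrib d2_def y_def A'_def r_def by (intro mult_right_mono) auto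
    moreover have "x * (x * B\<^sup>2) \<le> d1 * s"
      unfolding d1_def x_def B_def s_def mult.assoc[symmetric] power2_eq_square[of "cmod (a - a')"]
      by (intro mult_left_mono) auto
    moreover have "x * X = x * (x * B\<^sup>2) + (x * (B + B')) * (A' * y)"
      by (simp add: X_def algebra_simps)
    moreover have "0 \<le> r * d2" using rs by simp
    ultimately have "x * X \<le> 2 * (d1 * s) + r * d2" by argo
    also have "\<dots> \<le> 2 * ((1 + s) * d1 + (1 + r) * d2)"
      using rs mult_nonneg_nonneg[of r d2] unfolding base[symmetric] by (simp add: algebra_simps)
    finally have 2: "x * X \<le> 2 * ((1 + s) * d1 + (1 + r) * d2)" .
    show ?thesis using 1 2 by (intro add_mono mult_left_mono) auto
  qed
  finally show ?thesis by (simp add: algebra_simps)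
qed

subsection \<open>Approximate solutions of the ODE step\<close>

text \<open>The forcing \<open>e\<close> lets one notion cover the exact step of the scheme
  (\<epsilon> = 0), a smooth solution followed along two nearby characteristics (\<epsilon> small),
  and the zero function. Comparison with zero turns estimates for differences into estimates for
  densities.\<close>

definition approx_ode :: "real \<Rightarrow> real \<Rightarrow> real \<Rightarrow> real \<Rightarrow> real \<Rightarrow> (real \<Rightarrow> complex \<times> complex) \<Rightarrow> bool" where
  "approx_ode m \<alpha> \<beta> \<epsilon> \<tau> y \<longleftrightarrow>
    (\<forall>s\<in>{0..\<tau>}. \<exists>e. (y has_vector_derivative Nvec m \<alpha> \<beta> (y s) + e) (at s within {0..\<tau>}) \<and> norm e \<le> \<epsilon>)"

lemma approx_ode_swap:
  assumes "approx_ode m \<alpha> \<beta> \<epsilon> \<tau> y"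
  shows "approx_ode m \<alpha> \<beta> \<epsilon> \<tau> (\<lambda>s. prod.swap (y s))"
proof -
  have bl: "bounded_linear (prod.swap :: complex \<times> complex \<Rightarrow> complex \<times> complex)"
    by (rule bounded_linear_intro[of _ 1]) (auto simp: prod.swap_def norm_prod_def add.commute)
  have nsw: "norm (prod.swap e) = norm e" for e :: "complex \<times> complex"
    by (simp add: norm_prod_def add.commute prod.swap_def)
  have add: "prod.swap (a + b) = prod.swap a + prod.swap b" for a b :: "complex \<times> complex"
    by (simp add: prod.swap_def)
  show ?thesis unfolding approx_ode_def
  proof
    fix s assume "s \<in> {0..\<tau>}"
    then obtain e where e: "(y has_vector_derivative Nvec m \<alpha> \<beta> (y s) + e) (at s within {0..\<tau>})" "norm e \<le> \<epsilon>"
      using assms unfolding approx_ode_def by blast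
    have "((\<lambda>s. prod.swap (y s)) has_vector_derivative prod.swap (Nvec m \<alpha> \<beta> (y s) + e)) (at s within {0..\<tau>})"
      by (rule bounded_linear.has_vector_derivative[OF bl e(1)])
    then show "\<exists>e. ((\<lambda>s. prod.swap (y s)) has_vector_derivative Nvec m \<alpha> \<beta> (prod.swap (y s)) + e) (at s within {0..\<tau>}) \<and> norm e \<le> \<epsilon>"
      using e(2) by (intro exI[of _ "prod.swap e"]) (auto simp: Nvec_swap add nsw)
  qed
qed

lemma approx_ode_0 [simp]: "0 \<le> \<epsilon> \<Longrightarrow> approx_ode m \<alpha> \<beta> \<epsilon> \<tau> (\<lambda>s. 0)"
  unfolding approx_ode_def by (auto intro!: exI[of _ "0 :: complex \<times> complex"] simp del: split_paired_Ex)

lemma has_real_derivative_norm_square: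
  fixes f :: "real \<Rightarrow> 'a :: real_inner"
  assumes "(f has_vector_derivative f') (at s within S)"
  shows "((\<lambda>s. (norm (f s))\<^sup>2) has_real_derivative 2 * (f s \<bullet> f')) (at s within S)"
proof -
  have "(f has_derivative (\<lambda>h. h *\<^sub>R f')) (at s within S)"
    using assms by (simp add: has_vector_derivative_def)
  from has_derivative_inner[OF this this]
  show ?thesis
    unfolding has_field_derivative_def power2_norm_eq_inner
    by (rule has_derivative_eq_rhs) (simp add: fun_eq_iff inner_commute)
qed

lemma inner_le_sum_squares: "2 * (x \<bullet> y) \<le> (norm x)\<^sup>2 + (norm y)\<^sup>2"
proof -
  have "0 \<le> (norm (x - y))\<^sup>2" by simp
  then show ?thesis by (simp add: power2_norm_eq_inner inner_diff inner_commute)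
qed

text \<open>The nonlinearity is orthogonal to the state, so only the forcing changes the charge.
  Young's inequality converts it into growth at rate one plus the source
  \<open>\<epsilon>\<^sup>2\<close>.\<close>

lemma approx_ode_charge:
  assumes y: "approx_ode m \<alpha> \<beta> \<epsilon> \<tau> y" and t: "t \<in> {0..\<tau>}"
  shows "(norm (y t))\<^sup>2 \<le> exp t * ((norm (y 0))\<^sup>2 + \<epsilon>\<^sup>2 * t)"
proof -
  obtain e where e: "\<And>s. s \<in> {0..\<tau>} \<Longrightarrow>
      (y has_vector_derivative Nvec m \<alpha> \<beta> (y s) + e s) (at s within {0..\<tau>}) \<and> norm (e s) \<le> \<epsilon>"
    using y unfolding approx_ode_def by metis
  have "(norm (y t))\<^sup>2 \<le> exp (1 * t) * ((norm (y 0))\<^sup>2 + \<epsilon>\<^sup>2 * t)"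
  proof (rule gronwall_differential[OF has_real_derivative_norm_square _ _ _ t])
    fix s assume s: "s \<in> {0..\<tau>}"
    show "(y has_vector_derivative Nvec m \<alpha> \<beta> (y s) + e s) (at s within {0..\<tau>})" using e[OF s] by blast
    have "(norm (e s))\<^sup>2 \<le> \<epsilon>\<^sup>2" using e[OF s] by (intro power_mono) auto
    then show "2 * (y s \<bullet> (Nvec m \<alpha> \<beta> (y s) + e s)) \<le> 1 * (norm (y s))\<^sup>2 + \<epsilon>\<^sup>2"
      using inner_le_sum_squares[of "y s" "e s"] by (simp add: inner_add inner_Nvec)
  qed auto
  then show ?thesis by simp
qed

text \<open>The factor 2 stems from differentiating a square. The additional 1 absorbs the forcing
  by Young's inequality; the forcings of two solutions together have norm at most 2 \<epsilon>,
  which is the origin of the summand \<open>4 * \<epsilon>\<^sup>2\<close> below.\<close>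

definition rate :: "real \<Rightarrow> real \<Rightarrow> real \<Rightarrow> real" where
  "rate m \<alpha> \<beta> = 2 * (\<bar>m\<bar> + 2 * \<bar>\<alpha>\<bar> + 8 * \<bar>\<beta>\<bar>) + 1"

lemma rate_ge_1: "1 \<le> rate m \<alpha> \<beta>"
  by (simp add: rate_def)

lemma approx_ode_fst_diff:
  assumes y: "approx_ode m \<alpha> \<beta> \<epsilon> \<tau> y" and z: "approx_ode m \<alpha> \<beta> \<epsilon> \<tau> z" and s: "s \<in> {0..\<tau>}"
  shows "\<exists>D. ((\<lambda>s. (cmod (fst (y s) - fst (z s)))\<^sup>2) has_real_derivative D) (at s within {0..\<tau>}) \<and>
    D \<le> rate m \<alpha> \<beta> * ((1 + ((cmod (snd (y s)))\<^sup>2 + (cmod (snd (z s)))\<^sup>2)) * (cmod (fst (y s) - fst (z s)))\<^sup>2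
       + (1 + ((cmod (fst (y s)))\<^sup>2 + (cmod (fst (z s)))\<^sup>2)) * (cmod (snd (y s) - snd (z s)))\<^sup>2) + 4 * \<epsilon>\<^sup>2"
proof -
  define a b a' b' where "a = fst (y s)" and "b = snd (y s)" and "a' = fst (z s)" and "b' = snd (z s)"
  obtain e where e: "(y has_vector_derivative Nvec m \<alpha> \<beta> (y s) + e) (at s within {0..\<tau>})" "norm e \<le> \<epsilon>"
    using y s unfolding approx_ode_def by blast
  obtain e' where e': "(z has_vector_derivative Nvec m \<alpha> \<beta> (z s) + e') (at s within {0..\<tau>})" "norm e' \<le> \<epsilon>"
    using z s unfolding approx_ode_def by blast
  define g where "g = fst e - fst e'"
  have "cmod g \<le> 2 * \<epsilon>"
    using norm_triangle_ineq4[of "fst e" "fst e'"] norm_fst_le[of "fst e" "snd e"] norm_fst_le[of "fst e'" "snd e'"] e(2) e'(2)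
    by (simp add: g_def)
  then have "(cmod g)\<^sup>2 \<le> (2 * \<epsilon>)\<^sup>2" by (intro power_mono) auto
  then have g: "(cmod g)\<^sup>2 \<le> 4 * \<epsilon>\<^sup>2" by (simp add: power2_eq_square)
  have D: "((\<lambda>s. fst (y s) - fst (z s)) has_vector_derivative (N1 m \<alpha> \<beta> a b - N1 m \<alpha> \<beta> a' b') + g) (at s within {0..\<tau>})"
    using has_vector_derivative_diff[OF bounded_linear.has_vector_derivative[OF bounded_linear_fst e(1)]
        bounded_linear.has_vector_derivative[OF bounded_linear_fst e'(1)]]
    by (simp add: g_def a_def b_def a'_def b'_def Nvec_def algebra_simps)
  define X where "X = (1 + ((cmod b)\<^sup>2 + (cmod b')\<^sup>2)) * (cmod (a - a'))\<^sup>2 + (1 + ((cmod a)\<^sup>2 + (cmod a')\<^sup>2)) * (cmod (b - b'))\<^sup>2"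
  have "(cmod (a - a'))\<^sup>2 \<le> X"
    by (simp add: X_def distrib_right)
  then have "2 * ((a - a') \<bullet> (N1 m \<alpha> \<beta> a b - N1 m \<alpha> \<beta> a' b' + g)) \<le> rate m \<alpha> \<beta> * X + 4 * \<epsilon>\<^sup>2"
    using inner_N1_diff[of a a' m \<alpha> \<beta> b b'] g inner_le_sum_squares[of "a - a'" g]
    unfolding X_def[symmetric] by (simp add: rate_def inner_add_right algebra_simps)
  then show ?thesis
    using has_real_derivative_norm_square[OF D] by (auto simp: X_def a_def b_def a'_def b'_def)
qed

lemma approx_ode_snd_diff:
  assumes y: "approx_ode m \<alpha> \<beta> \<epsilon> \<tau> y" and z: "approx_ode m \<alpha> \<beta> \<epsilon> \<tau> z" and s: "s \<in> {0..\<tau>}"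
  shows "\<exists>D. ((\<lambda>s. (cmod (snd (y s) - snd (z s)))\<^sup>2) has_real_derivative D) (at s within {0..\<tau>}) \<and>
    D \<le> rate m \<alpha> \<beta> * ((1 + ((cmod (snd (y s)))\<^sup>2 + (cmod (snd (z s)))\<^sup>2)) * (cmod (fst (y s) - fst (z s)))\<^sup>2
       + (1 + ((cmod (fst (y s)))\<^sup>2 + (cmod (fst (z s)))\<^sup>2)) * (cmod (snd (y s) - snd (z s)))\<^sup>2) + 4 * \<epsilon>\<^sup>2"
  using approx_ode_fst_diff[OF approx_ode_swap[OF y] approx_ode_swap[OF z] s] by (simp add: add.commute)

text \<open>The first density grows at a rate given by the second one, which charge conservation
  keeps of order \<rho> + 1. Over a step this contributes at most a multiple of \<tau> * \<rho> +
  \<tau>, hence an absolute factor, although \<rho> itself may be large. The bound serves to replace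
  the densities inside a step by their values at its beginning. It is essential that the right side
  contains the first component only: otherwise densities of equal velocity would be multiplied
  later.\<close>

lemma approx_ode_fst_bound:
  assumes y: "approx_ode m \<alpha> \<beta> \<epsilon> \<tau> y" and t: "t \<in> {0..\<tau>}" and tau: "\<tau> \<le> 1"
    and eps: "0 \<le> \<epsilon>" "\<epsilon> \<le> 1" and small: "\<tau> * (norm (y 0))\<^sup>2 \<le> 1"
  defines "K \<equiv> rate m \<alpha> \<beta>"
  shows "1 + (cmod (fst (y t)))\<^sup>2 \<le> exp (13 * K) * (6 * K + 5) * (1 + (cmod (fst (y 0)))\<^sup>2)"
proof -
  define R where "R = (\<lambda>s. (cmod (fst (y s)))\<^sup>2)"
  define S where "S = (\<lambda>s. (cmod (snd (y s)))\<^sup>2)"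
  define \<rho> where "\<rho> = (norm (y 0))\<^sup>2"
  have K: "1 \<le> K" unfolding K_def by (rule rate_ge_1)
  have tau0: "0 \<le> \<tau>" using t by auto
  have rho: "0 \<le> \<rho>" by (simp add: \<rho>_def)
  have \<epsilon>2: "\<epsilon>\<^sup>2 \<le> 1" using eps by (simp add: power_le_one)
  have S: "S s \<le> 3 * (\<rho> + 1)" if s: "s \<in> {0..\<tau>}" for s
  proof -
    have "exp s \<le> exp (1::real)" using s tau by auto
    also have "\<dots> \<le> 3" by (rule exp_le)
    finally have ex: "exp s \<le> 3" .
    have "\<epsilon>\<^sup>2 * s \<le> 1 * 1" using s tau \<epsilon>2 by (intro mult_mono) auto
    then have "exp s * (\<rho> + \<epsilon>\<^sup>2 * s) \<le> 3 * (\<rho> + 1)"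
      using ex rho s by (intro mult_mono) auto
    moreover have "S s \<le> (norm (y s))\<^sup>2" by (simp add: S_def norm_prod_def)
    ultimately show ?thesis using approx_ode_charge[OF y s] by (simp add: \<rho>_def)
  qed
  have "\<exists>D. (R has_real_derivative D) (at s within {0..\<tau>}) \<and> D \<le> K * (7 + 6 * \<rho>) * R s + (3 * K * (\<rho> + 1) + 4)"
    if s: "s \<in> {0..\<tau>}" for s
  proof -
    obtain D where D: "(R has_real_derivative D) (at s within {0..\<tau>})"
        "D \<le> K * ((1 + S s) * R s + (1 + R s) * S s) + 4 * \<epsilon>\<^sup>2"
      using approx_ode_fst_diff[OF y approx_ode_0[OF eps(1)] s] by (auto simp: R_def S_def K_def)
    have R0: "0 \<le> R s" by (simp add: R_def)
    \<comment> \<open>The factor 7 + 6 \<rho> is 1 + 2 * 3 (\<rho> + 1); with t \<le> 1 and \<rho> *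
      t \<le> 1 it becomes the 13 in the exponent.\<close>
    have "(1 + S s) * R s + (1 + R s) * S s = (1 + 2 * S s) * R s + S s" by (simp add: algebra_simps)
    also have "\<dots> \<le> (7 + 6 * \<rho>) * R s + 3 * (\<rho> + 1)"
      using S[OF s] R0 by (intro add_mono[of _ "(7 + 6 * \<rho>) * R s"] mult_right_mono) auto
    finally have "K * ((1 + S s) * R s + (1 + R s) * S s) \<le> K * ((7 + 6 * \<rho>) * R s + 3 * (\<rho> + 1))"
      using K by (intro mult_left_mono) auto
    then have "D \<le> K * (7 + 6 * \<rho>) * R s + (3 * K * (\<rho> + 1) + 4)"
      using D(2) \<epsilon>2 by (simp add: algebra_simps)
    then show ?thesis using D(1) by blast
  qed
  then obtain D where D: "\<And>s. s \<in> {0..\<tau>} \<Longrightarrow> (R has_real_derivative D s) (at s within {0..\<tau>})"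
    "\<And>s. s \<in> {0..\<tau>} \<Longrightarrow> D s \<le> K * (7 + 6 * \<rho>) * R s + (3 * K * (\<rho> + 1) + 4)" by metis
  have "R t \<le> exp (K * (7 + 6 * \<rho>) * t) * (R 0 + (3 * K * (\<rho> + 1) + 4) * t)"
    using rho K by (intro gronwall_differential[OF D _ _ t]) auto
  also have "\<dots> \<le> exp (13 * K) * (R 0 + (6 * K + 4))"
  proof (intro mult_mono add_mono order.refl)
    have rt: "\<rho> * t \<le> 1" using small t rho by (smt (verit) \<rho>_def atLeastAtMost_iff mult.commute mult_left_mono)
    have t1: "t \<le> 1" "0 \<le> t" using t tau by auto
    have "K * ((7 + 6 * \<rho>) * t) \<le> K * 13" using rt t1 K by (intro mult_left_mono) (auto simp: algebra_simps)
    then show "exp (K * (7 + 6 * \<rho>) * t) \<le> exp (13 * K)" by (simp add: algebra_simps)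
    have "K * ((\<rho> + 1) * t) \<le> K * 2" using rt t1 K by (intro mult_left_mono) (auto simp: algebra_simps)
    then show "(3 * K * (\<rho> + 1) + 4) * t \<le> 6 * K + 4" using t1 by (simp add: algebra_simps)
    show "0 \<le> R 0 + (3 * K * (\<rho> + 1) + 4) * t" using K rho t1 by (simp add: R_def)
  qed auto
  finally have "1 + R t \<le> exp (13 * K) * 1 + exp (13 * K) * (R 0 + (6 * K + 4))"
    using K by (intro add_mono) auto
  also have "\<dots> = exp (13 * K) * (R 0 + (6 * K + 5))" by (simp add: algebra_simps)
  also have "\<dots> \<le> exp (13 * K) * ((6 * K + 5) * (1 + R 0))"
  proof (intro mult_left_mono)
    have "1 * R 0 \<le> (6 * K + 5) * R 0" using K by (intro mult_right_mono) (auto simp: R_def)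
    then show "R 0 + (6 * K + 5) \<le> (6 * K + 5) * (1 + R 0)" by (simp add: algebra_simps)
  qed auto
  finally show ?thesis by (simp add: R_def mult.assoc)
qed

text \<open>The state may be large at a point; what is limited is \<tau> times its square, and on
  the lattice this follows from small total charge. The increments are linear in the initial
  differences, with the crossing densities as coefficients.\<close>

definition step_bound :: "real \<Rightarrow> real \<Rightarrow> real \<Rightarrow> real \<Rightarrow> bool" where
  "step_bound m \<alpha> \<beta> C \<longleftrightarrow>
    (\<forall>\<epsilon> \<tau> y z. approx_ode m \<alpha> \<beta> \<epsilon> \<tau> y \<longrightarrow> approx_ode m \<alpha> \<beta> \<epsilon> \<tau> z \<longrightarrow> 0 \<le> \<tau> \<longrightarrow> \<tau> \<le> 1 \<longrightarrow>
     0 \<le> \<epsilon> \<longrightarrow> \<epsilon> \<le> 1 \<longrightarrow> \<tau> * ((norm (y 0))\<^sup>2 + (norm (z 0))\<^sup>2) \<le> 1 \<longrightarrow>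
     (let d1 = \<lambda>s. (cmod (fst (y s) - fst (z s)))\<^sup>2; d2 = \<lambda>s. (cmod (snd (y s) - snd (z s)))\<^sup>2;
        r = (cmod (fst (y 0)))\<^sup>2 + (cmod (fst (z 0)))\<^sup>2; s = (cmod (snd (y 0)))\<^sup>2 + (cmod (snd (z 0)))\<^sup>2;
        g = C * \<tau> * ((1 + s) * d1 0 + (1 + r) * d2 0 + \<epsilon>\<^sup>2)
      in d1 \<tau> \<le> d1 0 + g \<and> d2 \<tau> \<le> d2 0 + g))"

lemma approx_ode_step: "\<exists>C\<ge>1. step_bound m \<alpha> \<beta> C"
proof -
  define K where "K = rate m \<alpha> \<beta>"
  define C1 where "C1 = exp (13 * K) * (6 * K + 5)"
  define K2 where "K2 = 2 * C1 * K"
  \<comment> \<open>Read off from the final bound \<open>B\<close> below. The 12 is 3 * 4: the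
    weight satisfies \<open>W * t \<le> 3\<close> and multiplies the forcing term
    \<open>4 * \<epsilon>\<^sup>2\<close>.\<close>
  define C where "C = 12 * K2 * exp (3 * K2) + 4"
  have K: "1 \<le> K" unfolding K_def by (rule rate_ge_1)
  have C1: "0 \<le> C1" using K by (simp add: C1_def)
  have K2: "0 \<le> K2" using K C1 by (simp add: K2_def)
  show ?thesis unfolding step_bound_def
  proof (intro exI[of _ C] conjI allI impI)
    show "1 \<le> C" using K2 by (simp add: C_def)
    fix \<epsilon> \<tau> y z
    assume y: "approx_ode m \<alpha> \<beta> \<epsilon> \<tau> y" and z: "approx_ode m \<alpha> \<beta> \<epsilon> \<tau> z" and tau: "0 \<le> \<tau>" "\<tau> \<le> 1"
      and eps: "0 \<le> \<epsilon>" "\<epsilon> \<le> 1" and small: "\<tau> * ((norm (y 0))\<^sup>2 + (norm (z 0))\<^sup>2) \<le> 1"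
    define d1 where "d1 = (\<lambda>s. (cmod (fst (y s) - fst (z s)))\<^sup>2)"
    define d2 where "d2 = (\<lambda>s. (cmod (snd (y s) - snd (z s)))\<^sup>2)"
    define r s where "r \<sigma> = (cmod (fst (y \<sigma>)))\<^sup>2 + (cmod (fst (z \<sigma>)))\<^sup>2" and "s \<sigma> = (cmod (snd (y \<sigma>)))\<^sup>2 + (cmod (snd (z \<sigma>)))\<^sup>2" for \<sigma>
    \<comment> \<open>The weights are frozen at the beginning of the step, which makes
      \<open>E\<close> satisfy a closed linear inequality with rate \<open>W * K2\<close>, where
      \<open>W = 2 + s 0 + r 0\<close>. Since \<open>W * \<tau>\<close> is at most 3,
      \<open>E\<close> stays comparable to its initial value.\<close>
    define E where "E = (\<lambda>\<sigma>. (1 + s 0) * d1 \<sigma> + (1 + r 0) * d2 \<sigma>)"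
    have nn: "0 \<le> d1 \<sigma>" "0 \<le> d2 \<sigma>" "0 \<le> r \<sigma>" "0 \<le> s \<sigma>" for \<sigma> by (auto simp: d1_def d2_def r_def s_def)
    have sy: "\<tau> * (norm (y 0))\<^sup>2 \<le> 1" and sz: "\<tau> * (norm (z 0))\<^sup>2 \<le> 1"
    proof -
      have "0 \<le> \<tau> * (norm (y 0))\<^sup>2" "0 \<le> \<tau> * (norm (z 0))\<^sup>2" using tau by auto
      then show "\<tau> * (norm (y 0))\<^sup>2 \<le> 1" "\<tau> * (norm (z 0))\<^sup>2 \<le> 1"
        using small unfolding distrib_left by linarith+
    qed
    have nsw: "norm (prod.swap e) = norm e" for e :: "complex \<times> complex"
      by (simp add: norm_prod_def add.commute prod.swap_def)
    have comb: "1 + (a' + b') \<le> 2 * C1 * (1 + (a + b))"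
      if "1 + a' \<le> C1 * (1 + a)" "1 + b' \<le> C1 * (1 + b)" "0 \<le> a" "0 \<le> b" for a b a' b' :: real
    proof -
      have "1 + (a' + b') \<le> C1 * ((1 + a) + (1 + b))" using that unfolding distrib_left by linarith
      also have "\<dots> \<le> C1 * (2 * (1 + (a + b)))" using C1 that by (intro mult_left_mono) auto
      finally show ?thesis by (simp add: algebra_simps)
    qed
    have rb: "1 + r \<sigma> \<le> 2 * C1 * (1 + r 0)" if "\<sigma> \<in> {0..\<tau>}" for \<sigma>
      unfolding r_def C1_def K_def
      by (rule comb[unfolded C1_def K_def]) (use that y z tau eps sy sz in \<open>auto intro!: approx_ode_fst_bound\<close>)
    have sb: "1 + s \<sigma> \<le> 2 * C1 * (1 + s 0)" if "\<sigma> \<in> {0..\<tau>}" for \<sigma>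
      using approx_ode_fst_bound[OF approx_ode_swap[OF y] that tau(2) eps]
        approx_ode_fst_bound[OF approx_ode_swap[OF z] that tau(2) eps] sy sz
      unfolding s_def nsw C1_def K_def by (intro comb[unfolded C1_def K_def]) auto
    have main: "K * ((1 + s \<sigma>) * d1 \<sigma> + (1 + r \<sigma>) * d2 \<sigma>) \<le> K2 * E \<sigma>" if "\<sigma> \<in> {0..\<tau>}" for \<sigma>
    proof -
      have "(1 + s \<sigma>) * d1 \<sigma> + (1 + r \<sigma>) * d2 \<sigma> \<le> 2 * C1 * (1 + s 0) * d1 \<sigma> + 2 * C1 * (1 + r 0) * d2 \<sigma>"
        using rb[OF that] sb[OF that] nn by (intro add_mono mult_right_mono) auto
      then have "K * ((1 + s \<sigma>) * d1 \<sigma> + (1 + r \<sigma>) * d2 \<sigma>) \<le> K * (2 * C1 * (1 + s 0) * d1 \<sigma> + 2 * C1 * (1 + r 0) * d2 \<sigma>)"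
        using K by (intro mult_left_mono) auto
      then show ?thesis by (simp add: K2_def E_def algebra_simps)
    qed
    have "\<exists>D. (d1 has_real_derivative D) (at \<sigma> within {0..\<tau>}) \<and> D \<le> K2 * E \<sigma> + 4 * \<epsilon>\<^sup>2" if "\<sigma> \<in> {0..\<tau>}" for \<sigma>
      using approx_ode_fst_diff[OF y z that] main[OF that] unfolding d1_def d2_def r_def s_def K_def by force
    then obtain D1 where D1: "\<And>\<sigma>. \<sigma> \<in> {0..\<tau>} \<Longrightarrow> (d1 has_real_derivative D1 \<sigma>) (at \<sigma> within {0..\<tau>})"
      "\<And>\<sigma>. \<sigma> \<in> {0..\<tau>} \<Longrightarrow> D1 \<sigma> \<le> K2 * E \<sigma> + 4 * \<epsilon>\<^sup>2" by metis
    have "\<exists>D. (d2 has_real_derivative D) (at \<sigma> within {0..\<tau>}) \<and> D \<le> K2 * E \<sigma> + 4 * \<epsilon>\<^sup>2" if "\<sigma> \<in> {0..\<tau>}" for \<sigma>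
      using approx_ode_snd_diff[OF y z that] main[OF that] unfolding d1_def d2_def r_def s_def K_def by force
    then obtain D2 where D2: "\<And>\<sigma>. \<sigma> \<in> {0..\<tau>} \<Longrightarrow> (d2 has_real_derivative D2 \<sigma>) (at \<sigma> within {0..\<tau>})"
      "\<And>\<sigma>. \<sigma> \<in> {0..\<tau>} \<Longrightarrow> D2 \<sigma> \<le> K2 * E \<sigma> + 4 * \<epsilon>\<^sup>2" by metis
    define W where "W = 2 + s 0 + r 0"
    have W0: "0 \<le> W" using nn[of 0] by (simp add: W_def)
    have "\<tau> * (s 0 + r 0) \<le> 1" using small by (simp add: s_def r_def norm_prod_def algebra_simps)
    then have W: "W * t \<le> 3" if "t \<in> {0..\<tau>}" for t
      using that tau W0 mult_left_mono[of t \<tau> W] by (auto simp: W_def algebra_simps)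
    have Eb: "E t \<le> exp (3 * K2) * (E 0 + 12 * \<epsilon>\<^sup>2)" if t: "t \<in> {0..\<tau>}" for t
    proof -
      have "E t \<le> exp ((W * K2) * t) * (E 0 + (W * (4 * \<epsilon>\<^sup>2)) * t)"
      proof (rule gronwall_differential[OF _ _ _ _ t])
        fix \<sigma> assume \<sigma>: "\<sigma> \<in> {0..\<tau>}"
        show "(E has_real_derivative ((1 + s 0) * D1 \<sigma> + (1 + r 0) * D2 \<sigma>)) (at \<sigma> within {0..\<tau>})"
          unfolding E_def using D1(1)[OF \<sigma>] D2(1)[OF \<sigma>] by (auto intro!: derivative_eq_intros)
        have "(1 + s 0) * D1 \<sigma> + (1 + r 0) * D2 \<sigma> \<le> (1 + s 0) * (K2 * E \<sigma> + 4 * \<epsilon>\<^sup>2) + (1 + r 0) * (K2 * E \<sigma> + 4 * \<epsilon>\<^sup>2)"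
          using nn[of 0] D1(2)[OF \<sigma>] D2(2)[OF \<sigma>] by (intro add_mono mult_left_mono) auto
        then show "(1 + s 0) * D1 \<sigma> + (1 + r 0) * D2 \<sigma> \<le> W * K2 * E \<sigma> + W * (4 * \<epsilon>\<^sup>2)"
          by (simp add: W_def algebra_simps)
      qed (use W0 K2 in auto)
      also have "\<dots> \<le> exp (3 * K2) * (E 0 + 12 * \<epsilon>\<^sup>2)"
      proof (rule mult_mono)
        show "exp (W * K2 * t) \<le> exp (3 * K2)" using mult_right_mono[OF W[OF t] K2] by (simp add: algebra_simps)
        show "E 0 + W * (4 * \<epsilon>\<^sup>2) * t \<le> E 0 + 12 * \<epsilon>\<^sup>2"
          using mult_right_mono[OF W[OF t], of "4 * \<epsilon>\<^sup>2"] by (simp add: algebra_simps)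
        show "0 \<le> E 0 + W * (4 * \<epsilon>\<^sup>2) * t" using nn[of 0] W0 t by (simp add: E_def)
      qed auto
      finally show ?thesis .
    qed
    define B where "B = K2 * (exp (3 * K2) * (E 0 + 12 * \<epsilon>\<^sup>2)) + 4 * \<epsilon>\<^sup>2"
    have E0: "0 \<le> E 0" using nn[of 0] by (simp add: E_def)
    have B: "0 \<le> B" "K2 * E \<sigma> + 4 * \<epsilon>\<^sup>2 \<le> B" if "\<sigma> \<in> {0..\<tau>}" for \<sigma>
      unfolding B_def using E0 K2 Eb[OF that] by (auto intro: mult_left_mono)
    \<comment> \<open>With \<open>E\<close> under control the derivatives of \<open>d1\<close> and
      \<open>d2\<close> are bounded by the constant \<open>B\<close>. Plain integration, Gronwall
      with rate 0, keeps the coefficient of \<open>d1 0\<close> equal to one.\<close>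
    have "d1 \<tau> \<le> exp (0 * \<tau>) * (d1 0 + B * \<tau>)"
      by (rule gronwall_differential[OF D1(1)]) (use tau B D1(2) in \<open>force+\<close>)
    moreover have "d2 \<tau> \<le> exp (0 * \<tau>) * (d2 0 + B * \<tau>)"
      by (rule gronwall_differential[OF D2(1)]) (use tau B D2(2) in \<open>force+\<close>)
    moreover have "B * \<tau> \<le> C * \<tau> * (E 0 + \<epsilon>\<^sup>2)"
    proof -
      have "0 \<le> (11 * K2 * exp (3 * K2) + 4) * E 0" using K2 E0 by simp
      then have "B \<le> C * (E 0 + \<epsilon>\<^sup>2)" by (simp add: B_def C_def algebra_simps)
      from mult_right_mono[OF this tau(1)] show ?thesis by (simp add: algebra_simps)
    qed
    ultimately have "d1 \<tau> \<le> d1 0 + C * \<tau> * (E 0 + \<epsilon>\<^sup>2)" "d2 \<tau> \<le> d2 0 + C * \<tau> * (E 0 + \<epsilon>\<^sup>2)" by auto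
    then show "let d1 = \<lambda>s. (cmod (fst (y s) - fst (z s)))\<^sup>2; d2 = \<lambda>s. (cmod (snd (y s) - snd (z s)))\<^sup>2;
        r = (cmod (fst (y 0)))\<^sup>2 + (cmod (fst (z 0)))\<^sup>2; s = (cmod (snd (y 0)))\<^sup>2 + (cmod (snd (z 0)))\<^sup>2;
        g = C * \<tau> * ((1 + s) * d1 0 + (1 + r) * d2 0 + \<epsilon>\<^sup>2)
      in d1 \<tau> \<le> d1 0 + g \<and> d2 \<tau> \<le> d2 0 + g"
      by (simp add: Let_def d1_def d2_def r_def s_def E_def)
  qed
qed

text \<open>The scheme fixes each new value through some solution curve, chosen separately for every
  x; uniqueness makes the values within a cell agree. As no relation between \<tau> and the charge
  is assumed, the Lipschitz constant is taken on the ball given by the charge bound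
  \<open>M\<close>.\<close>

lemma approx_ode_unique:
  assumes y: "approx_ode m \<alpha> \<beta> 0 \<tau> y" and z: "approx_ode m \<alpha> \<beta> 0 \<tau> z" and 0: "y 0 = z 0" and tau: "0 \<le> \<tau>"
  shows "y \<tau> = z \<tau>"
proof -
  define K where "K = rate m \<alpha> \<beta>"
  define M where "M = exp \<tau> * (norm (y 0))\<^sup>2"
  define d where "d = (\<lambda>s. (cmod (fst (y s) - fst (z s)))\<^sup>2 + (cmod (snd (y s) - snd (z s)))\<^sup>2)"
  have K: "1 \<le> K" unfolding K_def by (rule rate_ge_1)
  have M: "(norm (y s))\<^sup>2 \<le> M" "(norm (z s))\<^sup>2 \<le> M" if "s \<in> {0..\<tau>}" for s
    using approx_ode_charge[OF y that] approx_ode_charge[OF z that] 0 that mult_right_mono[of "exp s" "exp \<tau>" "(norm (y 0))\<^sup>2"]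
    by (auto simp: M_def)
  have "\<exists>D. (d has_real_derivative D) (at s within {0..\<tau>}) \<and> D \<le> 2 * K * (1 + 2 * M) * d s + 0" if s: "s \<in> {0..\<tau>}" for s
  proof -
    let ?X = "(1 + ((cmod (snd (y s)))\<^sup>2 + (cmod (snd (z s)))\<^sup>2)) * (cmod (fst (y s) - fst (z s)))\<^sup>2
       + (1 + ((cmod (fst (y s)))\<^sup>2 + (cmod (fst (z s)))\<^sup>2)) * (cmod (snd (y s) - snd (z s)))\<^sup>2"
    obtain D1 where D1: "((\<lambda>s. (cmod (fst (y s) - fst (z s)))\<^sup>2) has_real_derivative D1) (at s within {0..\<tau>})" "D1 \<le> K * ?X"
      using approx_ode_fst_diff[OF y z s] by (auto simp: K_def)
    obtain D2 where D2: "((\<lambda>s. (cmod (snd (y s) - snd (z s)))\<^sup>2) has_real_derivative D2) (at s within {0..\<tau>})" "D2 \<le> K * ?X"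
      using approx_ode_snd_diff[OF y z s] by (auto simp: K_def)
    have "?X \<le> (1 + 2 * M) * (cmod (fst (y s) - fst (z s)))\<^sup>2 + (1 + 2 * M) * (cmod (snd (y s) - snd (z s)))\<^sup>2"
    proof -
      have "(norm w)\<^sup>2 = (cmod (fst w))\<^sup>2 + (cmod (snd w))\<^sup>2" for w :: "complex \<times> complex" by (simp add: norm_prod_def)
      then show ?thesis using M[OF s] by (intro add_mono mult_right_mono) (smt (verit) zero_le_power2)+
    qed
    then have "K * ?X \<le> K * ((1 + 2 * M) * d s)" using K by (intro mult_left_mono) (auto simp: d_def distrib_left)
    then have "D1 + D2 \<le> 2 * K * (1 + 2 * M) * d s + 0" using D1(2) D2(2) by (simp add: algebra_simps)
    moreover have "(d has_real_derivative D1 + D2) (at s within {0..\<tau>})"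
      unfolding d_def by (intro DERIV_add D1(1) D2(1))
    ultimately show ?thesis by blast
  qed
  then obtain D where D: "\<And>s. s \<in> {0..\<tau>} \<Longrightarrow> (d has_real_derivative D s) (at s within {0..\<tau>})"
      "\<And>s. s \<in> {0..\<tau>} \<Longrightarrow> D s \<le> 2 * K * (1 + 2 * M) * d s + 0" by metis
  have "0 \<le> 2 * K * (1 + 2 * M)" using K by (simp add: M_def)
  then have "d \<tau> \<le> exp (2 * K * (1 + 2 * M) * \<tau>) * (d 0 + 0 * \<tau>)"
    by (intro gronwall_differential[OF D]) (use tau in auto)
  also have "\<dots> = 0" by (simp add: d_def 0)
  finally have "(cmod (fst (y \<tau>) - fst (z \<tau>)))\<^sup>2 + (cmod (snd (y \<tau>) - snd (z \<tau>)))\<^sup>2 \<le> 0" by (simp add: d_def)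
  then show ?thesis by (simp add: sum_power2_le_zero_iff prod_eq_iff)
qed

subsection \<open>The interaction potential on the lattice\<close>

text \<open>Counts the pairs of a right-mover at \<open>i\<close> and a left-mover at
  \<open>k\<close> that still approach each other inside the section from \<open>A\<close> to
  \<open>B\<close>. It is the lattice form of the double integral of a(x) b(y) over x < y.\<close>

definition glimm :: "int \<Rightarrow> int \<Rightarrow> (int \<Rightarrow> real) \<Rightarrow> (int \<Rightarrow> real) \<Rightarrow> real" where
  "glimm A B a b = (\<Sum>(i, k) \<in> {(i, k). A \<le> i \<and> i < k \<and> k \<le> B}. a i * b k)"

lemma finite_index_pairs: "finite {(i, k). A \<le> i \<and> i < k \<and> k \<le> (B::int)}"
  by (rule finite_subset[of _ "{A..B} \<times> {A..B}"]) auto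

lemma glimm_nonneg: "(\<And>j. 0 \<le> a j) \<Longrightarrow> (\<And>j. 0 \<le> b j) \<Longrightarrow> 0 \<le> glimm A B a b"
  unfolding glimm_def by (intro sum_nonneg) auto

lemma glimm_le_product:
  assumes "\<And>j. 0 \<le> a j" "\<And>j. 0 \<le> b j"
  shows "glimm A B a b \<le> (\<Sum>j=A..B. a j) * (\<Sum>j=A..B. b j)"
proof -
  have "glimm A B a b \<le> (\<Sum>(i, k) \<in> {A..B} \<times> {A..B}. a i * b k)"
    unfolding glimm_def by (intro sum_mono2) (auto simp: assms)
  then show ?thesis by (simp add: sum_product sum.cartesian_product)
qed

text \<open>A pair at (i, k) comes from (i - 1, k + 1), so distances shrink by two. Former pairs at
  distance two now share a site; they form the extra sum on the left. Former pairs at distance one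
  have passed each other between two sites, and dropping them leaves an inequality.\<close>

lemma glimm_transport:
  assumes "\<And>j. 0 \<le> a j" "\<And>j. 0 \<le> b j"
  shows "glimm (A + 1) (B - 1) (\<lambda>j. a (j - 1)) (\<lambda>j. b (j + 1)) + (\<Sum>j\<in>{A+1..B-1}. a (j - 1) * b (j + 1))
    \<le> glimm A B a b"
proof -
  let ?S = "{(i, k). A + 1 \<le> i \<and> i < k \<and> k \<le> B - 1}" and ?D = "(\<lambda>j. (j, j)) ` {A+1..B-1}"
  let ?f = "\<lambda>(i, k). a (i - 1) * b (k + 1)" and ?h = "\<lambda>(i, k). (i - 1, k + 1 :: int)"
  have "glimm (A + 1) (B - 1) (\<lambda>j. a (j - 1)) (\<lambda>j. b (j + 1)) + (\<Sum>j\<in>{A+1..B-1}. a (j - 1) * b (j + 1)) = sum ?f ?S + sum ?f ?D"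
    by (simp add: glimm_def sum.reindex inj_on_def)
  also have "\<dots> = sum ?f (?S \<union> ?D)"
    by (rule sum.union_disjoint[symmetric]) (rule finite_index_pairs, auto)
  also have "\<dots> = sum (\<lambda>(i, k). a i * b k) (?h ` (?S \<union> ?D))"
    by (subst sum.reindex) (auto simp: inj_on_def case_prod_unfold)
  also have "\<dots> \<le> glimm A B a b"
    unfolding glimm_def by (intro sum_mono2 finite_index_pairs) (auto simp: assms)
  finally show ?thesis .
qed

lemma glimm_le_sum3:
  assumes "\<And>i k. A \<le> i \<Longrightarrow> i < k \<Longrightarrow> k \<le> B \<Longrightarrow> a i * b k \<le> a1 i * b1 k + a2 i * b2 k + a3 i * b3 k"
  shows "glimm A B a b \<le> glimm A B a1 b1 + glimm A B a2 b2 + glimm A B a3 b3"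
  unfolding glimm_def sum.distrib[symmetric] by (intro sum_mono) (auto simp: assms)

text \<open>Right-moving and left-moving particles that cross leave the potential for good; their
  interaction is the subtracted sum.\<close>
lemma glimm_step:
  assumes nn: "\<And>j. 0 \<le> a j" "\<And>j. 0 \<le> b j" "\<And>j. 0 \<le> a' j" "\<And>j. 0 \<le> b' j" "\<And>j. 0 \<le> e j" "\<And>j. 0 \<le> f j"
    and a': "\<And>j. j \<in> {A+1..B-1} \<Longrightarrow> a' j \<le> a (j - 1) + e j"
    and b': "\<And>j. j \<in> {A+1..B-1} \<Longrightarrow> b' j \<le> b (j + 1) + f j"
  defines "I \<equiv> {A+1..B-1}" and "X \<equiv> glimm A B a b - (\<Sum>j\<in>{A+1..B-1}. a (j - 1) * b (j + 1))"
  shows "glimm (A + 1) (B - 1) a' b' \<le> X + (\<Sum>j\<in>I. e j) * (\<Sum>j\<in>I. b' j) + (\<Sum>j\<in>I. a (j - 1)) * (\<Sum>j\<in>I. f j)"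
    and "glimm (A + 1) (B - 1) a' b' \<le> X + (\<Sum>j\<in>I. e j) * (\<Sum>j\<in>I. b (j + 1)) + (\<Sum>j\<in>I. a' j) * (\<Sum>j\<in>I. f j)"
proof -
  let ?g = "glimm (A + 1) (B - 1)" and ?a = "\<lambda>j. a (j - 1)" and ?b = "\<lambda>j. b (j + 1)"
  have X: "?g ?a ?b \<le> X" using glimm_transport[of a b A B] nn by (simp add: X_def)
  have "?g a' b' \<le> ?g ?a ?b + ?g e b' + ?g ?a f"
  proof (rule glimm_le_sum3)
    fix i k assume "A + 1 \<le> i" "i < k" "k \<le> B - 1"
    then have "a' i * b' k \<le> (a (i - 1) + e i) * b' k" "a (i - 1) * b' k \<le> a (i - 1) * (b (k + 1) + f k)"
      using a' b' nn by (auto intro!: mult_right_mono mult_left_mono)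
    then show "a' i * b' k \<le> a (i - 1) * b (k + 1) + e i * b' k + a (i - 1) * f k" by (simp add: algebra_simps)
  qed
  moreover have "?g e b' \<le> (\<Sum>j\<in>I. e j) * (\<Sum>j\<in>I. b' j)" "?g ?a f \<le> (\<Sum>j\<in>I. a (j - 1)) * (\<Sum>j\<in>I. f j)"
    unfolding I_def using nn by (intro glimm_le_product; simp)+
  ultimately show "?g a' b' \<le> X + (\<Sum>j\<in>I. e j) * (\<Sum>j\<in>I. b' j) + (\<Sum>j\<in>I. a (j - 1)) * (\<Sum>j\<in>I. f j)"
    using X by linarith
  have "?g a' b' \<le> ?g ?a ?b + ?g e ?b + ?g a' f"
  proof (rule glimm_le_sum3)
    fix i k assume "A + 1 \<le> i" "i < k" "k \<le> B - 1"
    then have "a' i * b' k \<le> a' i * (b (k + 1) + f k)" "a' i * b (k + 1) \<le> (a (i - 1) + e i) * b (k + 1)"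
      using a' b' nn by (auto intro!: mult_right_mono mult_left_mono)
    then show "a' i * b' k \<le> a (i - 1) * b (k + 1) + e i * b (k + 1) + a' i * f k" by (simp add: algebra_simps)
  qed
  moreover have "?g e ?b \<le> (\<Sum>j\<in>I. e j) * (\<Sum>j\<in>I. b (j + 1))" "?g a' f \<le> (\<Sum>j\<in>I. a' j) * (\<Sum>j\<in>I. f j)"
    unfolding I_def using nn by (intro glimm_le_product; simp)+
  ultimately show "?g a' b' \<le> X + (\<Sum>j\<in>I. e j) * (\<Sum>j\<in>I. b (j + 1)) + (\<Sum>j\<in>I. a' j) * (\<Sum>j\<in>I. f j)"
    using X by linarith
qed

lemma sum_shift_le:
  fixes a :: "int \<Rightarrow> real"
  assumes "\<And>j. 0 \<le> a j"
  shows "(\<Sum>j\<in>{A+1..B-1}. a (j - 1)) \<le> (\<Sum>j=A..B. a j)" "(\<Sum>j\<in>{A+1..B-1}. a (j + 1)) \<le> (\<Sum>j=A..B. a j)"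
proof -
  have "(\<Sum>j\<in>{A+1..B-1}. a (j - 1)) = sum a ((\<lambda>j. j - 1) ` {A+1..B-1})" by (subst sum.reindex) (auto simp: inj_on_def)
  also have "\<dots> \<le> sum a {A..B}" by (intro sum_mono2) (auto simp: assms)
  finally show "(\<Sum>j\<in>{A+1..B-1}. a (j - 1)) \<le> (\<Sum>j=A..B. a j)" .
  have "(\<Sum>j\<in>{A+1..B-1}. a (j + 1)) = sum a ((\<lambda>j. j + 1) ` {A+1..B-1})" by (subst sum.reindex) (auto simp: inj_on_def)
  also have "\<dots> \<le> sum a {A..B}" by (intro sum_mono2) (auto simp: assms)
  finally show "(\<Sum>j\<in>{A+1..B-1}. a (j + 1)) \<le> (\<Sum>j=A..B. a j)" .
qed

text \<open>Charges carry one factor \<tau> and potentials two, which makes them independent of the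
  mesh; therefore the crossing sums \<open>\<Gamma>\<close> and \<open>D\<close> are subtracted with
  a factor \<tau>. \<open>F\<close> and \<open>G\<close> are the increments that one ODE step
  permits for densities and differences. The bound on the length of the section turns the sum of the
  forcing over all sites into a single \<open>\<epsilon>2\<close>.\<close>

lemma interaction_step:
  fixes r s d1 d2 r' s' d1' d2' :: "int \<Rightarrow> real"
  assumes C: "0 \<le> C" and tau: "0 < \<tau>" and len: "\<tau> * real_of_int (B - A + 1) \<le> 1" and AB: "A \<le> B + 1" and eps: "0 \<le> \<epsilon>2"
    and nn: "\<And>j. 0 \<le> r j" "\<And>j. 0 \<le> s j" "\<And>j. 0 \<le> d1 j" "\<And>j. 0 \<le> d2 j"
      "\<And>j. 0 \<le> r' j" "\<And>j. 0 \<le> s' j" "\<And>j. 0 \<le> d1' j" "\<And>j. 0 \<le> d2' j"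
  defines "F \<equiv> \<lambda>j. C * \<tau> * (r (j-1) + s (j+1) + 2 * (r (j-1) * s (j+1)) + 2 * \<epsilon>2)"
    and "G \<equiv> \<lambda>j. C * \<tau> * ((1 + s (j+1)) * d1 (j-1) + (1 + r (j-1)) * d2 (j+1) + \<epsilon>2)"
  assumes r': "\<And>j. j \<in> {A+1..B-1} \<Longrightarrow> r' j \<le> r (j-1) + F j" and s': "\<And>j. j \<in> {A+1..B-1} \<Longrightarrow> s' j \<le> s (j+1) + F j"
    and d1': "\<And>j. j \<in> {A+1..B-1} \<Longrightarrow> d1' j \<le> d1 (j-1) + G j" and d2': "\<And>j. j \<in> {A+1..B-1} \<Longrightarrow> d2' j \<le> d2 (j+1) + G j"
    and mass: "\<tau> * (\<Sum>j=A..B. r j + s j) \<le> \<delta>" and mass': "\<tau> * (\<Sum>j\<in>{A+1..B-1}. r' j + s' j) \<le> \<delta>"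
  defines "L \<equiv> \<tau> * (\<Sum>j=A..B. d1 j + d2 j)" and "L' \<equiv> \<tau> * (\<Sum>j\<in>{A+1..B-1}. d1' j + d2' j)"
    and "\<Gamma> \<equiv> \<tau> * (\<Sum>j\<in>{A+1..B-1}. r (j-1) * s (j+1))"
    and "D \<equiv> \<tau> * (\<Sum>j\<in>{A+1..B-1}. d1 (j-1) * s (j+1) + r (j-1) * d2 (j+1))"
    and "P \<equiv> \<tau>\<^sup>2 * glimm A B r s" and "P' \<equiv> \<tau>\<^sup>2 * glimm (A+1) (B-1) r' s'"
    and "Q \<equiv> \<tau>\<^sup>2 * (glimm A B d1 s + glimm A B r d2)"
    and "Q' \<equiv> \<tau>\<^sup>2 * (glimm (A+1) (B-1) d1' s' + glimm (A+1) (B-1) r' d2')"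
  shows "P' \<le> P - \<tau> * \<Gamma> + 2 * \<delta> * (C * \<tau> * (\<delta> + 2 * \<Gamma> + 2 * \<epsilon>2))"
    and "L' \<le> L + 2 * (C * \<tau> * (L + D + \<epsilon>2))"
    and "Q' \<le> Q - \<tau> * D + \<delta> * (C * \<tau> * (L + D + \<epsilon>2)) + L * (C * \<tau> * (\<delta> + 2 * \<Gamma> + 2 * \<epsilon>2))"
proof -
  let ?I = "{A+1..B-1}"
  have Fn: "0 \<le> F j" and Gn: "0 \<le> G j" for j using C tau eps nn by (auto simp: F_def G_def intro!: mult_nonneg_nonneg add_nonneg_nonneg)
  define \<rho> where "\<rho> = \<tau> * (\<Sum>j\<in>?I. r (j-1))"
  define \<sigma> where "\<sigma> = \<tau> * (\<Sum>j\<in>?I. s (j+1))"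
  define x where "x = \<tau> * (\<Sum>j\<in>?I. d1 (j-1))"
  define y where "y = \<tau> * (\<Sum>j\<in>?I. d2 (j+1))"
  define \<rho>' where "\<rho>' = \<tau> * (\<Sum>j\<in>?I. r' j)"
  define \<sigma>' where "\<sigma>' = \<tau> * (\<Sum>j\<in>?I. s' j)"
  define \<Phi> where "\<Phi> = \<tau> * (\<Sum>j\<in>?I. F j)"
  define \<Psi> where "\<Psi> = \<tau> * (\<Sum>j\<in>?I. G j)"
  have nn': "0 \<le> \<rho>" "0 \<le> \<sigma>" "0 \<le> x" "0 \<le> y" "0 \<le> \<rho>'" "0 \<le> \<sigma>'" "0 \<le> \<Phi>" "0 \<le> \<Psi>"
    using tau nn Fn Gn unfolding \<rho>_def \<sigma>_def x_def y_def \<rho>'_def \<sigma>'_def \<Phi>_def \<Psi>_def by (auto intro!: mult_nonneg_nonneg sum_nonneg)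
  have m1: "\<rho> + \<sigma> \<le> \<delta>"
  proof -
    have "\<rho> + \<sigma> \<le> \<tau> * ((\<Sum>j=A..B. r j) + (\<Sum>j=A..B. s j))"
      unfolding \<rho>_def \<sigma>_def distrib_left using tau nn by (intro add_mono mult_left_mono sum_shift_le) auto
    then show ?thesis using mass by (simp add: sum.distrib)
  qed
  have m2: "\<rho>' + \<sigma>' \<le> \<delta>" using mass' by (simp add: \<rho>'_def \<sigma>'_def sum.distrib distrib_left)
  have xy: "x + y \<le> L"
  proof -
    have "x + y \<le> \<tau> * ((\<Sum>j=A..B. d1 j) + (\<Sum>j=A..B. d2 j))"
      unfolding x_def y_def distrib_left using tau nn by (intro add_mono mult_left_mono sum_shift_le) auto
    then show ?thesis by (simp add: sum.distrib L_def)
  qed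
  have card: "\<tau> * real (card ?I) \<le> 1"
  proof -
    have "\<tau> * real (card ?I) \<le> \<tau> * real_of_int (B - A + 1)" using tau AB by (intro mult_left_mono) auto
    then show ?thesis using len by simp
  qed
  have \<Phi>: "\<Phi> \<le> C * \<tau> * (\<delta> + 2 * \<Gamma> + 2 * \<epsilon>2)"
  proof -
    have "\<Phi> = C * \<tau> * (\<rho> + \<sigma> + 2 * \<Gamma> + 2 * \<epsilon>2 * (\<tau> * real (card ?I)))"
      by (simp add: \<Phi>_def F_def \<rho>_def \<sigma>_def \<Gamma>_def sum.distrib sum_distrib_left[symmetric] algebra_simps)
    also have "\<dots> \<le> C * \<tau> * (\<delta> + 2 * \<Gamma> + 2 * \<epsilon>2 * 1)"
      using m1 card C tau eps by (intro mult_left_mono add_mono) auto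
    finally show ?thesis by simp
  qed
  have \<Psi>: "\<Psi> \<le> C * \<tau> * (L + D + \<epsilon>2)"
  proof -
    have "\<Psi> = C * \<tau> * (x + y + D + \<epsilon>2 * (\<tau> * real (card ?I)))"
      by (simp add: \<Psi>_def G_def x_def y_def D_def sum.distrib sum_distrib_left[symmetric] algebra_simps)
    also have "\<dots> \<le> C * \<tau> * (L + D + \<epsilon>2 * 1)"
      using xy card C tau eps by (intro mult_left_mono add_mono) auto
    finally show ?thesis by simp
  qed
  have \<delta>0: "0 \<le> \<delta>" using m1 nn' by linarith
  show "L' \<le> L + 2 * (C * \<tau> * (L + D + \<epsilon>2))"
  proof -
    have "(\<Sum>j\<in>?I. d1' j + d2' j) \<le> (\<Sum>j\<in>?I. (d1 (j-1) + G j) + (d2 (j+1) + G j))"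
      using d1' d2' by (intro sum_mono add_mono) auto
    then have "L' \<le> \<tau> * (\<Sum>j\<in>?I. (d1 (j-1) + G j) + (d2 (j+1) + G j))"
      unfolding L'_def using tau by (intro mult_left_mono) auto
    also have "\<dots> = x + y + 2 * \<Psi>" by (simp add: x_def y_def \<Psi>_def sum.distrib distrib_left sum_distrib_left[symmetric])
    finally show ?thesis using xy \<Psi> by linarith
  qed
  show "P' \<le> P - \<tau> * \<Gamma> + 2 * \<delta> * (C * \<tau> * (\<delta> + 2 * \<Gamma> + 2 * \<epsilon>2))"
  proof -
    have "glimm (A + 1) (B - 1) r' s' \<le> glimm A B r s - (\<Sum>j\<in>?I. r (j - 1) * s (j + 1))
        + (\<Sum>j\<in>?I. F j) * (\<Sum>j\<in>?I. s' j) + (\<Sum>j\<in>?I. r (j - 1)) * (\<Sum>j\<in>?I. F j)"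
      by (rule glimm_step(1)) (use nn Fn r' s' in auto)
    then have "P' \<le> \<tau>\<^sup>2 * (glimm A B r s - (\<Sum>j\<in>?I. r (j - 1) * s (j + 1))
        + (\<Sum>j\<in>?I. F j) * (\<Sum>j\<in>?I. s' j) + (\<Sum>j\<in>?I. r (j - 1)) * (\<Sum>j\<in>?I. F j))"
      unfolding P'_def by (intro mult_left_mono) auto
    also have "\<dots> = P - \<tau> * \<Gamma> + \<Phi> * \<sigma>' + \<rho> * \<Phi>"
      by (simp add: P_def \<Gamma>_def \<Phi>_def \<sigma>'_def \<rho>_def power2_eq_square algebra_simps)
    also have "\<dots> \<le> P - \<tau> * \<Gamma> + \<Phi> * \<delta> + \<delta> * \<Phi>"
      using nn' m1 m2 by (intro add_mono mult_mono order.refl) auto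
    also have "\<dots> \<le> P - \<tau> * \<Gamma> + 2 * \<delta> * (C * \<tau> * (\<delta> + 2 * \<Gamma> + 2 * \<epsilon>2))"
      using mult_left_mono[OF \<Phi> \<delta>0] by (simp add: algebra_simps)
    finally show ?thesis .
  qed
  show "Q' \<le> Q - \<tau> * D + \<delta> * (C * \<tau> * (L + D + \<epsilon>2)) + L * (C * \<tau> * (\<delta> + 2 * \<Gamma> + 2 * \<epsilon>2))"
  proof -
    \<comment> \<open>The two expansions of a product of sums are chosen such that the increment
      \<open>G\<close> always meets a new density, whose sum is at most \<delta>, and
      \<open>F\<close> always an old difference, whose sum is at most \<open>L\<close>. Neither a
      new difference nor a product of two increments occurs.\<close>
    have 1: "glimm (A + 1) (B - 1) d1' s' \<le> glimm A B d1 s - (\<Sum>j\<in>?I. d1 (j - 1) * s (j + 1))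
        + (\<Sum>j\<in>?I. G j) * (\<Sum>j\<in>?I. s' j) + (\<Sum>j\<in>?I. d1 (j - 1)) * (\<Sum>j\<in>?I. F j)"
      by (rule glimm_step(1)) (use nn Fn Gn d1' s' in auto)
    have 2: "glimm (A + 1) (B - 1) r' d2' \<le> glimm A B r d2 - (\<Sum>j\<in>?I. r (j - 1) * d2 (j + 1))
        + (\<Sum>j\<in>?I. F j) * (\<Sum>j\<in>?I. d2 (j + 1)) + (\<Sum>j\<in>?I. r' j) * (\<Sum>j\<in>?I. G j)"
      by (rule glimm_step(2)) (use nn Fn Gn r' d2' in auto)
    have "Q' \<le> \<tau>\<^sup>2 * ((glimm A B d1 s - (\<Sum>j\<in>?I. d1 (j - 1) * s (j + 1))
        + (\<Sum>j\<in>?I. G j) * (\<Sum>j\<in>?I. s' j) + (\<Sum>j\<in>?I. d1 (j - 1)) * (\<Sum>j\<in>?I. F j))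
        + (glimm A B r d2 - (\<Sum>j\<in>?I. r (j - 1) * d2 (j + 1))
        + (\<Sum>j\<in>?I. F j) * (\<Sum>j\<in>?I. d2 (j + 1)) + (\<Sum>j\<in>?I. r' j) * (\<Sum>j\<in>?I. G j)))"
      unfolding Q'_def using 1 2 by (intro mult_left_mono add_mono) auto
    also have "\<dots> = Q - \<tau> * D + (\<rho>' + \<sigma>') * \<Psi> + (x + y) * \<Phi>"
      by (simp add: Q_def D_def \<Phi>_def \<Psi>_def \<sigma>'_def \<rho>'_def x_def y_def power2_eq_square sum.distrib algebra_simps)
    also have "\<dots> \<le> Q - \<tau> * D + \<delta> * \<Psi> + L * \<Phi>"
      using nn' xy m2 by (intro add_mono mult_right_mono) auto
    also have "\<dots> \<le> Q - \<tau> * D + \<delta> * (C * \<tau> * (L + D + \<epsilon>2)) + L * (C * \<tau> * (\<delta> + 2 * \<Gamma> + 2 * \<epsilon>2))"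
      using \<Phi> \<Psi> \<delta>0 xy nn' by (intro add_mono mult_left_mono) auto
    finally show ?thesis .
  qed
qed

section \<open>Summation of the one-step estimates over a cone\<close>

lemma discrete_gronwall:
  fixes F g h :: "nat \<Rightarrow> real"
  assumes step: "\<And>n. n < N \<Longrightarrow> F (Suc n) \<le> F n * (1 + g n) + h n"
    and nn: "\<And>n. n < N \<Longrightarrow> 0 \<le> g n" "\<And>n. n < N \<Longrightarrow> 0 \<le> h n" "0 \<le> F 0"
    and n: "n \<le> N"
  shows "F n \<le> exp (\<Sum>i<n. g i) * (F 0 + (\<Sum>i<n. h i))"
  using n
proof (induction n)
  case (Suc n)
  then have IH: "F n \<le> exp (\<Sum>i<n. g i) * (F 0 + (\<Sum>i<n. h i))" and n: "n < N" by auto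
  have "F (Suc n) \<le> F n * (1 + g n) + h n" using step[OF n] .
  also have "\<dots> \<le> (exp (\<Sum>i<n. g i) * (F 0 + (\<Sum>i<n. h i))) * exp (g n) + exp (\<Sum>i<Suc n. g i) * h n"
  proof (intro add_mono)
    have nonneg: "0 \<le> exp (\<Sum>i<n. g i) * (F 0 + (\<Sum>i<n. h i))"
      using nn n by (auto intro!: mult_nonneg_nonneg add_nonneg_nonneg sum_nonneg)
    have "F n * (1 + g n) \<le> (exp (\<Sum>i<n. g i) * (F 0 + (\<Sum>i<n. h i))) * (1 + g n)"
      using IH nn(1)[OF n] by (intro mult_right_mono) auto
    also have "\<dots> \<le> (exp (\<Sum>i<n. g i) * (F 0 + (\<Sum>i<n. h i))) * exp (g n)"
      using nonneg exp_ge_add_one_self[of "g n"] by (intro mult_left_mono) auto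
    finally show "F n * (1 + g n) \<le> \<dots>" .
    have "0 \<le> (\<Sum>i<Suc n. g i)" using nn n by (intro sum_nonneg) auto
    then have "1 \<le> exp (\<Sum>i<Suc n. g i)" by simp
    from mult_right_mono[OF this nn(2)[OF n]] show "h n \<le> exp (\<Sum>i<Suc n. g i) * h n" by simp
  qed
  also have "\<dots> = exp (\<Sum>i<Suc n. g i) * (F 0 + (\<Sum>i<Suc n. h i))"
    by (simp add: exp_add algebra_simps)
  finally show ?case .
qed simp

text \<open>\<open>L\<close> grows by \<open>2 * C * \<tau> * D\<close>, and \<open>D\<close> is not
  bounded by \<open>L\<close> uniformly in the mesh; but \<open>Q\<close> falls by
  \<open>\<tau> * D\<close>. In \<open>L + 4 * C * Q\<close> the fall pays for this growth and for
  the part of \<open>D\<close> that feeds back into \<open>Q\<close>, because 4 C \<delta> is at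
  most 1/2. What remains is proportional to \<open>L\<close> with a rate containing
  \<open>\<Gamma>\<close>, and \<open>\<Gamma>\<close> is summable in time by the same mechanism
  applied to the densities alone.\<close>

lemma discrete_stability:
  fixes r s d1 d2 :: "nat \<Rightarrow> int \<Rightarrow> real"
  assumes C: "1 \<le> C" and tau: "0 < \<tau>" and len: "\<tau> * real_of_int (B - A + 1) \<le> 1" and AB: "A + 2 * int N \<le> B + 1"
    and N: "real N * \<tau> \<le> 1" and eps: "0 \<le> \<epsilon>2" "\<epsilon>2 \<le> 1" and \<delta>: "8 * C * \<delta> \<le> 1"
    and nn: "\<And>n j. 0 \<le> r n j" "\<And>n j. 0 \<le> s n j" "\<And>n j. 0 \<le> d1 n j" "\<And>n j. 0 \<le> d2 n j"
  defines "F \<equiv> \<lambda>n j. C * \<tau> * (r n (j-1) + s n (j+1) + 2 * (r n (j-1) * s n (j+1)) + 2 * \<epsilon>2)"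
    and "G \<equiv> \<lambda>n j. C * \<tau> * ((1 + s n (j+1)) * d1 n (j-1) + (1 + r n (j-1)) * d2 n (j+1) + \<epsilon>2)"
    and "I \<equiv> \<lambda>n. {A + int n .. B - int n}"
  assumes r': "\<And>n j. n < N \<Longrightarrow> j \<in> I (Suc n) \<Longrightarrow> r (Suc n) j \<le> r n (j-1) + F n j"
    and s': "\<And>n j. n < N \<Longrightarrow> j \<in> I (Suc n) \<Longrightarrow> s (Suc n) j \<le> s n (j+1) + F n j"
    and d1': "\<And>n j. n < N \<Longrightarrow> j \<in> I (Suc n) \<Longrightarrow> d1 (Suc n) j \<le> d1 n (j-1) + G n j"
    and d2': "\<And>n j. n < N \<Longrightarrow> j \<in> I (Suc n) \<Longrightarrow> d2 (Suc n) j \<le> d2 n (j+1) + G n j"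
    and mass: "\<And>n. n \<le> N \<Longrightarrow> \<tau> * (\<Sum>j\<in>I n. r n j + s n j) \<le> \<delta>"
    and n: "n \<le> N"
  shows "\<tau> * (\<Sum>j\<in>I n. d1 n j + d2 n j) \<le> exp (100 * C\<^sup>2) * (5 * C) * (\<tau> * (\<Sum>j\<in>I 0. d1 0 j + d2 0 j) + \<epsilon>2)"
proof -
  define L where "L n = \<tau> * (\<Sum>j\<in>I n. d1 n j + d2 n j)" for n
  define \<Gamma> where "\<Gamma> n = \<tau> * (\<Sum>j\<in>I (Suc n). r n (j-1) * s n (j+1))" for n
  define D where "D n = \<tau> * (\<Sum>j\<in>I (Suc n). d1 n (j-1) * s n (j+1) + r n (j-1) * d2 n (j+1))" for n
  define P where "P n = \<tau>\<^sup>2 * glimm (A + int n) (B - int n) (r n) (s n)" for n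
  define Q where "Q n = \<tau>\<^sup>2 * (glimm (A + int n) (B - int n) (d1 n) (s n) + glimm (A + int n) (B - int n) (r n) (d2 n))" for n
  have Isuc: "{A + int n + 1..B - int n - 1} = I (Suc n)" for n by (auto simp: I_def)
  have g1: "A + int (Suc n) = A + int n + 1" "B - int (Suc n) = B - int n - 1" for n by auto
  have step: "P (Suc n) \<le> P n - \<tau> * \<Gamma> n + 2 * \<delta> * (C * \<tau> * (\<delta> + 2 * \<Gamma> n + 2 * \<epsilon>2))"
    "L (Suc n) \<le> L n + 2 * (C * \<tau> * (L n + D n + \<epsilon>2))"
    "Q (Suc n) \<le> Q n - \<tau> * D n + \<delta> * (C * \<tau> * (L n + D n + \<epsilon>2)) + L n * (C * \<tau> * (\<delta> + 2 * \<Gamma> n + 2 * \<epsilon>2))"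
    if n: "n < N" for n
  proof -
    have len': "\<tau> * real_of_int ((B - int n) - (A + int n) + 1) \<le> 1"
      using len tau by (smt (verit) mult_left_mono of_int_diff of_int_of_nat_eq of_nat_0_le_iff of_int_add)
    have AB': "A + int n \<le> (B - int n) + 1" using AB n by auto
    have m: "\<tau> * (\<Sum>j = A + int n..B - int n. r n j + s n j) \<le> \<delta>" using mass[of n] n by (simp add: I_def)
    have m': "\<tau> * (\<Sum>j = A + int n + 1..B - int n - 1. r (Suc n) j + s (Suc n) j) \<le> \<delta>"
      using mass[of "Suc n"] n unfolding Isuc by simp
    note * = interaction_step[where C = C and \<tau> = \<tau> and A = "A + int n" and B = "B - int n" and ?\<epsilon>2.0 = \<epsilon>2 and \<delta> = \<delta>
        and r = "r n" and s = "s n" and ?d1.0 = "d1 n" and ?d2.0 = "d2 n"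
        and r' = "r (Suc n)" and s' = "s (Suc n)" and d1' = "d1 (Suc n)" and d2' = "d2 (Suc n)",
        OF _ tau len' AB' eps(1) nn nn _ _ _ _ m m', unfolded Isuc,
        OF _ r'[unfolded F_def, OF n] s'[unfolded F_def, OF n] d1'[unfolded G_def, OF n] d2'[unfolded G_def, OF n]]
    have C0: "0 \<le> C" using C by simp
    show "P (Suc n) \<le> P n - \<tau> * \<Gamma> n + 2 * \<delta> * (C * \<tau> * (\<delta> + 2 * \<Gamma> n + 2 * \<epsilon>2))"
      using *(1)[OF C0] unfolding P_def \<Gamma>_def g1 by simp
    show "L (Suc n) \<le> L n + 2 * (C * \<tau> * (L n + D n + \<epsilon>2))"
      using *(2)[OF C0] unfolding L_def D_def I_def by simp
    show "Q (Suc n) \<le> Q n - \<tau> * D n + \<delta> * (C * \<tau> * (L n + D n + \<epsilon>2)) + L n * (C * \<tau> * (\<delta> + 2 * \<Gamma> n + 2 * \<epsilon>2))"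
      using *(3)[OF C0] unfolding Q_def D_def L_def \<Gamma>_def g1 I_def by simp
  qed
  have pos: "0 \<le> L n" "0 \<le> \<Gamma> n" "0 \<le> D n" "0 \<le> P n" "0 \<le> Q n" for n
    unfolding L_def \<Gamma>_def D_def P_def Q_def using tau nn by (auto intro!: mult_nonneg_nonneg sum_nonneg add_nonneg_nonneg glimm_nonneg)
  have \<delta>0: "0 \<le> \<delta>" using mass[of 0] tau nn by (smt (verit) le0 mult_nonneg_nonneg sum_nonneg)
  have \<delta>1: "\<delta> \<le> 1" using \<delta> C \<delta>0 by (smt (verit) mult_left_le_one_le mult_le_cancel_right1)
  have C\<delta>: "C * \<delta> \<le> 1 / 8" using \<delta> by simp
  \<comment> \<open>The feedback into \<open>P\<close> is at most a quarter of \<tau> (3 + 2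
    \<Gamma>). Its \<Gamma>-part is half of the decrease, so after moving it to the left and
    doubling, the potentials telescope.\<close>
  have \<Gamma>sum: "(\<Sum>i<n. \<tau> * \<Gamma> i) \<le> 2 * P 0 - 2 * P n + 2 * (real n * \<tau>)" if "n \<le> N" for n
    using that
  proof (induction n)
    case (Suc n)
    have "2 * \<delta> * (C * \<tau> * (\<delta> + 2 * \<Gamma> n + 2 * \<epsilon>2)) = (2 * (C * \<delta>)) * (\<tau> * (\<delta> + 2 * \<Gamma> n + 2 * \<epsilon>2))" by (simp add: algebra_simps)
    also have "\<dots> \<le> (1/4) * (\<tau> * (1 + 2 * \<Gamma> n + 2 * 1))"
      using C\<delta> \<delta>0 \<delta>1 eps tau pos[of n] by (intro mult_mono mult_left_mono) auto
    finally have "2 * \<delta> * (C * \<tau> * (\<delta> + 2 * \<Gamma> n + 2 * \<epsilon>2)) \<le> (1/4) * (\<tau> * (1 + 2 * \<Gamma> n + 2 * 1))" .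
    then have "\<tau> * \<Gamma> n \<le> 2 * P n - 2 * P (Suc n) + 2 * \<tau>"
      using step(1)[of n] Suc.prems tau by (simp add: algebra_simps)
    then show ?case using Suc by (simp add: algebra_simps)
  qed simp
  have glimm_\<delta>: "P 0 \<le> 1" "Q 0 \<le> L 0"
  proof -
    let ?S = "\<lambda>f. \<tau> * (\<Sum>j=A..B. f j)"
    have Sn: "0 \<le> ?S (r 0)" "0 \<le> ?S (s 0)" "0 \<le> ?S (d1 0)" "0 \<le> ?S (d2 0)" using tau nn by (auto intro!: mult_nonneg_nonneg sum_nonneg)
    have S\<delta>: "?S (r 0) + ?S (s 0) \<le> 1" using mass[of 0] \<delta>1 by (simp add: I_def sum.distrib distrib_left)
    have SL: "?S (d1 0) + ?S (d2 0) = L 0" by (simp add: L_def I_def sum.distrib distrib_left)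
    have sq: "\<tau>\<^sup>2 * glimm A B a b \<le> ?S a * ?S b" if "\<And>j. 0 \<le> a j" "\<And>j. 0 \<le> b j" for a b
      using mult_left_mono[OF glimm_le_product[OF that], of "\<tau>\<^sup>2" A B] by (simp add: power2_eq_square algebra_simps)
    have "P 0 \<le> ?S (r 0) * ?S (s 0)" unfolding P_def using sq[OF nn(1,2)] by simp
    also have "\<dots> \<le> 1 * 1" using Sn S\<delta> by (intro mult_mono) auto
    finally show "P 0 \<le> 1" by simp
    have "Q 0 \<le> ?S (d1 0) * ?S (s 0) + ?S (r 0) * ?S (d2 0)"
      unfolding Q_def distrib_left using sq[of "d1 0" "s 0", OF nn(3,2)] sq[of "r 0" "d2 0", OF nn(1,4)] by (intro add_mono) simp_all
    also have "\<dots> \<le> ?S (d1 0) * 1 + 1 * ?S (d2 0)" using Sn S\<delta> by (intro add_mono mult_left_mono[of _ 1] mult_right_mono[of _ 1]) linarith+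
    finally show "Q 0 \<le> L 0" using SL by simp
  qed
  define H where "H n = L n + 4 * C * Q n" for n
  \<comment> \<open>A single \<open>\<Gamma> n\<close> is not bounded uniformly in the mesh; only
    the sum of \<open>\<tau> * \<Gamma> n\<close> is, by 4. In the exponent this gives 28 + 16 * 4,
    which is below 100.\<close>
  define g where "g n = 28 * C\<^sup>2 * \<tau> + 16 * C\<^sup>2 * (\<tau> * \<Gamma> n)" for n
  have Hstep: "H (Suc n) \<le> H n * (1 + g n) + 4 * C * \<tau> * \<epsilon>2" if n: "n < N" for n
  proof -
    have "4 * C * (\<delta> * (C * \<tau> * (L n + D n + \<epsilon>2))) = (4 * (C * \<delta>)) * (C * \<tau> * (L n + D n + \<epsilon>2))" by (simp add: algebra_simps)
    also have "\<dots> \<le> (1/2) * (C * \<tau> * (L n + D n + \<epsilon>2))"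
      using C\<delta> C tau pos[of n] eps by (intro mult_right_mono) auto
    finally have 1: "4 * C * (\<delta> * (C * \<tau> * (L n + D n + \<epsilon>2))) \<le> (1/2) * (C * \<tau> * (L n + D n + \<epsilon>2))" .
    have "4 * C * (L n * (C * \<tau> * (\<delta> + 2 * \<Gamma> n + 2 * \<epsilon>2))) = 4 * C\<^sup>2 * \<tau> * (\<delta> + 2 * \<Gamma> n + 2 * \<epsilon>2) * L n" by (simp add: power2_eq_square algebra_simps)
    also have "\<dots> \<le> 4 * C\<^sup>2 * \<tau> * (1 + 2 * \<Gamma> n + 2 * 1) * L n"
      using \<delta>1 eps tau pos[of n] by (intro mult_right_mono mult_left_mono) auto
    finally have 2: "4 * C * (L n * (C * \<tau> * (\<delta> + 2 * \<Gamma> n + 2 * \<epsilon>2))) \<le> 4 * C\<^sup>2 * \<tau> * (3 + 2 * \<Gamma> n) * L n" by (simp add: algebra_simps)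
    have CC: "C \<le> C\<^sup>2" using C by (simp add: power2_eq_square mult_le_cancel_left1)
    have 3: "3 * (C * (\<tau> * L n)) \<le> 3 * (C\<^sup>2 * (\<tau> * L n))"
      using CC tau pos[of n] by (intro mult_left_mono mult_right_mono) auto
    have CD: "0 \<le> C * \<tau> * D n" "0 \<le> C * \<tau> * \<epsilon>2" "0 \<le> C\<^sup>2 * \<tau> * L n" "0 \<le> C\<^sup>2 * \<tau> * \<Gamma> n * L n"
      using C tau pos[of n] eps by auto
    have 4: "4 * C * Q (Suc n) \<le> 4 * C * (Q n - \<tau> * D n + \<delta> * (C * \<tau> * (L n + D n + \<epsilon>2)) + L n * (C * \<tau> * (\<delta> + 2 * \<Gamma> n + 2 * \<epsilon>2)))"
      using step(3)[OF n] C by (intro mult_left_mono) auto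
    have "H (Suc n) \<le> H n + g n * L n + 4 * C * \<tau> * \<epsilon>2"
      using step(2)[OF n] 1 2 3 4 CD unfolding H_def g_def by (simp add: algebra_simps)
    moreover have "g n * L n \<le> g n * H n"
      using C tau pos[of n] by (intro mult_left_mono) (auto simp: g_def H_def)
    ultimately show ?thesis by (simp add: algebra_simps)
  qed
  have "H n \<le> exp (\<Sum>i<n. g i) * (H 0 + (\<Sum>i<n. 4 * C * \<tau> * \<epsilon>2))"
    by (rule discrete_gronwall[where N = N]) (use n Hstep C tau eps pos in \<open>auto simp: g_def H_def\<close>)
  also have "\<dots> \<le> exp (100 * C\<^sup>2) * (5 * C * L 0 + 4 * C * \<epsilon>2)"
  proof (intro mult_mono add_mono)
    have nt: "real n * \<tau> \<le> 1" using n N tau by (smt (verit) mult_right_mono of_nat_mono)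
    have "(\<Sum>i<n. g i) = 28 * C\<^sup>2 * (real n * \<tau>) + 16 * C\<^sup>2 * (\<Sum>i<n. \<tau> * \<Gamma> i)"
      by (simp add: g_def sum.distrib sum_distrib_left)
    also have "\<dots> \<le> 28 * C\<^sup>2 * 1 + 16 * C\<^sup>2 * 4"
      using nt \<Gamma>sum[OF n] glimm_\<delta>(1) pos[of n] by (intro add_mono mult_left_mono) auto
    also have "\<dots> \<le> 100 * C\<^sup>2" by simp
    finally show "exp (\<Sum>i<n. g i) \<le> exp (100 * C\<^sup>2)" by simp
    have "4 * C * Q 0 \<le> 4 * C * L 0" "1 * L 0 \<le> C * L 0" using glimm_\<delta>(2) C mult_right_mono[OF C pos(1)[of 0]] by (auto intro: mult_left_mono)
    then show "H 0 \<le> 5 * C * L 0" by (simp add: H_def)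
    have "4 * C * \<epsilon>2 * (real n * \<tau>) \<le> 4 * C * \<epsilon>2 * 1" using nt C eps by (intro mult_left_mono) auto
    then show "(\<Sum>i<n. 4 * C * \<tau> * \<epsilon>2) \<le> 4 * C * \<epsilon>2" by (simp add: algebra_simps)
    show "0 \<le> H 0 + (\<Sum>i<n. 4 * C * \<tau> * \<epsilon>2)" using C tau eps pos[of 0] by (auto simp: H_def)
  qed auto
  also have "\<dots> \<le> exp (100 * C\<^sup>2) * (5 * C * (L 0 + \<epsilon>2))"
    using C eps by (intro mult_left_mono) (auto simp: algebra_simps)
  finally have "H n \<le> exp (100 * C\<^sup>2) * (5 * C) * (L 0 + \<epsilon>2)" by (simp add: mult.assoc)
  moreover have "L n \<le> H n" using pos[of n] C by (simp add: H_def)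
  ultimately show ?thesis unfolding L_def by linarith
qed

subsection \<open>Stability of approximate lattice schemes\<close>

text \<open>The index range loses one site on either side per step: it is the section of a backward
  light cone, so that values inside it depend on the initial values at the sites \<open>A..B\<close>
  alone.\<close>

definition approx_scheme :: "real \<Rightarrow> real \<Rightarrow> real \<Rightarrow> real \<Rightarrow> real \<Rightarrow> nat \<Rightarrow> int \<Rightarrow> int
    \<Rightarrow> (nat \<Rightarrow> int \<Rightarrow> complex) \<Rightarrow> (nat \<Rightarrow> int \<Rightarrow> complex) \<Rightarrow> bool" where
  "approx_scheme m \<alpha> \<beta> \<epsilon> \<tau> N A B P Q \<longleftrightarrow>
    (\<forall>n<N. \<forall>j\<in>{A + int (Suc n) .. B - int (Suc n)}. \<exists>y. approx_ode m \<alpha> \<beta> \<epsilon> \<tau> y \<and>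
       y 0 = (P n (j - 1), Q n (j + 1)) \<and> y \<tau> = (P (Suc n) j, Q (Suc n) j))"

lemma approx_ode_mono: "approx_ode m \<alpha> \<beta> \<epsilon> \<tau> y \<Longrightarrow> \<epsilon> \<le> \<epsilon>' \<Longrightarrow> approx_ode m \<alpha> \<beta> \<epsilon>' \<tau> y"
  unfolding approx_ode_def by (meson order.trans)

lemma approx_scheme_mono:
  "approx_scheme m \<alpha> \<beta> \<epsilon> \<tau> N A B P Q \<Longrightarrow> \<epsilon> \<le> \<epsilon>' \<Longrightarrow> approx_scheme m \<alpha> \<beta> \<epsilon>' \<tau> N A B P Q"
  unfolding approx_scheme_def by (meson approx_ode_mono)

lemma norm_Pair_square: "(norm (a, b))\<^sup>2 = (norm a)\<^sup>2 + (norm b)\<^sup>2"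
  by (simp add: norm_prod_def)

text \<open>Every site passes each of its components on to at most one site of the next section, so
  the charge bound of the ODE may be summed over sites. The factor 3 bounds the exponential over
  unit time.\<close>

lemma approx_scheme_charge:
  assumes sch: "approx_scheme m \<alpha> \<beta> \<epsilon> \<tau> N A B P Q" and tau: "0 \<le> \<tau>" and N: "real N * \<tau> \<le> 1" and n: "n \<le> N"
  defines "I \<equiv> \<lambda>n. {A + int n .. B - int n}"
  shows "\<tau> * (\<Sum>j\<in>I n. (cmod (P n j))\<^sup>2 + (cmod (Q n j))\<^sup>2)
    \<le> 3 * (\<tau> * (\<Sum>j=A..B. (cmod (P 0 j))\<^sup>2 + (cmod (Q 0 j))\<^sup>2) + \<epsilon>\<^sup>2 * (\<tau> * real (card {A..B})))"
proof -
  define M where "M n = \<tau> * (\<Sum>j\<in>I n. (cmod (P n j))\<^sup>2 + (cmod (Q n j))\<^sup>2)" for n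
  define len where "len = \<tau> * real (card {A..B})"
  have l: "0 \<le> len" using tau by (simp add: len_def)
  have M0: "0 \<le> M n" for n using tau by (auto simp: M_def intro!: mult_nonneg_nonneg sum_nonneg)
  have "M n \<le> exp (real n * \<tau>) * (M 0 + \<epsilon>\<^sup>2 * len * (real n * \<tau>))" using n
  proof (induction n)
    case (Suc n)
    have "(cmod (P (Suc n) j))\<^sup>2 + (cmod (Q (Suc n) j))\<^sup>2 \<le> exp \<tau> * ((cmod (P n (j - 1)))\<^sup>2 + (cmod (Q n (j + 1)))\<^sup>2 + \<epsilon>\<^sup>2 * \<tau>)"
      if j: "j \<in> I (Suc n)" for j
    proof -
      obtain y where "approx_ode m \<alpha> \<beta> \<epsilon> \<tau> y" "y 0 = (P n (j - 1), Q n (j + 1))" "y \<tau> = (P (Suc n) j, Q (Suc n) j)"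
        using sch j Suc.prems unfolding approx_scheme_def I_def by (meson Suc_le_lessD)
      then show ?thesis using approx_ode_charge[of m \<alpha> \<beta> \<epsilon> \<tau> y \<tau>] tau by (simp add: norm_Pair_square)
    qed
    then have "(\<Sum>j\<in>I (Suc n). (cmod (P (Suc n) j))\<^sup>2 + (cmod (Q (Suc n) j))\<^sup>2)
        \<le> (\<Sum>j\<in>I (Suc n). exp \<tau> * ((cmod (P n (j - 1)))\<^sup>2 + (cmod (Q n (j + 1)))\<^sup>2 + \<epsilon>\<^sup>2 * \<tau>))"
      by (rule sum_mono)
    also have "\<dots> = exp \<tau> * ((\<Sum>j\<in>I (Suc n). (cmod (P n (j - 1)))\<^sup>2) + (\<Sum>j\<in>I (Suc n). (cmod (Q n (j + 1)))\<^sup>2) + \<epsilon>\<^sup>2 * \<tau> * real (card (I (Suc n))))"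
      by (simp add: sum_distrib_left[symmetric] sum.distrib algebra_simps)
    also have "\<dots> \<le> exp \<tau> * ((\<Sum>j\<in>I n. (cmod (P n j))\<^sup>2) + (\<Sum>j\<in>I n. (cmod (Q n j))\<^sup>2) + \<epsilon>\<^sup>2 * \<tau> * real (card {A..B}))"
    proof (intro mult_left_mono add_mono)
      have Is: "I (Suc n) = {(A + int n) + 1..(B - int n) - 1}" by (auto simp: I_def)
      show "(\<Sum>j\<in>I (Suc n). (cmod (P n (j - 1)))\<^sup>2) \<le> (\<Sum>j\<in>I n. (cmod (P n j))\<^sup>2)"
        unfolding Is unfolding I_def by (rule sum_shift_le) auto
      show "(\<Sum>j\<in>I (Suc n). (cmod (Q n (j + 1)))\<^sup>2) \<le> (\<Sum>j\<in>I n. (cmod (Q n j))\<^sup>2)"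
        unfolding Is unfolding I_def by (rule sum_shift_le) auto
      show "real (card (I (Suc n))) \<le> real (card {A..B})" by (simp add: I_def)
    qed (use tau in auto)
    finally have "M (Suc n) \<le> \<tau> * (exp \<tau> * ((\<Sum>j\<in>I n. (cmod (P n j))\<^sup>2) + (\<Sum>j\<in>I n. (cmod (Q n j))\<^sup>2) + \<epsilon>\<^sup>2 * \<tau> * real (card {A..B})))"
      unfolding M_def using tau by (rule mult_left_mono)
    also have "\<dots> = exp \<tau> * (M n + \<epsilon>\<^sup>2 * len * \<tau>)" by (simp add: M_def len_def sum.distrib algebra_simps)
    also have "\<dots> \<le> exp \<tau> * (exp (real n * \<tau>) * (M 0 + \<epsilon>\<^sup>2 * len * (real n * \<tau>)) + exp (real n * \<tau>) * (\<epsilon>\<^sup>2 * len * \<tau>))"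
    proof (intro mult_left_mono add_mono)
      have "1 \<le> exp (real n * \<tau>)" using tau by simp
      from mult_right_mono[OF this, of "\<epsilon>\<^sup>2 * len * \<tau>"] show "\<epsilon>\<^sup>2 * len * \<tau> \<le> exp (real n * \<tau>) * (\<epsilon>\<^sup>2 * len * \<tau>)" using l tau by simp
    qed (use Suc in auto)
    also have "\<dots> = exp (real (Suc n) * \<tau>) * (M 0 + \<epsilon>\<^sup>2 * len * (real (Suc n) * \<tau>))"
      by (simp add: exp_add algebra_simps)
    finally show ?case .
  qed simp
  also have "\<dots> \<le> 3 * (M 0 + \<epsilon>\<^sup>2 * len * 1)"
  proof -
    have nt: "real n * \<tau> \<le> 1" using n N tau by (smt (verit) mult_right_mono of_nat_mono)
    then have "exp (real n * \<tau>) \<le> 3" using exp_le by (meson exp_le_cancel_iff order.trans)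
    then show ?thesis using nt l tau M0[of 0] by (intro mult_mono add_mono mult_left_mono) auto
  qed
  finally show ?thesis by (simp add: M_def len_def I_def)
qed

text \<open>Smallness is asked at the initial section only; charge conservation carries it to the
  later ones. Both schemes have the same forcing bound, which counts towards \<delta>. The relation
  \<open>A + 2 * int N \<le> B + 1\<close> allows the last section to be empty, but no more than
  that.\<close>

definition scheme_stable :: "real \<Rightarrow> real \<Rightarrow> real \<Rightarrow> real \<Rightarrow> real \<Rightarrow> bool" where
  "scheme_stable m \<alpha> \<beta> \<delta> K \<longleftrightarrow>
    (\<forall>\<epsilon> \<tau> N A B U V P Q.
     approx_scheme m \<alpha> \<beta> \<epsilon> \<tau> N A B U V \<longrightarrow> approx_scheme m \<alpha> \<beta> \<epsilon> \<tau> N A B P Q \<longrightarrow> 0 < \<tau> \<longrightarrow> 0 \<le> \<epsilon> \<longrightarrow> \<epsilon> \<le> 1 \<longrightarrow>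
     real N * \<tau> \<le> 1 \<longrightarrow> \<tau> \<le> 1 \<longrightarrow> \<tau> * real_of_int (B - A + 1) \<le> 1 \<longrightarrow> A + 2 * int N \<le> B + 1 \<longrightarrow>
     \<tau> * (\<Sum>j=A..B. (cmod (U 0 j))\<^sup>2 + (cmod (V 0 j))\<^sup>2) + \<tau> * (\<Sum>j=A..B. (cmod (P 0 j))\<^sup>2 + (cmod (Q 0 j))\<^sup>2) + \<epsilon>\<^sup>2 \<le> \<delta> \<longrightarrow>
     (\<forall>n\<le>N. \<tau> * (\<Sum>j\<in>{A + int n..B - int n}. (cmod (U n j - P n j))\<^sup>2 + (cmod (V n j - Q n j))\<^sup>2)
        \<le> K * (\<tau> * (\<Sum>j=A..B. (cmod (U 0 j - P 0 j))\<^sup>2 + (cmod (V 0 j - Q 0 j))\<^sup>2) + \<epsilon>\<^sup>2)))"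

lemma approx_scheme_stability: "\<exists>\<delta>>0. \<exists>K>0. scheme_stable m \<alpha> \<beta> \<delta> K"
proof -
  obtain C where C: "1 \<le> C" and bound: "step_bound m \<alpha> \<beta> C" using approx_ode_step by blast
  note step = bound[unfolded step_bound_def, rule_format]
  \<comment> \<open>At later times the joint charge is at most 6 \<delta>: growth by a factor 3,
    doubled because the forcing is counted once for each scheme. The discrete estimate requires 8 C
    * 6 \<delta> \<le> 1.\<close>
  define \<delta> where "\<delta> = 1 / (48 * C)"
  define K where "K = exp (100 * C\<^sup>2) * (5 * C)"
  show ?thesis unfolding scheme_stable_def
  proof (rule exI[of _ \<delta>], intro conjI, goal_cases)
    case 1 show ?case using C by (simp add: \<delta>_def)
    case 2 show ?case
    proof (rule exI[of _ K], intro conjI allI impI, goal_cases)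
      case 1 show ?case using C by (simp add: K_def)
      case (2 \<epsilon> \<tau> N A B U V P Q n)
      note schU = 2(1) and schP = 2(2) and tau = 2(3) and eps = 2(4,5) and N = 2(6) and tau1 = 2(7) and len = 2(8) and AB = 2(9)
        and small = 2(10) and n = 2(11)
      define r s where "r n j = (cmod (U n j))\<^sup>2 + (cmod (P n j))\<^sup>2" and "s n j = (cmod (V n j))\<^sup>2 + (cmod (Q n j))\<^sup>2" for n j
      define d1 d2 where "d1 n j = (cmod (U n j - P n j))\<^sup>2" and "d2 n j = (cmod (V n j - Q n j))\<^sup>2" for n j
      have \<delta>1: "6 * \<delta> \<le> 1" using C by (simp add: \<delta>_def)
      have nn: "0 \<le> r n j" "0 \<le> s n j" "0 \<le> d1 n j" "0 \<le> d2 n j" for n j by (auto simp: r_def s_def d1_def d2_def)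
      have mass: "\<tau> * (\<Sum>j\<in>{A + int n..B - int n}. r n j + s n j) \<le> 6 * \<delta>" if n: "n \<le> N" for n
      proof -
        let ?MU = "\<tau> * (\<Sum>j=A..B. (cmod (U 0 j))\<^sup>2 + (cmod (V 0 j))\<^sup>2)" and ?MP = "\<tau> * (\<Sum>j=A..B. (cmod (P 0 j))\<^sup>2 + (cmod (Q 0 j))\<^sup>2)"
        have MM: "0 \<le> ?MU" "0 \<le> ?MP" using tau by (auto intro!: mult_nonneg_nonneg sum_nonneg)
        have "\<tau> * real (card {A..B}) \<le> 1" using len tau AB by (cases "B - A + 1 \<ge> 0") auto
        then have e: "\<epsilon>\<^sup>2 * (\<tau> * real (card {A..B})) \<le> \<epsilon>\<^sup>2 * 1" by (intro mult_left_mono) auto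
        have "\<tau> * (\<Sum>j\<in>{A + int n..B - int n}. r n j + s n j)
            = \<tau> * (\<Sum>j\<in>{A + int n..B - int n}. (cmod (U n j))\<^sup>2 + (cmod (V n j))\<^sup>2)
            + \<tau> * (\<Sum>j\<in>{A + int n..B - int n}. (cmod (P n j))\<^sup>2 + (cmod (Q n j))\<^sup>2)"
          by (simp add: r_def s_def sum.distrib algebra_simps)
        also have "\<dots> \<le> 3 * (?MU + \<epsilon>\<^sup>2) + 3 * (?MP + \<epsilon>\<^sup>2)"
        proof -
          have lin: "x + y \<le> 3 * (a + c) + 3 * (b + c)" if "x \<le> 3 * (a + c')" "y \<le> 3 * (b + c')" "c' \<le> c * 1" for x y a b c c' :: real
            using that by argo
          show ?thesis
            by (rule lin[OF approx_scheme_charge[OF schU less_imp_le[OF tau] N n] approx_scheme_charge[OF schP less_imp_le[OF tau] N n] e])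
        qed
        also have "\<dots> \<le> 6 * \<delta>" using small MM by argo
        finally show ?thesis .
      qed
      have step': "r (Suc n) j \<le> r n (j-1) + C * \<tau> * (r n (j-1) + s n (j+1) + 2 * (r n (j-1) * s n (j+1)) + 2 * \<epsilon>\<^sup>2) \<and>
          s (Suc n) j \<le> s n (j+1) + C * \<tau> * (r n (j-1) + s n (j+1) + 2 * (r n (j-1) * s n (j+1)) + 2 * \<epsilon>\<^sup>2) \<and>
          d1 (Suc n) j \<le> d1 n (j-1) + C * \<tau> * ((1 + s n (j+1)) * d1 n (j-1) + (1 + r n (j-1)) * d2 n (j+1) + \<epsilon>\<^sup>2) \<and>
          d2 (Suc n) j \<le> d2 n (j+1) + C * \<tau> * ((1 + s n (j+1)) * d1 n (j-1) + (1 + r n (j-1)) * d2 n (j+1) + \<epsilon>\<^sup>2)"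
        if n: "n < N" and j: "j \<in> {A + int (Suc n) .. B - int (Suc n)}" for n j
      proof -
        obtain y where y: "approx_ode m \<alpha> \<beta> \<epsilon> \<tau> y" "y 0 = (U n (j - 1), V n (j + 1))" "y \<tau> = (U (Suc n) j, V (Suc n) j)"
          using schU n j unfolding approx_scheme_def by blast
        obtain z where z: "approx_ode m \<alpha> \<beta> \<epsilon> \<tau> z" "z 0 = (P n (j - 1), Q n (j + 1))" "z \<tau> = (P (Suc n) j, Q (Suc n) j)"
          using schP n j unfolding approx_scheme_def by blast
        have "r n (j - 1) + s n (j + 1) \<le> (\<Sum>j\<in>{A + int n..B - int n}. r n j + s n j)"
        proof -
          have "r n (j - 1) \<le> (\<Sum>j\<in>{A + int n..B - int n}. r n j)" "s n (j + 1) \<le> (\<Sum>j\<in>{A + int n..B - int n}. s n j)"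
            using j nn by (auto intro!: member_le_sum)
          then show ?thesis by (simp add: sum.distrib)
        qed
        then have "\<tau> * (r n (j - 1) + s n (j + 1)) \<le> \<tau> * (\<Sum>j\<in>{A + int n..B - int n}. r n j + s n j)" using tau by simp
        then have rs: "\<tau> * (r n (j - 1) + s n (j + 1)) \<le> 1" using mass[of n] n \<delta>1 by (meson less_imp_le order.trans)
        have eq: "r n (j - 1) + s n (j + 1) = (norm (y 0))\<^sup>2 + (norm (z 0))\<^sup>2" by (simp add: r_def s_def y z norm_Pair_square)
        have yz: "\<tau> * ((norm (y 0))\<^sup>2 + (norm (z 0))\<^sup>2) \<le> 1" using rs eq by simp
        have "0 \<le> \<tau> * (norm (y 0))\<^sup>2" "0 \<le> \<tau> * (norm (z 0))\<^sup>2" using tau by auto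
        then have y1: "\<tau> * ((norm (y 0))\<^sup>2 + (norm (0 :: complex \<times> complex))\<^sup>2) \<le> 1"
            and z1: "\<tau> * ((norm (z 0))\<^sup>2 + (norm (0 :: complex \<times> complex))\<^sup>2) \<le> 1"
          using yz by (simp_all add: distrib_left)
        \<comment> \<open>Comparison with the zero solution bounds the growth of the densities
          themselves. The right side equals a + b + 2 a b up to the forcing, the form in which
          \<open>F\<close> is written.\<close>
        have Uy: "(cmod (U (Suc n) j))\<^sup>2 \<le> (cmod (U n (j - 1)))\<^sup>2 + C * \<tau> * ((1 + (cmod (V n (j+1)))\<^sup>2) * (cmod (U n (j-1)))\<^sup>2 + (1 + (cmod (U n (j-1)))\<^sup>2) * (cmod (V n (j+1)))\<^sup>2 + \<epsilon>\<^sup>2)"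
          "(cmod (V (Suc n) j))\<^sup>2 \<le> (cmod (V n (j + 1)))\<^sup>2 + C * \<tau> * ((1 + (cmod (V n (j+1)))\<^sup>2) * (cmod (U n (j-1)))\<^sup>2 + (1 + (cmod (U n (j-1)))\<^sup>2) * (cmod (V n (j+1)))\<^sup>2 + \<epsilon>\<^sup>2)"
          using step[OF y(1) approx_ode_0[OF eps(1)] _ tau1 eps y1] tau by (simp_all add: Let_def y)
        have Pz: "(cmod (P (Suc n) j))\<^sup>2 \<le> (cmod (P n (j - 1)))\<^sup>2 + C * \<tau> * ((1 + (cmod (Q n (j+1)))\<^sup>2) * (cmod (P n (j-1)))\<^sup>2 + (1 + (cmod (P n (j-1)))\<^sup>2) * (cmod (Q n (j+1)))\<^sup>2 + \<epsilon>\<^sup>2)"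
          "(cmod (Q (Suc n) j))\<^sup>2 \<le> (cmod (Q n (j + 1)))\<^sup>2 + C * \<tau> * ((1 + (cmod (Q n (j+1)))\<^sup>2) * (cmod (P n (j-1)))\<^sup>2 + (1 + (cmod (P n (j-1)))\<^sup>2) * (cmod (Q n (j+1)))\<^sup>2 + \<epsilon>\<^sup>2)"
          using step[OF z(1) approx_ode_0[OF eps(1)] _ tau1 eps z1] tau by (simp_all add: Let_def z)
        have quad: "C * \<tau> * ((1 + b) * a + (1 + a) * b + \<epsilon>\<^sup>2) + C * \<tau> * ((1 + b') * a' + (1 + a') * b' + \<epsilon>\<^sup>2)
            \<le> C * \<tau> * ((a + a') + (b + b') + 2 * ((a + a') * (b + b')) + 2 * \<epsilon>\<^sup>2)"
          if "0 \<le> a" "0 \<le> b" "0 \<le> a'" "0 \<le> b'" for a b a' b'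
        proof -
          have "0 \<le> a * b'" "0 \<le> a' * b" using that by auto
          then have "((1 + b) * a + (1 + a) * b + \<epsilon>\<^sup>2) + ((1 + b') * a' + (1 + a') * b' + \<epsilon>\<^sup>2)
             \<le> (a + a') + (b + b') + 2 * ((a + a') * (b + b')) + 2 * \<epsilon>\<^sup>2" by (simp add: algebra_simps)
          from mult_left_mono[OF this, of "C * \<tau>"] show ?thesis using C tau unfolding distrib_left by simp
        qed
        note q = quad[of "(cmod (U n (j-1)))\<^sup>2" "(cmod (V n (j+1)))\<^sup>2" "(cmod (P n (j-1)))\<^sup>2" "(cmod (Q n (j+1)))\<^sup>2"]
        have r1: "r (Suc n) j \<le> r n (j-1) + C * \<tau> * (r n (j-1) + s n (j+1) + 2 * (r n (j-1) * s n (j+1)) + 2 * \<epsilon>\<^sup>2)"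
          unfolding r_def s_def by (smt (verit) Uy(1) Pz(1) q zero_le_power2)
        have s1: "s (Suc n) j \<le> s n (j+1) + C * \<tau> * (r n (j-1) + s n (j+1) + 2 * (r n (j-1) * s n (j+1)) + 2 * \<epsilon>\<^sup>2)"
          unfolding r_def s_def by (smt (verit) Uy(2) Pz(2) q zero_le_power2)
        show ?thesis
          using step[OF y(1) z(1) _ tau1 eps yz] tau r1 s1
          by (simp add: Let_def y z r_def[of n "j-1"] s_def[of n "j+1"] d1_def d2_def)
      qed
      have "\<tau> * (\<Sum>j\<in>{A + int n..B - int n}. d1 n j + d2 n j)
          \<le> exp (100 * C\<^sup>2) * (5 * C) * (\<tau> * (\<Sum>j\<in>{A + int 0..B - int 0}. d1 0 j + d2 0 j) + \<epsilon>\<^sup>2)"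
        by (rule discrete_stability[where N = N and r = r and s = s and \<delta> = "6 * \<delta>", OF C tau len AB N])
          (use eps nn mass step' n C in \<open>auto simp: power_le_one \<delta>_def\<close>)
      then show ?case by (simp add: K_def d1_def d2_def)
    qed
  qed
qed

subsection \<open>Smooth and time-splitting solutions on the lattice\<close>

lemma smooth2_D:
  assumes "smooth2 f"
  shows "continuous_on UNIV f" "\<exists>D. \<forall>p. (f has_derivative D p) (at p)"
proof -
  show "continuous_on UNIV f" using assms unfolding smooth2_def by (metis Ck.simps(1))
  have "Ck (Suc 0) f" using assms unfolding smooth2_def by blast
  then show "\<exists>D. \<forall>p. (f has_derivative D p) (at p)" by auto
qed

text \<open>\<open>Ck\<close> provides some total derivative and the equation provides partial ones.
  Uniqueness of derivatives along the axes identifies them, after which the chain rule applies along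
  the slanted characteristics.\<close>

lemma smooth2_directional:
  assumes f: "smooth2 (\<lambda>(x, t). f x t)"
    and t: "((\<lambda>s. f x s) has_vector_derivative ft) (at t)" and x: "((\<lambda>y. f y t) has_vector_derivative fx) (at x)"
  shows "((\<lambda>(x, t). f x t) has_derivative (\<lambda>(h, k). h *\<^sub>R fx + k *\<^sub>R ft)) (at (x, t))"
proof -
  obtain D where D: "((\<lambda>(x, t). f x t) has_derivative D) (at (x, t))" using smooth2_D(2)[OF f] by blast
  interpret bounded_linear D using D by (rule has_derivative_bounded_linear)
  have 1: "((\<lambda>s. (x, s)) has_derivative (\<lambda>h. (0, h))) (at t)" and 2: "((\<lambda>y. (y, t)) has_derivative (\<lambda>h. (h, 0))) (at x)"
    by (auto intro!: derivative_eq_intros)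
  have "((\<lambda>s. (\<lambda>(x, t). f x t) (x, s)) has_derivative (\<lambda>h. D (0, h))) (at t)"
    "((\<lambda>y. (\<lambda>(x, t). f x t) (y, t)) has_derivative (\<lambda>h. D (h, 0))) (at x)"
    using has_derivative_compose[OF 1 D] has_derivative_compose[OF 2 D] by blast+
  then have "(\<lambda>h. D (0, h)) = (\<lambda>h. h *\<^sub>R ft)" "(\<lambda>h. D (h, 0)) = (\<lambda>h. h *\<^sub>R fx)"
    using t x has_derivative_unique by (auto simp: has_vector_derivative_def)
  then have *: "D (0, k) = k *\<^sub>R ft" "D (h, 0) = h *\<^sub>R fx" for h k by metis+
  have "D (h, k) = h *\<^sub>R fx + k *\<^sub>R ft" for h k using add[of "(h, 0)" "(0, k)"] unfolding * by simp
  then have "D = (\<lambda>(h, k). h *\<^sub>R fx + k *\<^sub>R ft)" by (intro ext) (simp only: case_prod_unfold prod.collapse[symmetric] split_paired_all fst_conv snd_conv)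
  then show ?thesis using D by (simp only:)
qed

lemma smooth_sol_continuous:
  assumes "smooth_sol m \<alpha> \<beta> u v"
  shows "continuous_on UNIV (\<lambda>(x, t). u x t)" "continuous_on UNIV (\<lambda>(x, t). v x t)"
  using assms smooth2_D(1) unfolding smooth_sol_def by auto

lemma smooth_sol_characteristics:
  assumes sol: "smooth_sol m \<alpha> \<beta> u v" and t: "0 \<le> t + s"
  shows "((\<lambda>\<sigma>. u (x + \<sigma>) (t + \<sigma>)) has_vector_derivative N1 m \<alpha> \<beta> (u (x + s) (t + s)) (v (x + s) (t + s))) (at s within S)"
    and "((\<lambda>\<sigma>. v (x - \<sigma>) (t + \<sigma>)) has_vector_derivative N2 m \<alpha> \<beta> (u (x - s) (t + s)) (v (x - s) (t + s))) (at s within S)"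
proof -
  have su: "smooth2 (\<lambda>(x, t). u x t)" and sv: "smooth2 (\<lambda>(x, t). v x t)" using sol by (auto simp: smooth_sol_def)
  have pde: "\<exists>ut ux vt vx. ((\<lambda>s. u x s) has_vector_derivative ut) (at t) \<and> ((\<lambda>y. u y t) has_vector_derivative ux) (at x) \<and>
           ((\<lambda>s. v x s) has_vector_derivative vt) (at t) \<and> ((\<lambda>y. v y t) has_vector_derivative vx) (at x) \<and>
           ut + ux = N1 m \<alpha> \<beta> (u x t) (v x t) \<and> vt - vx = N2 m \<alpha> \<beta> (u x t) (v x t)" if "0 \<le> t" for x t
    using sol that by (simp add: smooth_sol_def)
  obtain ut ux where 1: "((\<lambda>r. u (x + s) r) has_vector_derivative ut) (at (t + s))" "((\<lambda>y. u y (t + s)) has_vector_derivative ux) (at (x + s))"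
      "ut + ux = N1 m \<alpha> \<beta> (u (x + s) (t + s)) (v (x + s) (t + s))"
    using pde[OF t, of "x + s"] by blast
  have "((\<lambda>\<sigma>. (x + \<sigma>, t + \<sigma>)) has_derivative (\<lambda>h. (h, h))) (at s within S)"
    by (auto intro!: derivative_eq_intros)
  from has_derivative_compose[OF this smooth2_directional[OF su 1(1,2)]]
  have "((\<lambda>\<sigma>. u (x + \<sigma>) (t + \<sigma>)) has_derivative (\<lambda>h. h *\<^sub>R ux + h *\<^sub>R ut)) (at s within S)" by simp
  then show "((\<lambda>\<sigma>. u (x + \<sigma>) (t + \<sigma>)) has_vector_derivative N1 m \<alpha> \<beta> (u (x + s) (t + s)) (v (x + s) (t + s))) (at s within S)"
    unfolding has_vector_derivative_def 1(3)[symmetric] by (simp add: scaleR_add_right add.commute)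
  obtain vt vx where 2: "((\<lambda>r. v (x - s) r) has_vector_derivative vt) (at (t + s))" "((\<lambda>y. v y (t + s)) has_vector_derivative vx) (at (x - s))"
      "vt - vx = N2 m \<alpha> \<beta> (u (x - s) (t + s)) (v (x - s) (t + s))"
    using pde[OF t, of "x - s"] by blast
  have "((\<lambda>\<sigma>. (x - \<sigma>, t + \<sigma>)) has_derivative (\<lambda>h. (- h, h))) (at s within S)"
    by (auto intro!: derivative_eq_intros)
  from has_derivative_compose[OF this smooth2_directional[OF sv 2(1,2)]]
  have "((\<lambda>\<sigma>. v (x - \<sigma>) (t + \<sigma>)) has_derivative (\<lambda>h. (- h) *\<^sub>R vx + h *\<^sub>R vt)) (at s within S)" by simp
  then show "((\<lambda>\<sigma>. v (x - \<sigma>) (t + \<sigma>)) has_vector_derivative N2 m \<alpha> \<beta> (u (x - s) (t + s)) (v (x - s) (t + s))) (at s within S)"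
    unfolding has_vector_derivative_def 2(3)[symmetric] by (simp add: scaleR_diff_right)
qed

lemma continuous_on_N1 [continuous_intros]:
  "continuous_on S f \<Longrightarrow> continuous_on S g \<Longrightarrow> continuous_on S (\<lambda>x. N1 m \<alpha> \<beta> (f x) (g x))"
  unfolding N1_def by (intro continuous_intros)

text \<open>The offset \<open>n0\<close> turns any grid time into an initial time, so that the
  estimates can be restarted at later times.\<close>

abbreviation grid :: "(real \<Rightarrow> real \<Rightarrow> complex) \<Rightarrow> real \<Rightarrow> nat \<Rightarrow> nat \<Rightarrow> int \<Rightarrow> complex" where
  "grid p \<tau> n0 \<equiv> \<lambda>n j. p (real_of_int j * \<tau>) (real (n0 + n) * \<tau>)"

text \<open>Along the two characteristics through a grid point the solution satisfies the ODE up to an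
  error coming from the distance between them.\<close>
lemma smooth_sol_approx_scheme:
  assumes sol: "smooth_sol m \<alpha> \<beta> p q" and eps: "0 < \<epsilon>"
  shows "\<exists>\<tau>0>0. \<forall>\<tau> n0 N A B. 0 < \<tau> \<longrightarrow> \<tau> < \<tau>0 \<longrightarrow> - X \<le> real_of_int A * \<tau> \<longrightarrow> real_of_int B * \<tau> \<le> X \<longrightarrow>
     real (n0 + N) * \<tau> \<le> T \<longrightarrow> approx_scheme m \<alpha> \<beta> \<epsilon> \<tau> N A B
       (grid p \<tau> n0) (grid q \<tau> n0)"
proof -
  \<comment> \<open>The spatial arguments of \<open>p\<close> and \<open>q\<close> are kept apart
    because a lattice step evaluates them at different points; on the diagonal one recovers the
    right-hand sides of the equation. Uniform continuity on the compact set \<open>S\<close> bounds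
    the discrepancy.\<close>
  define H1 where "H1 = (\<lambda>(x1, x2, t). N1 m \<alpha> \<beta> (p x1 t) (q x2 t))"
  define H2 where "H2 = (\<lambda>(x1, x2, t). N2 m \<alpha> \<beta> (p x1 t) (q x2 t))"
  define S where "S = {-X..X} \<times> {-X..X} \<times> {0..T}"
  have cp: "continuous_on S (\<lambda>(x1, x2, t). p x1 t)"
  proof -
    have "continuous_on S (\<lambda>(x1, x2, t). (x1, t))" by (auto simp: case_prod_unfold intro!: continuous_intros)
    from continuous_on_compose2[OF smooth_sol_continuous(1)[OF sol] this] show ?thesis by (simp add: case_prod_unfold)
  qed
  have cq: "continuous_on S (\<lambda>(x1, x2, t). q x2 t)"
  proof -
    have "continuous_on S (\<lambda>(x1, x2, t). (x2, t))" by (auto simp: case_prod_unfold intro!: continuous_intros)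
    from continuous_on_compose2[OF smooth_sol_continuous(2)[OF sol] this] show ?thesis by (simp add: case_prod_unfold)
  qed
  have "continuous_on S H1" "continuous_on S H2"
    using cp cq unfolding H1_def H2_def N2_eq_N1 by (auto simp: case_prod_unfold intro!: continuous_intros)
  moreover have "compact S" unfolding S_def by (intro compact_Times compact_Icc)
  ultimately have uc: "uniformly_continuous_on S H1" "uniformly_continuous_on S H2"
    by (auto intro: compact_uniformly_continuous)
  obtain d1 where d1: "0 < d1" "\<And>z z'. z \<in> S \<Longrightarrow> z' \<in> S \<Longrightarrow> dist z' z < d1 \<Longrightarrow> dist (H1 z') (H1 z) < \<epsilon> / 2"
    using uc(1)[unfolded uniformly_continuous_on_def, rule_format, of "\<epsilon>/2"] eps by auto
  obtain d2 where d2: "0 < d2" "\<And>z z'. z \<in> S \<Longrightarrow> z' \<in> S \<Longrightarrow> dist z' z < d2 \<Longrightarrow> dist (H2 z') (H2 z) < \<epsilon> / 2"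
    using uc(2)[unfolded uniformly_continuous_on_def, rule_format, of "\<epsilon>/2"] eps by auto
  \<comment> \<open>The two characteristics of a step start at distance 2 \<tau>, which is thus
    smaller than both moduli.\<close>
  define \<tau>0 where "\<tau>0 = min d1 d2 / 2"
  show ?thesis
  proof (rule exI[of _ \<tau>0], intro conjI allI impI)
    show "0 < \<tau>0" using d1 d2 by (simp add: \<tau>0_def)
    fix \<tau> n0 N A B
    assume tau: "0 < \<tau>" "\<tau> < \<tau>0" and A: "- X \<le> real_of_int A * \<tau>" and B: "real_of_int B * \<tau> \<le> X" and NT: "real (n0 + N) * \<tau> \<le> T"
    show "approx_scheme m \<alpha> \<beta> \<epsilon> \<tau> N A B
       (grid p \<tau> n0) (grid q \<tau> n0)"
      unfolding approx_scheme_def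
    proof (intro allI impI ballI)
      fix n j assume n: "n < N" and j: "j \<in> {A + int (Suc n)..B - int (Suc n)}"
      define t where "t = real (n0 + n) * \<tau>"
      define xl where "xl = real_of_int (j - 1) * \<tau>"
      define xr where "xr = real_of_int (j + 1) * \<tau>"
      \<comment> \<open>The right-moving curve from the left neighbour and the left-moving one from
        the right neighbour meet at site \<open>j\<close> at the end of the step.\<close>
      define y where "y = (\<lambda>\<sigma>. (p (xl + \<sigma>) (t + \<sigma>), q (xr - \<sigma>) (t + \<sigma>)))"
      have t0: "0 \<le> t" using tau by (simp add: t_def)
      have tT: "t + \<tau> \<le> T"
      proof -
        have "real (n0 + n) + 1 \<le> real (n0 + N)" using n by simp
        then have "(real (n0 + n) + 1) * \<tau> \<le> real (n0 + N) * \<tau>" using tau by (intro mult_right_mono) auto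
        then show ?thesis using NT by (simp add: t_def algebra_simps)
      qed
      have "real_of_int A \<le> real_of_int (j - 1)" "real_of_int (j + 1) \<le> real_of_int B" using j by (simp_all only: of_int_le_iff) auto
      then have "real_of_int A * \<tau> \<le> xl" "xr \<le> real_of_int B * \<tau>" unfolding xl_def xr_def using tau by (auto intro!: mult_right_mono)
      then have X: "- X \<le> xl" "xr \<le> X" using A B by auto
      have lr: "xr = xl + 2 * \<tau>" by (simp add: xl_def xr_def algebra_simps)
      have "approx_ode m \<alpha> \<beta> \<epsilon> \<tau> y"
        unfolding approx_ode_def
      proof
        fix s assume s: "s \<in> {0..\<tau>}"
        define x1 x2 where "x1 = xl + s" and "x2 = xr - s"
        define e1 e2 where "e1 = H1 (x1, x1, t + s) - H1 (x1, x2, t + s)" and "e2 = H2 (x2, x2, t + s) - H2 (x1, x2, t + s)"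
        have mem: "(x1, x1, t + s) \<in> S" "(x1, x2, t + s) \<in> S" "(x2, x2, t + s) \<in> S"
          using s X lr t0 tT tau by (auto simp: S_def x1_def x2_def)
        have "\<bar>x1 - x2\<bar> < d1" "\<bar>x1 - x2\<bar> < d2" using s lr tau by (auto simp: x1_def x2_def \<tau>0_def)
        then have "dist (x1, x1, t + s) (x1, x2, t + s) < d1" "dist (x2, x2, t + s) (x1, x2, t + s) < d2"
          by (simp_all add: dist_Pair_Pair dist_real_def abs_minus_commute)
        then have e: "norm e1 < \<epsilon> / 2" "norm e2 < \<epsilon> / 2"
          using d1(2)[OF mem(2,1)] d2(2)[OF mem(2,3)] by (auto simp: e1_def e2_def dist_norm)
        have "(y has_vector_derivative (N1 m \<alpha> \<beta> (p x1 (t + s)) (q x1 (t + s)), N2 m \<alpha> \<beta> (p x2 (t + s)) (q x2 (t + s)))) (at s within {0..\<tau>})"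
          unfolding y_def x1_def x2_def using s t0
          by (intro has_vector_derivative_Pair smooth_sol_characteristics[OF sol]) auto
        moreover have "(N1 m \<alpha> \<beta> (p x1 (t + s)) (q x1 (t + s)), N2 m \<alpha> \<beta> (p x2 (t + s)) (q x2 (t + s))) = Nvec m \<alpha> \<beta> (y s) + (e1, e2)"
          by (simp add: Nvec_def y_def e1_def e2_def H1_def H2_def x1_def x2_def)
        moreover have "norm (e1, e2) \<le> \<epsilon>" using e norm_Pair_le[of e1 e2] by linarith
        ultimately show "\<exists>e. (y has_vector_derivative Nvec m \<alpha> \<beta> (y s) + e) (at s within {0..\<tau>}) \<and> norm e \<le> \<epsilon>" by metis
      qed
      moreover have "y 0 = (p (real_of_int (j - 1) * \<tau>) (real (n0 + n) * \<tau>), q (real_of_int (j + 1) * \<tau>) (real (n0 + n) * \<tau>))"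
        by (simp add: y_def xl_def xr_def t_def)
      moreover have "y \<tau> = (p (real_of_int j * \<tau>) (real (n0 + Suc n) * \<tau>), q (real_of_int j * \<tau>) (real (n0 + Suc n) * \<tau>))"
      proof -
        have "xl + \<tau> = real_of_int j * \<tau>" "xr - \<tau> = real_of_int j * \<tau>" "t + \<tau> = real (n0 + Suc n) * \<tau>"
          by (simp_all add: xl_def xr_def t_def algebra_simps)
        then show ?thesis by (simp add: y_def)
      qed
      ultimately show "\<exists>y. approx_ode m \<alpha> \<beta> \<epsilon> \<tau> y \<and>
          y 0 = (p (real_of_int (j - 1) * \<tau>) (real (n0 + n) * \<tau>), q (real_of_int (j + 1) * \<tau>) (real (n0 + n) * \<tau>)) \<and>
          y \<tau> = (p (real_of_int j * \<tau>) (real (n0 + Suc n) * \<tau>), q (real_of_int j * \<tau>) (real (n0 + Suc n) * \<tau>))" by blast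
    qed
  qed
qed

section \<open>The time-splitting solution as a lattice scheme\<close>

lemma ts_sol_step:
  assumes ts: "ts_sol m \<alpha> \<beta> \<tau> a b U V"
  shows "\<exists>y. approx_ode m \<alpha> \<beta> 0 \<tau> y \<and> y 0 = (U (x - \<tau>) (real n * \<tau>), V (x + \<tau>) (real n * \<tau>)) \<and>
    y \<tau> = (U x (real (Suc n) * \<tau>), V x (real (Suc n) * \<tau>))"
proof -
  obtain y where "y 0 = (U (x - \<tau>) (real n * \<tau>), V (x + \<tau>) (real n * \<tau>))"
    "\<And>s. s\<in>{0..\<tau>} \<Longrightarrow> (y has_vector_derivative Nvec m \<alpha> \<beta> (y s)) (at s within {0..\<tau>})"
    "(U x ((real n + 1) * \<tau>), V x ((real n + 1) * \<tau>)) = y \<tau>"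
    using ts unfolding ts_sol_def by blast
  moreover from this(2) have "approx_ode m \<alpha> \<beta> 0 \<tau> y"
    unfolding approx_ode_def by (intro ballI exI[of _ 0]) simp
  ultimately show ?thesis by (intro exI[of _ y]) (auto simp: add.commute)
qed

text \<open>Transport over one step moves by exactly one cell width, so it maps cells to cells;
  uniqueness for the ODE then preserves constancy on cells. The scheme is therefore determined by
  its samples at left endpoints.\<close>

lemma ts_sol_piecewise_constant:
  assumes ts: "ts_sol m \<alpha> \<beta> \<tau> a b U V" and tau: "0 < \<tau>"
  shows "U x (real n * \<tau>) = U (real_of_int \<lfloor>x / \<tau>\<rfloor> * \<tau>) (real n * \<tau>) \<and> V x (real n * \<tau>) = V (real_of_int \<lfloor>x / \<tau>\<rfloor> * \<tau>) (real n * \<tau>)"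
proof (induction n arbitrary: x)
  case 0
  have "\<lfloor>(real_of_int \<lfloor>x / \<tau>\<rfloor> * \<tau>) / \<tau>\<rfloor> = \<lfloor>x / \<tau>\<rfloor>" using tau by simp
  then show ?case using ts unfolding ts_sol_def by simp
next
  case (Suc n)
  define x' where "x' = real_of_int \<lfloor>x / \<tau>\<rfloor> * \<tau>"
  have fl: "\<lfloor>(x - \<tau>) / \<tau>\<rfloor> = \<lfloor>x / \<tau>\<rfloor> - 1" "\<lfloor>(x + \<tau>) / \<tau>\<rfloor> = \<lfloor>x / \<tau>\<rfloor> + 1" for x
    using tau by (simp_all add: diff_divide_distrib add_divide_distrib)
  have fx: "\<lfloor>x' / \<tau>\<rfloor> = \<lfloor>x / \<tau>\<rfloor>" using tau by (simp add: x'_def)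
  obtain y where y: "approx_ode m \<alpha> \<beta> 0 \<tau> y" "y 0 = (U (x - \<tau>) (real n * \<tau>), V (x + \<tau>) (real n * \<tau>))"
    "y \<tau> = (U x (real (Suc n) * \<tau>), V x (real (Suc n) * \<tau>))" using ts_sol_step[OF ts] by blast
  obtain z where z: "approx_ode m \<alpha> \<beta> 0 \<tau> z" "z 0 = (U (x' - \<tau>) (real n * \<tau>), V (x' + \<tau>) (real n * \<tau>))"
    "z \<tau> = (U x' (real (Suc n) * \<tau>), V x' (real (Suc n) * \<tau>))" using ts_sol_step[OF ts] by blast
  have "y 0 = z 0"
    unfolding y z using Suc[of "x - \<tau>"] Suc[of "x' - \<tau>"] Suc[of "x + \<tau>"] Suc[of "x' + \<tau>"] by (simp add: fl fx)
  from approx_ode_unique[OF y(1) z(1) this] show ?case using tau y(3) z(3) by (simp add: x'_def)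
qed

text \<open>Between grid times the components are shifted by \<theta> in opposite directions and are
  constant on two different families of cells. This is why the cell estimates that follow carry a
  shift.\<close>

lemma ts_sol_between:
  assumes ts: "ts_sol m \<alpha> \<beta> \<tau> a b U V" and tau: "0 < \<tau>" and t: "0 \<le> t"
  defines "n \<equiv> nat \<lfloor>t / \<tau>\<rfloor>" defines "\<theta> \<equiv> t - real n * \<tau>"
  shows "U x t = U (real_of_int \<lfloor>(x - \<theta>) / \<tau>\<rfloor> * \<tau>) (real n * \<tau>)"
    and "V x t = V (real_of_int \<lfloor>(x + \<theta>) / \<tau>\<rfloor> * \<tau>) (real n * \<tau>)"
    and "0 \<le> \<theta>" and "\<theta> < \<tau>"
proof -
  have rn: "real n = real_of_int \<lfloor>t / \<tau>\<rfloor>" using t tau by (simp add: n_def)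
  have "real n \<le> t / \<tau>" "t / \<tau> < real n + 1" unfolding rn by linarith+
  then have mem: "t \<in> {real n * \<tau> ..< (real n + 1) * \<tau>}" using tau by (auto simp: field_simps)
  then show "0 \<le> \<theta>" "\<theta> < \<tau>" by (auto simp: \<theta>_def algebra_simps)
  have "U x t = U (x - \<theta>) (real n * \<tau>)" "V x t = V (x + \<theta>) (real n * \<tau>)"
    using ts mem unfolding ts_sol_def \<theta>_def by blast+
  then show "U x t = U (real_of_int \<lfloor>(x - \<theta>) / \<tau>\<rfloor> * \<tau>) (real n * \<tau>)" "V x t = V (real_of_int \<lfloor>(x + \<theta>) / \<tau>\<rfloor> * \<tau>) (real n * \<tau>)"
    using ts_sol_piecewise_constant[OF ts tau] by metis+
qed

lemma ts_sol_approx_scheme: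
  assumes ts: "ts_sol m \<alpha> \<beta> \<tau> a b U V"
  shows "approx_scheme m \<alpha> \<beta> 0 \<tau> N A B
       (grid U \<tau> n0) (grid V \<tau> n0)"
  unfolding approx_scheme_def
proof (intro allI impI ballI)
  fix n j
  have "real_of_int j * \<tau> - \<tau> = real_of_int (j - 1) * \<tau>" "real_of_int j * \<tau> + \<tau> = real_of_int (j + 1) * \<tau>" by (simp_all add: algebra_simps)
  then show "\<exists>y. approx_ode m \<alpha> \<beta> 0 \<tau> y \<and> y 0 = (U (real_of_int (j - 1) * \<tau>) (real (n0 + n) * \<tau>), V (real_of_int (j + 1) * \<tau>) (real (n0 + n) * \<tau>)) \<and>
    y \<tau> = (U (real_of_int j * \<tau>) (real (n0 + Suc n) * \<tau>), V (real_of_int j * \<tau>) (real (n0 + Suc n) * \<tau>))"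
    using ts_sol_step[OF ts, of "real_of_int j * \<tau>" "n0 + n"] by (simp only: add_Suc_right)
qed

subsection \<open>Lattice sums and square integrals\<close>

text \<open>Values in \<open>ennreal\<close> admit infinite energy. The smooth approximations are
  not known in advance to be square integrable at later times, and monotonicity needs no
  integrability conditions in this setting.\<close>

definition sq_int :: "real set \<Rightarrow> (real \<Rightarrow> complex) \<Rightarrow> ennreal" where
  "sq_int S f = (\<integral>\<^sup>+x. ennreal ((cmod (f x))\<^sup>2) * indicator S x \<partial>lborel)"

abbreviation cells :: "real \<Rightarrow> real \<Rightarrow> int \<Rightarrow> int \<Rightarrow> real set" where
  "cells \<tau> \<theta> A B \<equiv> {real_of_int A * \<tau> + \<theta> ..< (real_of_int B + 1) * \<tau> + \<theta>}"

lemma mem_cell_iff: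
  fixes x \<theta> \<tau> :: real
  assumes "0 < \<tau>"
  shows "\<lfloor>(x - \<theta>) / \<tau>\<rfloor> = j \<longleftrightarrow> x \<in> {real_of_int j * \<tau> + \<theta> ..< (real_of_int j + 1) * \<tau> + \<theta>}"
  using assms by (auto simp: floor_eq_iff field_simps)

lemma mem_cells_iff:
  fixes x \<theta> \<tau> :: real
  assumes "0 < \<tau>"
  shows "x \<in> cells \<tau> \<theta> A B \<longleftrightarrow> \<lfloor>(x - \<theta>) / \<tau>\<rfloor> \<in> {A..B}"
  using assms by (auto simp: le_floor_iff floor_le_iff field_simps)

lemma floor_measurable_real [measurable]: "(\<lambda>x::real. G \<lfloor>(x - \<theta>) / \<tau>\<rfloor>) \<in> borel_measurable borel" for G :: "int \<Rightarrow> 'b::topological_space"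
proof -
  have "(\<lambda>x::real. \<lfloor>(x - \<theta>) / \<tau>\<rfloor>) \<in> measurable borel (count_space UNIV)" by measurable
  then show ?thesis by (rule measurable_compose) simp
qed

lemma nn_integral_cells:
  fixes g :: "int \<Rightarrow> real"
  assumes tau: "0 < \<tau>" and g: "\<And>j. 0 \<le> g j"
  shows "(\<integral>\<^sup>+x. ennreal (g \<lfloor>(x - \<theta>) / \<tau>\<rfloor>) * indicator (cells \<tau> \<theta> A B) x \<partial>lborel)
    = ennreal (\<tau> * (\<Sum>j=A..B. g j))"
proof -
  let ?c = "\<lambda>j. {real_of_int j * \<tau> + \<theta> ..< (real_of_int j + 1) * \<tau> + \<theta>}"
  have "ennreal (g \<lfloor>(x - \<theta>) / \<tau>\<rfloor>) * indicator (cells \<tau> \<theta> A B) x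
      = (\<Sum>j=A..B. ennreal (g j) * indicator (?c j) x)" for x
  proof -
    have "(\<Sum>j=A..B. ennreal (g j) * indicator (?c j) x) = (\<Sum>j=A..B. if \<lfloor>(x - \<theta>) / \<tau>\<rfloor> = j then ennreal (g j) else 0)"
      unfolding indicator_def mem_cell_iff[OF tau, symmetric] by (intro sum.cong) auto
    then show ?thesis unfolding indicator_def mem_cells_iff[OF tau] by (simp add: sum.delta)
  qed
  then have "(\<integral>\<^sup>+x. ennreal (g \<lfloor>(x - \<theta>) / \<tau>\<rfloor>) * indicator (cells \<tau> \<theta> A B) x \<partial>lborel)
      = (\<integral>\<^sup>+x. (\<Sum>j=A..B. ennreal (g j) * indicator (?c j) x) \<partial>lborel)" by simp
  also have "\<dots> = (\<Sum>j=A..B. ennreal (g j) * emeasure lborel (?c j))"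
    by (subst nn_integral_sum) (auto simp: nn_integral_cmult_indicator)
  also have "\<dots> = (\<Sum>j=A..B. ennreal (g j * \<tau>))"
    using tau g by (intro sum.cong refl) (simp add: ennreal_mult algebra_simps)
  also have "\<dots> = ennreal (\<Sum>j=A..B. g j * \<tau>)" using tau g by (intro sum_ennreal) auto
  finally show ?thesis by (simp add: sum_distrib_left mult.commute)
qed

lemma cmod_add_square_le: "(cmod (a + b))\<^sup>2 \<le> 2 * (cmod a)\<^sup>2 + 2 * (cmod b)\<^sup>2"
proof -
  have "(cmod (a + b))\<^sup>2 \<le> (cmod a + cmod b)\<^sup>2" by (intro power_mono norm_triangle_ineq) auto
  also have "\<dots> \<le> 2 * (cmod a)\<^sup>2 + 2 * (cmod b)\<^sup>2" using sum_squares_bound[of "cmod a" "cmod b"] by (simp add: power2_sum)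
  finally show ?thesis .
qed

text \<open>On each shifted cell \<phi> is replaced by its sample \<open>w j\<close> at cost
  \<omega>, and squaring a sum costs a factor 2. Together with the converse estimate below this
  translates between integrals and lattice sums, even though shifted cells are not aligned with the
  sample points.\<close>

lemma sq_int_cells_le:
  assumes tau: "0 < \<tau>"
    and close: "\<And>j x. j \<in> {A..B} \<Longrightarrow> real_of_int j * \<tau> + \<theta> \<le> x \<Longrightarrow> x \<le> (real_of_int j + 1) * \<tau> + \<theta> \<Longrightarrow> cmod (\<phi> x - w j) \<le> \<omega>"
  shows "sq_int (cells \<tau> \<theta> A B) (\<lambda>x. G \<lfloor>(x - \<theta>) / \<tau>\<rfloor> - \<phi> x)
     \<le> ennreal (2 * (\<tau> * (\<Sum>j=A..B. (cmod (G j - w j))\<^sup>2)) + 2 * (\<omega>\<^sup>2 * (\<tau> * real (card {A..B}))))"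
proof -
  let ?S = "cells \<tau> \<theta> A B"
  have "sq_int ?S (\<lambda>x. G \<lfloor>(x - \<theta>) / \<tau>\<rfloor> - \<phi> x)
    \<le> (\<integral>\<^sup>+x. ennreal ((\<lambda>j. 2 * (cmod (G j - w j))\<^sup>2 + 2 * \<omega>\<^sup>2) \<lfloor>(x - \<theta>) / \<tau>\<rfloor>) * indicator ?S x \<partial>lborel)"
    unfolding sq_int_def
  proof (rule nn_integral_mono)
    fix x
    show "ennreal ((cmod (G \<lfloor>(x - \<theta>) / \<tau>\<rfloor> - \<phi> x))\<^sup>2) * indicator ?S x
        \<le> ennreal ((\<lambda>j. 2 * (cmod (G j - w j))\<^sup>2 + 2 * \<omega>\<^sup>2) \<lfloor>(x - \<theta>) / \<tau>\<rfloor>) * indicator ?S x"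
    proof (cases "x \<in> ?S")
      case True
      define j where "j = \<lfloor>(x - \<theta>) / \<tau>\<rfloor>"
      have "j \<in> {A..B}" using True unfolding mem_cells_iff[OF tau] j_def .
      moreover have "x \<in> {real_of_int j * \<tau> + \<theta> ..< (real_of_int j + 1) * \<tau> + \<theta>}" using mem_cell_iff[OF tau] j_def by blast
      ultimately have "cmod (w j - \<phi> x) \<le> \<omega>" using close[of j x] by (auto simp: norm_minus_commute)
      then have "(cmod (w j - \<phi> x))\<^sup>2 \<le> \<omega>\<^sup>2" by (intro power_mono) auto
      then have "(cmod (G j - \<phi> x))\<^sup>2 \<le> 2 * (cmod (G j - w j))\<^sup>2 + 2 * \<omega>\<^sup>2"
        using cmod_add_square_le[of "G j - w j" "w j - \<phi> x"] by simp
      then show ?thesis unfolding j_def[symmetric] by (intro mult_right_mono ennreal_leI) auto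
    qed simp
  qed
  also have "\<dots> = ennreal (\<tau> * (\<Sum>j=A..B. 2 * (cmod (G j - w j))\<^sup>2 + 2 * \<omega>\<^sup>2))"
    by (rule nn_integral_cells[OF tau]) auto
  also have "\<tau> * (\<Sum>j=A..B. 2 * (cmod (G j - w j))\<^sup>2 + 2 * \<omega>\<^sup>2)
      = 2 * (\<tau> * (\<Sum>j=A..B. (cmod (G j - w j))\<^sup>2)) + 2 * (\<omega>\<^sup>2 * (\<tau> * real (card {A..B})))"
    by (simp add: sum.distrib sum_distrib_left[symmetric] algebra_simps)
  finally show ?thesis .
qed

lemma sum_cells_le_sq_int:
  assumes tau: "0 < \<tau>" and \<phi>[measurable]: "\<phi> \<in> borel_measurable borel"
    and close: "\<And>j x. j \<in> {A..B} \<Longrightarrow> real_of_int j * \<tau> + \<theta> \<le> x \<Longrightarrow> x \<le> (real_of_int j + 1) * \<tau> + \<theta> \<Longrightarrow> cmod (\<phi> x - w j) \<le> \<omega>"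
  shows "ennreal (\<tau> * (\<Sum>j=A..B. (cmod (G j - w j))\<^sup>2))
     \<le> 2 * sq_int (cells \<tau> \<theta> A B) (\<lambda>x. G \<lfloor>(x - \<theta>) / \<tau>\<rfloor> - \<phi> x)
       + ennreal (2 * (\<omega>\<^sup>2 * (\<tau> * real (card {A..B}))))"
proof -
  let ?S = "cells \<tau> \<theta> A B"
  have "ennreal (\<tau> * (\<Sum>j=A..B. (cmod (G j - w j))\<^sup>2))
      = (\<integral>\<^sup>+x. ennreal ((\<lambda>j. (cmod (G j - w j))\<^sup>2) \<lfloor>(x - \<theta>) / \<tau>\<rfloor>) * indicator ?S x \<partial>lborel)"
    by (rule nn_integral_cells[OF tau, symmetric]) auto
  also have "\<dots> \<le> (\<integral>\<^sup>+x. 2 * (ennreal ((cmod (G \<lfloor>(x - \<theta>) / \<tau>\<rfloor> - \<phi> x))\<^sup>2) * indicator ?S x)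
       + ennreal ((\<lambda>j. 2 * \<omega>\<^sup>2) \<lfloor>(x - \<theta>) / \<tau>\<rfloor>) * indicator ?S x \<partial>lborel)"
  proof (rule nn_integral_mono)
    fix x
    show "ennreal ((\<lambda>j. (cmod (G j - w j))\<^sup>2) \<lfloor>(x - \<theta>) / \<tau>\<rfloor>) * indicator ?S x
        \<le> 2 * (ennreal ((cmod (G \<lfloor>(x - \<theta>) / \<tau>\<rfloor> - \<phi> x))\<^sup>2) * indicator ?S x) + ennreal ((\<lambda>j. 2 * \<omega>\<^sup>2) \<lfloor>(x - \<theta>) / \<tau>\<rfloor>) * indicator ?S x"
    proof (cases "x \<in> ?S")
      case True
      define j where "j = \<lfloor>(x - \<theta>) / \<tau>\<rfloor>"
      have "j \<in> {A..B}" using True unfolding mem_cells_iff[OF tau] j_def .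
      moreover have "x \<in> {real_of_int j * \<tau> + \<theta> ..< (real_of_int j + 1) * \<tau> + \<theta>}" using mem_cell_iff[OF tau] j_def by blast
      ultimately have "cmod (\<phi> x - w j) \<le> \<omega>" using close[of j x] by auto
      then have "(cmod (\<phi> x - w j))\<^sup>2 \<le> \<omega>\<^sup>2" by (intro power_mono) auto
      then have "(cmod (G j - w j))\<^sup>2 \<le> 2 * (cmod (G j - \<phi> x))\<^sup>2 + 2 * \<omega>\<^sup>2"
        using cmod_add_square_le[of "G j - \<phi> x" "\<phi> x - w j"] by simp
      then have "ennreal ((cmod (G j - w j))\<^sup>2) \<le> ennreal (2 * (cmod (G j - \<phi> x))\<^sup>2 + 2 * \<omega>\<^sup>2)" by (rule ennreal_leI)
      also have "\<dots> = 2 * ennreal ((cmod (G j - \<phi> x))\<^sup>2) + ennreal (2 * \<omega>\<^sup>2)"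
        by (subst ennreal_plus) (simp_all add: ennreal_mult)
      finally show ?thesis using True unfolding j_def[symmetric] by simp
    qed simp
  qed
  also have "\<dots> = 2 * sq_int ?S (\<lambda>x. G \<lfloor>(x - \<theta>) / \<tau>\<rfloor> - \<phi> x) + ennreal (\<tau> * (\<Sum>j=A..B. 2 * \<omega>\<^sup>2))"
    unfolding sq_int_def nn_integral_cells[OF tau, of "\<lambda>j. 2 * \<omega>\<^sup>2", simplified, symmetric]
    by (subst nn_integral_add) (simp_all add: nn_integral_cmult nn_integral_cells[OF tau, of "\<lambda>j. 2 * \<omega>\<^sup>2", simplified] del: nn_integral_indicator nn_integral_cmult_indicator)
  finally show ?thesis by (simp add: algebra_simps)
qed

lemma sq_int_mono: "S \<subseteq> S' \<Longrightarrow> sq_int S f \<le> sq_int S' f"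
  unfolding sq_int_def by (intro nn_integral_mono mult_left_mono) (auto simp: indicator_def)

text \<open>A cone of base \<open>[c - 2 h, e + 2 h]\<close> at time \<open>a\<close> covers \<open>[c, e]\<close> during \<open>[a, a + h]\<close>, with
  room for the cells that are shifted by less than \<open>\<tau>\<close>.\<close>
lemma cone_indices:
  fixes a h t \<tau> c e :: real
  assumes tau: "0 < \<tau>" "\<tau> \<le> h / 10" and t: "0 \<le> a" "a \<le> t" "t \<le> a + h" and ce: "c \<le> e" and h: "h \<le> 1 / 2"
  defines "n0 \<equiv> nat \<lfloor>a / \<tau>\<rfloor>" and "N \<equiv> nat \<lfloor>t / \<tau>\<rfloor> - nat \<lfloor>a / \<tau>\<rfloor>"
    and "A \<equiv> \<lceil>(c - 2 * h) / \<tau>\<rceil> + 1" and "B \<equiv> \<lfloor>(e + 2 * h) / \<tau>\<rfloor> - 2"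
  shows "n0 + N = nat \<lfloor>t / \<tau>\<rfloor>" "real N * \<tau> \<le> 1" "A + 2 * int N \<le> B + 1"
    "\<tau> * real_of_int (B - A + 1) \<le> e - c + 4 * h" "\<tau> * real (card {A..B}) \<le> e - c + 4 * h"
    "\<tau> * real (card {A + int N..B - int N}) \<le> e - c + 4 * h"
    "c - 2 * h + \<tau> \<le> real_of_int A * \<tau>" "(real_of_int B + 1) * \<tau> + \<tau> \<le> e + 2 * h"
    "real (n0 + N) * \<tau> \<le> a + h"
    "\<bar>\<theta>\<bar> < \<tau> \<Longrightarrow> cells \<tau> \<theta> A B \<subseteq> {c - 2 * h .. e + 2 * h}"
    "\<bar>\<theta>\<bar> < \<tau> \<Longrightarrow> {c..e} \<subseteq> cells \<tau> \<theta> (A + int N) (B - int N)"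
proof -
  have at: "a / \<tau> \<le> t / \<tau>" using t tau by (simp add: divide_right_mono)
  then have fl: "\<lfloor>a / \<tau>\<rfloor> \<le> \<lfloor>t / \<tau>\<rfloor>" by (rule floor_mono)
  have fa: "0 \<le> \<lfloor>a / \<tau>\<rfloor>" using t tau by simp
  show n0N: "n0 + N = nat \<lfloor>t / \<tau>\<rfloor>" using fl fa by (simp add: n0_def N_def)
  have rN: "real N = real_of_int \<lfloor>t / \<tau>\<rfloor> - real_of_int \<lfloor>a / \<tau>\<rfloor>" using fl fa by (simp add: N_def of_nat_diff nat_mono del: zero_le_floor)
  have "real N \<le> t / \<tau> - a / \<tau> + 1" unfolding rN by linarith
  then have "real N * \<tau> \<le> (t / \<tau> - a / \<tau> + 1) * \<tau>" using tau by (intro mult_right_mono) auto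
  also have "\<dots> = t - a + \<tau>" using tau by (simp add: field_simps)
  \<comment> \<open>Rounding both times down may add almost one step, so either side of the cone
    retreats by at most h + \<tau>. Rounding of the endpoints and the shift cost another 3 \<tau> on
    each side; h + 4 \<tau> stays below the available 2 h because \<tau> is at most h / 10.\<close>
  finally have Nt: "real N * \<tau> \<le> h + \<tau>" using t by linarith
  then show "real N * \<tau> \<le> 1" using h tau by linarith
  have "(c - 2 * h) / \<tau> + 1 \<le> real_of_int A" "real_of_int A \<le> (c - 2 * h) / \<tau> + 2" unfolding A_def by linarith+
  then have A: "c - 2 * h + \<tau> \<le> real_of_int A * \<tau>" "real_of_int A * \<tau> \<le> c - 2 * h + 2 * \<tau>"
    using tau by (auto simp: field_simps)
  have "real_of_int B \<le> (e + 2 * h) / \<tau> - 2" "(e + 2 * h) / \<tau> - 3 \<le> real_of_int B" unfolding B_def by linarith+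
  then have B: "real_of_int B * \<tau> \<le> e + 2 * h - 2 * \<tau>" "e + 2 * h - 3 * \<tau> \<le> real_of_int B * \<tau>"
    using tau by (auto simp: field_simps)
  show "c - 2 * h + \<tau> \<le> real_of_int A * \<tau>" by (rule A(1))
  show "(real_of_int B + 1) * \<tau> + \<tau> \<le> e + 2 * h" using B(1) by (simp add: algebra_simps)
  have "(real_of_int A + 2 * real N) * \<tau> \<le> (real_of_int B + 1) * \<tau>"
    using A B Nt tau ce by (simp add: algebra_simps)
  then have "real_of_int A + 2 * real N \<le> real_of_int B + 1" using tau by simp
  then show AB: "A + 2 * int N \<le> B + 1" by linarith
  show len: "\<tau> * real_of_int (B - A + 1) \<le> e - c + 4 * h" using A B tau by (simp add: algebra_simps)
  then show card: "\<tau> * real (card {A..B}) \<le> e - c + 4 * h" using AB by simp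
  have "card {A + int N..B - int N} \<le> card {A..B}" by (intro card_mono) auto
  then have "\<tau> * real (card {A + int N..B - int N}) \<le> \<tau> * real (card {A..B})" using tau by (intro mult_left_mono) auto
  then show "\<tau> * real (card {A + int N..B - int N}) \<le> e - c + 4 * h" using card by linarith
  show "real (n0 + N) * \<tau> \<le> a + h"
  proof -
    have "real (n0 + N) = real_of_int \<lfloor>t / \<tau>\<rfloor>" using order.trans[OF fa fl] unfolding n0N by simp
    also have "\<dots> \<le> t / \<tau>" by linarith
    finally have "real (n0 + N) * \<tau> \<le> t" using tau by (simp add: field_simps)
    then show ?thesis using t by linarith
  qed
  assume \<theta>: "\<bar>\<theta>\<bar> < \<tau>"
  then show "cells \<tau> \<theta> A B \<subseteq> {c - 2 * h .. e + 2 * h}"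
    using A B by (auto simp: algebra_simps)
  have "real_of_int (A + int N) * \<tau> + \<theta> \<le> c" "e < (real_of_int (B - int N) + 1) * \<tau> + \<theta>"
    using A B Nt \<theta> tau by (auto simp: algebra_simps)
  then show "{c..e} \<subseteq> cells \<tau> \<theta> (A + int N) (B - int N)" by auto
qed

section \<open>Energies of pairs and their lattice counterparts\<close>

definition energy :: "real set \<Rightarrow> (real \<Rightarrow> complex) \<Rightarrow> (real \<Rightarrow> complex) \<Rightarrow> ennreal" where
  "energy S f g = sq_int S f + sq_int S g"

abbreviation charge :: "real set \<Rightarrow> (real \<Rightarrow> real \<Rightarrow> complex) \<Rightarrow> (real \<Rightarrow> real \<Rightarrow> complex) \<Rightarrow> real \<Rightarrow> ennreal" where
  "charge S u v t \<equiv> energy S (\<lambda>x. u x t) (\<lambda>x. v x t)"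

abbreviation gap :: "real set \<Rightarrow> (real \<Rightarrow> real \<Rightarrow> complex) \<Rightarrow> (real \<Rightarrow> real \<Rightarrow> complex)
    \<Rightarrow> (real \<Rightarrow> real \<Rightarrow> complex) \<Rightarrow> (real \<Rightarrow> real \<Rightarrow> complex) \<Rightarrow> real \<Rightarrow> ennreal" where
  "gap S u v p q t \<equiv> energy S (\<lambda>x. u x t - p x t) (\<lambda>x. v x t - q x t)"

lemma energy_mono: "S \<subseteq> S' \<Longrightarrow> energy S f g \<le> energy S' f g"
  unfolding energy_def by (intro add_mono sq_int_mono)

text \<open>The first function is constant on cells shifted by \<theta> and the second on cells
  shifted by -\<theta>, so the covering is demanded for all small shifts at once. The distance 2
  \<tau> in the sampling condition is a cell width plus a shift.\<close>

lemma energy_cells_upper: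
  assumes tau: "0 < \<tau>" and \<theta>: "\<bar>\<theta>\<bar> < \<tau>"
    and f: "\<And>x. f x = F \<lfloor>(x - \<theta>) / \<tau>\<rfloor>" and g: "\<And>x. g x = G \<lfloor>(x + \<theta>) / \<tau>\<rfloor>"
    and cover: "\<And>\<theta>. \<bar>\<theta>\<bar> < \<tau> \<Longrightarrow> {c..e} \<subseteq> cells \<tau> \<theta> A B"
    and close: "\<And>j x. j \<in> {A..B} \<Longrightarrow> \<bar>x - real_of_int j * \<tau>\<bar> \<le> 2 * \<tau> \<Longrightarrow> cmod (\<phi> x - w j) \<le> \<omega> \<and> cmod (\<psi> x - z j) \<le> \<omega>"
  shows "energy {c..e} (\<lambda>x. f x - \<phi> x) (\<lambda>x. g x - \<psi> x)
    \<le> ennreal (2 * (\<tau> * (\<Sum>j=A..B. (cmod (F j - w j))\<^sup>2 + (cmod (G j - z j))\<^sup>2)) + 4 * (\<omega>\<^sup>2 * (\<tau> * real (card {A..B}))))"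
proof -
  have cl: "cmod (\<phi> x - w j) \<le> \<omega> \<and> cmod (\<psi> x - z j) \<le> \<omega>"
    if "j \<in> {A..B}" "real_of_int j * \<tau> + \<theta>' \<le> x" "x \<le> (real_of_int j + 1) * \<tau> + \<theta>'" "\<bar>\<theta>'\<bar> < \<tau>" for j x \<theta>'
  proof (rule close)
    have "x \<le> real_of_int j * \<tau> + \<tau> + \<theta>'" using that(3) by (simp add: distrib_right)
    then show "\<bar>x - real_of_int j * \<tau>\<bar> \<le> 2 * \<tau>" using that(2,4) by linarith
  qed (rule that)
  let ?S = "\<lambda>\<theta>. cells \<tau> \<theta> A B"
  have "sq_int {c..e} (\<lambda>x. f x - \<phi> x) \<le> sq_int (?S \<theta>) (\<lambda>x. F \<lfloor>(x - \<theta>) / \<tau>\<rfloor> - \<phi> x)"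
    unfolding f by (intro sq_int_mono cover \<theta>)
  also have "\<dots> \<le> ennreal (2 * (\<tau> * (\<Sum>j=A..B. (cmod (F j - w j))\<^sup>2)) + 2 * (\<omega>\<^sup>2 * (\<tau> * real (card {A..B}))))"
    by (rule sq_int_cells_le[OF tau]) (use cl \<theta> in \<open>auto\<close>)
  finally have 1: "sq_int {c..e} (\<lambda>x. f x - \<phi> x) \<le> \<dots>" .
  have "sq_int {c..e} (\<lambda>x. g x - \<psi> x) \<le> sq_int (?S (- \<theta>)) (\<lambda>x. G \<lfloor>(x - (- \<theta>)) / \<tau>\<rfloor> - \<psi> x)"
    unfolding g diff_minus_eq_add using \<theta> by (intro sq_int_mono cover) auto
  also have "\<dots> \<le> ennreal (2 * (\<tau> * (\<Sum>j=A..B. (cmod (G j - z j))\<^sup>2)) + 2 * (\<omega>\<^sup>2 * (\<tau> * real (card {A..B}))))"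
    by (rule sq_int_cells_le[OF tau]) (use cl[where \<theta>' = "- \<theta>"] \<theta> in \<open>auto\<close>)
  finally have 2: "sq_int {c..e} (\<lambda>x. g x - \<psi> x) \<le> \<dots>" .
  have "energy {c..e} (\<lambda>x. f x - \<phi> x) (\<lambda>x. g x - \<psi> x)
     \<le> ennreal (2 * (\<tau> * (\<Sum>j=A..B. (cmod (F j - w j))\<^sup>2)) + 2 * (\<omega>\<^sup>2 * (\<tau> * real (card {A..B}))))
     + ennreal (2 * (\<tau> * (\<Sum>j=A..B. (cmod (G j - z j))\<^sup>2)) + 2 * (\<omega>\<^sup>2 * (\<tau> * real (card {A..B}))))"
    unfolding energy_def by (intro add_mono 1 2)
  also have "\<dots> = ennreal (2 * (\<tau> * (\<Sum>j=A..B. (cmod (F j - w j))\<^sup>2 + (cmod (G j - z j))\<^sup>2)) + 4 * (\<omega>\<^sup>2 * (\<tau> * real (card {A..B}))))"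
    using tau by (subst ennreal_plus[symmetric])
      (auto simp: sum.distrib algebra_simps intro!: add_nonneg_nonneg mult_nonneg_nonneg sum_nonneg arg_cong[of _ _ ennreal])
  finally show ?thesis .
qed

lemma energy_cells_lower:
  assumes tau: "0 < \<tau>" and \<theta>: "\<bar>\<theta>\<bar> < \<tau>" and meas: "\<phi> \<in> borel_measurable borel" "\<psi> \<in> borel_measurable borel"
    and f: "\<And>x. f x = F \<lfloor>(x - \<theta>) / \<tau>\<rfloor>" and g: "\<And>x. g x = G \<lfloor>(x + \<theta>) / \<tau>\<rfloor>"
    and sub: "\<And>\<theta>. \<bar>\<theta>\<bar> < \<tau> \<Longrightarrow> cells \<tau> \<theta> A B \<subseteq> S"
    and close: "\<And>j x. j \<in> {A..B} \<Longrightarrow> \<bar>x - real_of_int j * \<tau>\<bar> \<le> 2 * \<tau> \<Longrightarrow> cmod (\<phi> x - w j) \<le> \<omega> \<and> cmod (\<psi> x - z j) \<le> \<omega>"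
  shows "ennreal (\<tau> * (\<Sum>j=A..B. (cmod (F j - w j))\<^sup>2 + (cmod (G j - z j))\<^sup>2))
    \<le> 2 * energy S (\<lambda>x. f x - \<phi> x) (\<lambda>x. g x - \<psi> x) + ennreal (4 * (\<omega>\<^sup>2 * (\<tau> * real (card {A..B}))))"
proof -
  have cl: "cmod (\<phi> x - w j) \<le> \<omega> \<and> cmod (\<psi> x - z j) \<le> \<omega>"
    if "j \<in> {A..B}" "real_of_int j * \<tau> + \<theta>' \<le> x" "x \<le> (real_of_int j + 1) * \<tau> + \<theta>'" "\<bar>\<theta>'\<bar> < \<tau>" for j x \<theta>'
  proof (rule close)
    have "x \<le> real_of_int j * \<tau> + \<tau> + \<theta>'" using that(3) by (simp add: distrib_right)
    then show "\<bar>x - real_of_int j * \<tau>\<bar> \<le> 2 * \<tau>" using that(2,4) by linarith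
  qed (rule that)
  let ?S = "\<lambda>\<theta>. cells \<tau> \<theta> A B"
  let ?r = "2 * (\<omega>\<^sup>2 * (\<tau> * real (card {A..B})))"
  have "ennreal (\<tau> * (\<Sum>j=A..B. (cmod (F j - w j))\<^sup>2)) \<le> 2 * sq_int (?S \<theta>) (\<lambda>x. F \<lfloor>(x - \<theta>) / \<tau>\<rfloor> - \<phi> x) + ennreal ?r"
    by (rule sum_cells_le_sq_int[OF tau meas(1)]) (use cl \<theta> in \<open>auto\<close>)
  also have "\<dots> \<le> 2 * sq_int S (\<lambda>x. f x - \<phi> x) + ennreal ?r"
    unfolding f by (intro add_mono mult_left_mono sq_int_mono sub \<theta>) auto
  finally have 1: "ennreal (\<tau> * (\<Sum>j=A..B. (cmod (F j - w j))\<^sup>2)) \<le> \<dots>" .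
  have "ennreal (\<tau> * (\<Sum>j=A..B. (cmod (G j - z j))\<^sup>2)) \<le> 2 * sq_int (?S (- \<theta>)) (\<lambda>x. G \<lfloor>(x - (- \<theta>)) / \<tau>\<rfloor> - \<psi> x) + ennreal ?r"
    by (rule sum_cells_le_sq_int[OF tau meas(2)]) (use cl[where \<theta>' = "- \<theta>"] \<theta> in \<open>auto\<close>)
  also have "\<dots> \<le> 2 * sq_int S (\<lambda>x. g x - \<psi> x) + ennreal ?r"
    unfolding g diff_minus_eq_add using \<theta> by (intro add_mono mult_left_mono sq_int_mono sub) auto
  finally have 2: "ennreal (\<tau> * (\<Sum>j=A..B. (cmod (G j - z j))\<^sup>2)) \<le> \<dots>" .
  have "ennreal (\<tau> * (\<Sum>j=A..B. (cmod (F j - w j))\<^sup>2 + (cmod (G j - z j))\<^sup>2))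
      = ennreal (\<tau> * (\<Sum>j=A..B. (cmod (F j - w j))\<^sup>2)) + ennreal (\<tau> * (\<Sum>j=A..B. (cmod (G j - z j))\<^sup>2))"
    using tau by (subst ennreal_plus[symmetric]) (auto simp: sum.distrib algebra_simps intro!: mult_nonneg_nonneg sum_nonneg)
  also have "\<dots> \<le> (2 * sq_int S (\<lambda>x. f x - \<phi> x) + ennreal ?r) + (2 * sq_int S (\<lambda>x. g x - \<psi> x) + ennreal ?r)"
    by (intro add_mono 1 2)
  also have "\<dots> = 2 * energy S (\<lambda>x. f x - \<phi> x) (\<lambda>x. g x - \<psi> x) + (ennreal ?r + ennreal ?r)"
    by (simp add: energy_def distrib_left ac_simps)
  also have "ennreal ?r + ennreal ?r = ennreal (4 * (\<omega>\<^sup>2 * (\<tau> * real (card {A..B}))))"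
    using tau by (subst ennreal_plus[symmetric]) auto
  finally show ?thesis .
qed

text \<open>Allows the charge of a smooth solution to be read as its distance from the zero lattice
  function, so that the cell estimates above also yield charge bounds.\<close>

lemma energy_uminus: "energy S (\<lambda>x. 0 - f x) (\<lambda>x. 0 - g x) = energy S f g"
  by (simp add: energy_def sq_int_def)

section \<open>Sampling smooth solutions on fine grids\<close>

lemma uniformly_close:
  fixes p :: "real \<Rightarrow> real \<Rightarrow> complex"
  assumes cont: "continuous_on UNIV (\<lambda>(x, t). p x t)" and \<omega>: "0 < \<omega>"
  shows "\<exists>\<tau>0>0. \<forall>\<tau> x x' t t'. \<tau> < \<tau>0 \<longrightarrow> \<bar>x\<bar> \<le> X \<longrightarrow> \<bar>x'\<bar> \<le> X \<longrightarrow> 0 \<le> t \<longrightarrow> t \<le> T \<longrightarrow> 0 \<le> t' \<longrightarrow> t' \<le> T \<longrightarrow>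
     \<bar>x - x'\<bar> \<le> 2 * \<tau> \<longrightarrow> \<bar>t - t'\<bar> \<le> \<tau> \<longrightarrow> cmod (p x t - p x' t') \<le> \<omega>"
proof -
  have "uniformly_continuous_on ({-X..X} \<times> {0..T}) (\<lambda>(x, t). p x t)"
    by (rule compact_uniformly_continuous) (auto intro: continuous_on_subset[OF cont] compact_Times)
  then obtain d where d: "0 < d" "\<And>z z'. z \<in> {-X..X} \<times> {0..T} \<Longrightarrow> z' \<in> {-X..X} \<times> {0..T} \<Longrightarrow> dist z' z < d \<Longrightarrow>
      dist ((\<lambda>(x, t). p x t) z') ((\<lambda>(x, t). p x t) z) < \<omega>"
    using \<omega> unfolding uniformly_continuous_on_def by metis
  show ?thesis
  proof (rule exI[of _ "d / 3"], intro conjI allI impI)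
    show "0 < d / 3" using d by simp
    fix \<tau> x x' t t' :: real
    assume *: "\<tau> < d / 3" "\<bar>x\<bar> \<le> X" "\<bar>x'\<bar> \<le> X" "0 \<le> t" "t \<le> T" "0 \<le> t'" "t' \<le> T" "\<bar>x - x'\<bar> \<le> 2 * \<tau>" "\<bar>t - t'\<bar> \<le> \<tau>"
    have "dist (x, t) (x', t') \<le> \<bar>x - x'\<bar> + \<bar>t - t'\<bar>"
      unfolding dist_Pair_Pair dist_real_def by (rule sqrt_sum_squares_le_sum) auto
    then have "dist (x, t) (x', t') < d" using * by linarith
    moreover have "(x', t') \<in> {-X..X} \<times> {0..T}" "(x, t) \<in> {-X..X} \<times> {0..T}" using * by auto
    ultimately have "dist (p x t) (p x' t') < \<omega>" using d(2)[of "(x', t')" "(x, t)"] by simp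
    then show "cmod (p x t - p x' t') \<le> \<omega>" by (simp add: dist_norm)
  qed
qed

text \<open>The grid on which both solutions are compared: a cone as above, with the smooth solution
  sampled at the corners of the cells.\<close>
definition sampled :: "real \<Rightarrow> real \<Rightarrow> real \<Rightarrow> (real \<Rightarrow> real \<Rightarrow> complex) \<Rightarrow> (real \<Rightarrow> real \<Rightarrow> complex) \<Rightarrow> real \<Rightarrow> real \<Rightarrow> real \<Rightarrow> real \<Rightarrow> real \<Rightarrow> real \<Rightarrow> real \<Rightarrow> bool" where
  "sampled m \<alpha> \<beta> p q \<omega> h c e a \<tau> t \<longleftrightarrow>
    \<tau> \<le> h / 10 \<and>
     (let n0 = nat \<lfloor>a / \<tau>\<rfloor>; N = nat \<lfloor>t / \<tau>\<rfloor> - nat \<lfloor>a / \<tau>\<rfloor>; A = \<lceil>(c - 2 * h) / \<tau>\<rceil> + 1; B = \<lfloor>(e + 2 * h) / \<tau>\<rfloor> - 2 in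
       approx_scheme m \<alpha> \<beta> \<omega> \<tau> N A B
         (grid p \<tau> n0) (grid q \<tau> n0) \<and>
       (\<forall>s\<in>{a..a+h}. \<forall>j\<in>{A..B}. \<forall>x. \<bar>x - real_of_int j * \<tau>\<bar> \<le> 2 * \<tau> \<longrightarrow>
         cmod (p x s - p (real_of_int j * \<tau>) (real (nat \<lfloor>s / \<tau>\<rfloor>) * \<tau>)) \<le> \<omega> \<and>
         cmod (q x s - q (real_of_int j * \<tau>) (real (nat \<lfloor>s / \<tau>\<rfloor>) * \<tau>)) \<le> \<omega>))"

lemma smooth_sol_sampling:
  assumes sol: "smooth_sol m \<alpha> \<beta> p q" and \<omega>: "0 < \<omega>" and h: "0 < h" "h \<le> 1 / 2" and ce: "c \<le> e" and a: "0 \<le> a"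
  shows "\<exists>\<tau>0>0. \<forall>\<tau> t. 0 < \<tau> \<longrightarrow> \<tau> < \<tau>0 \<longrightarrow> a \<le> t \<longrightarrow> t \<le> a + h \<longrightarrow> sampled m \<alpha> \<beta> p q \<omega> h c e a \<tau> t"
proof -
  \<comment> \<open>The base of the cone is enlarged by 2 h; the third h keeps all points within 2
    \<tau> of a grid point inside the compact set.\<close>
  define X where "X = \<bar>c\<bar> + \<bar>e\<bar> + 3 * h"
  define T where "T = a + h"
  obtain t1 where t1: "0 < t1" and sch: "\<And>\<tau> n0 N A B. 0 < \<tau> \<Longrightarrow> \<tau> < t1 \<Longrightarrow> - X \<le> real_of_int A * \<tau> \<Longrightarrow> real_of_int B * \<tau> \<le> X \<Longrightarrow>
     real (n0 + N) * \<tau> \<le> T \<Longrightarrow> approx_scheme m \<alpha> \<beta> \<omega> \<tau> N A B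
       (grid p \<tau> n0) (grid q \<tau> n0)"
    using smooth_sol_approx_scheme[OF sol \<omega>, of X T] by blast
  obtain t2 where t2: "0 < t2" and cp: "\<And>\<tau> x x' t t'. \<tau> < t2 \<Longrightarrow> \<bar>x\<bar> \<le> X \<Longrightarrow> \<bar>x'\<bar> \<le> X \<Longrightarrow> 0 \<le> t \<Longrightarrow> t \<le> T \<Longrightarrow> 0 \<le> t' \<Longrightarrow> t' \<le> T \<Longrightarrow>
     \<bar>x - x'\<bar> \<le> 2 * \<tau> \<Longrightarrow> \<bar>t - t'\<bar> \<le> \<tau> \<Longrightarrow> cmod (p x t - p x' t') \<le> \<omega>"
    using uniformly_close[OF smooth_sol_continuous(1)[OF sol] \<omega>, of X T] by blast
  obtain t3 where t3: "0 < t3" and cq: "\<And>\<tau> x x' t t'. \<tau> < t3 \<Longrightarrow> \<bar>x\<bar> \<le> X \<Longrightarrow> \<bar>x'\<bar> \<le> X \<Longrightarrow> 0 \<le> t \<Longrightarrow> t \<le> T \<Longrightarrow> 0 \<le> t' \<Longrightarrow> t' \<le> T \<Longrightarrow>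
     \<bar>x - x'\<bar> \<le> 2 * \<tau> \<Longrightarrow> \<bar>t - t'\<bar> \<le> \<tau> \<Longrightarrow> cmod (q x t - q x' t') \<le> \<omega>"
    using uniformly_close[OF smooth_sol_continuous(2)[OF sol] \<omega>, of X T] by blast
  define \<tau>0 where "\<tau>0 = min (min t1 (h / 10)) (min t2 t3)"
  show ?thesis unfolding sampled_def
  proof (rule exI[of _ \<tau>0], intro conjI allI impI)
    show "0 < \<tau>0" using t1 t2 t3 h by (simp add: \<tau>0_def)
    fix \<tau> t assume tau: "0 < \<tau>" "\<tau> < \<tau>0" and t: "a \<le> t" "t \<le> a + h"
    have tau': "\<tau> < t1" "\<tau> \<le> h / 10" "\<tau> < t2" "\<tau> < t3" using tau by (auto simp: \<tau>0_def)
    then show "\<tau> \<le> h / 10" by simp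
    define n0 N A B where "n0 = nat \<lfloor>a / \<tau>\<rfloor>" and "N = nat \<lfloor>t / \<tau>\<rfloor> - nat \<lfloor>a / \<tau>\<rfloor>" and "A = \<lceil>(c - 2 * h) / \<tau>\<rceil> + 1" and "B = \<lfloor>(e + 2 * h) / \<tau>\<rfloor> - 2"
    note ci = cone_indices[OF tau(1) tau'(2) a t ce h(2), folded n0_def N_def A_def B_def]
    have A: "c - 2 * h \<le> real_of_int A * \<tau>" and B: "real_of_int B * \<tau> \<le> e + 2 * h"
      using ci(7,8) tau by (auto simp: algebra_simps)
    have "approx_scheme m \<alpha> \<beta> \<omega> \<tau> N A B
         (grid p \<tau> n0) (grid q \<tau> n0)"
      using A B h ci(9) by (intro sch tau tau') (auto simp: X_def T_def)
    moreover have "cmod (p x s - p (real_of_int j * \<tau>) (real (nat \<lfloor>s / \<tau>\<rfloor>) * \<tau>)) \<le> \<omega> \<and>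
         cmod (q x s - q (real_of_int j * \<tau>) (real (nat \<lfloor>s / \<tau>\<rfloor>) * \<tau>)) \<le> \<omega>"
      if s: "s \<in> {a..a+h}" and j: "j \<in> {A..B}" and x: "\<bar>x - real_of_int j * \<tau>\<bar> \<le> 2 * \<tau>" for s j x
    proof -
      have "real_of_int A * \<tau> \<le> real_of_int j * \<tau>" "real_of_int j * \<tau> \<le> real_of_int B * \<tau>" using j tau by auto
      then have jX: "c - 2 * h \<le> real_of_int j * \<tau>" "real_of_int j * \<tau> \<le> e + 2 * h" using A B by auto
      then have X: "\<bar>real_of_int j * \<tau>\<bar> \<le> X" "\<bar>x\<bar> \<le> X" using x tau' h tau by (auto simp: X_def abs_le_iff)
      have s0: "0 \<le> s" using s a by auto
      have rn: "real (nat \<lfloor>s / \<tau>\<rfloor>) = real_of_int \<lfloor>s / \<tau>\<rfloor>" using s0 tau by simp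
      have "real (nat \<lfloor>s / \<tau>\<rfloor>) \<le> s / \<tau>" "s / \<tau> < real (nat \<lfloor>s / \<tau>\<rfloor>) + 1" unfolding rn by linarith+
      then have "real (nat \<lfloor>s / \<tau>\<rfloor>) * \<tau> \<le> s" "s \<le> real (nat \<lfloor>s / \<tau>\<rfloor>) * \<tau> + \<tau>" using tau by (auto simp: field_simps)
      moreover have "0 \<le> real (nat \<lfloor>s / \<tau>\<rfloor>) * \<tau>" using tau by simp
      ultimately show ?thesis using s s0 X x tau'(3,4) by (intro conjI cp[of \<tau>] cq[of \<tau>]) (auto simp: T_def)
    qed
    ultimately show "let n0 = nat \<lfloor>a / \<tau>\<rfloor>; N = nat \<lfloor>t / \<tau>\<rfloor> - nat \<lfloor>a / \<tau>\<rfloor>; A = \<lceil>(c - 2 * h) / \<tau>\<rceil> + 1; B = \<lfloor>(e + 2 * h) / \<tau>\<rfloor> - 2 in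
       approx_scheme m \<alpha> \<beta> \<omega> \<tau> N A B
         (grid p \<tau> n0) (grid q \<tau> n0) \<and>
       (\<forall>s\<in>{a..a+h}. \<forall>j\<in>{A..B}. \<forall>x. \<bar>x - real_of_int j * \<tau>\<bar> \<le> 2 * \<tau> \<longrightarrow>
         cmod (p x s - p (real_of_int j * \<tau>) (real (nat \<lfloor>s / \<tau>\<rfloor>) * \<tau>)) \<le> \<omega> \<and>
         cmod (q x s - q (real_of_int j * \<tau>) (real (nat \<lfloor>s / \<tau>\<rfloor>) * \<tau>)) \<le> \<omega>)"
      unfolding Let_def n0_def N_def A_def B_def by blast
  qed
qed

subsection \<open>Local charge and stability estimates\<close>

text \<open>The constant is 2 * 3 * 2: a factor 2 for each passage between integrals and lattice
  sums, and 3 for the growth on the cone. No smallness of the charge is involved, so the estimate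
  holds on arbitrarily long intervals.\<close>

lemma ts_sol_charge:
  assumes ts: "ts_sol m \<alpha> \<beta> \<tau> a0 b0 U V" and tau: "0 < \<tau>" "\<tau> \<le> h / 10"
    and t: "0 \<le> a" "a \<le> t" "t \<le> a + h" and ce: "c \<le> e" and h: "h \<le> 1 / 2"
  shows "charge {c..e} U V t \<le> 12 * charge {c - 2 * h..e + 2 * h} U V a"
proof -
  define n0 N A B where "n0 = nat \<lfloor>a / \<tau>\<rfloor>" and "N = nat \<lfloor>t / \<tau>\<rfloor> - nat \<lfloor>a / \<tau>\<rfloor>" and "A = \<lceil>(c - 2 * h) / \<tau>\<rceil> + 1" and "B = \<lfloor>(e + 2 * h) / \<tau>\<rfloor> - 2"
  note ci = cone_indices[OF tau t ce h, folded n0_def N_def A_def B_def]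
  have t0: "0 \<le> t" using t by simp
  note bt = ts_sol_between[OF ts tau(1) t0] and ba = ts_sol_between[OF ts tau(1) t(1), folded n0_def]
  define P Q where "P n j = grid U \<tau> n0 n j" and "Q n j = grid V \<tau> n0 n j" for n j
  define M where "M n = \<tau> * (\<Sum>j\<in>{A + int n..B - int n}. (cmod (P n j))\<^sup>2 + (cmod (Q n j))\<^sup>2)" for n
  have M0: "0 \<le> M n" for n using tau by (auto simp: M_def intro!: mult_nonneg_nonneg sum_nonneg)
  have "energy {c..e} (\<lambda>x. U x t - 0) (\<lambda>x. V x t - 0)
    \<le> ennreal (2 * (\<tau> * (\<Sum>j\<in>{A + int N..B - int N}. (cmod (P N j - 0))\<^sup>2 + (cmod (Q N j - 0))\<^sup>2)) + 4 * (0\<^sup>2 * (\<tau> * real (card {A + int N..B - int N}))))"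
    by (rule energy_cells_upper[OF tau(1), where \<theta> = "t - real (nat \<lfloor>t / \<tau>\<rfloor>) * \<tau>"])
      (use bt ci(11) in \<open>auto simp: P_def Q_def ci(1)\<close>)
  then have 1: "charge {c..e} U V t \<le> ennreal (2 * M N)" by (simp add: M_def)
  have "approx_scheme m \<alpha> \<beta> 0 \<tau> N A B P Q"
    unfolding P_def[abs_def] Q_def[abs_def] by (rule ts_sol_approx_scheme[OF ts])
  from approx_scheme_charge[OF this _ ci(2) order.refl] have "M N \<le> 3 * M 0" using tau by (simp add: M_def)
  then have "ennreal (2 * M N) \<le> ennreal (6 * M 0)" by (intro ennreal_leI) simp
  also have "\<dots> = 6 * ennreal (M 0)" using M0 by (simp add: ennreal_mult)
  also have "ennreal (M 0) \<le> 2 * charge {c - 2 * h..e + 2 * h} U V a"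
  proof -
    have "ennreal (\<tau> * (\<Sum>j=A..B. (cmod (P 0 j - 0))\<^sup>2 + (cmod (Q 0 j - 0))\<^sup>2))
       \<le> 2 * energy {c - 2 * h..e + 2 * h} (\<lambda>x. U x a - 0) (\<lambda>x. V x a - 0) + ennreal (4 * (0\<^sup>2 * (\<tau> * real (card {A..B}))))"
      by (rule energy_cells_lower[OF tau(1), where \<theta> = "a - real n0 * \<tau>"]) (use ba ci(10) in \<open>auto simp: P_def Q_def\<close>)
    then show ?thesis by (simp add: M_def)
  qed
  finally have "ennreal (2 * M N) \<le> 6 * (2 * charge {c - 2 * h..e + 2 * h} U V a)"
    by (simp add: mult_left_mono)
  with 1 have "charge {c..e} U V t \<le> 6 * (2 * charge {c - 2 * h..e + 2 * h} U V a)"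
    by (rule order.trans)
  then show ?thesis by (simp add: mult.assoc[symmetric])
qed

lemma smooth_sol_measurable:
  assumes "smooth_sol m \<alpha> \<beta> p q"
  shows "(\<lambda>x. p x t) \<in> borel_measurable borel" "(\<lambda>x. q x t) \<in> borel_measurable borel"
proof -
  have "continuous_on UNIV (\<lambda>x::real. (x, t))" by (intro continuous_intros)
  from continuous_on_compose2[OF smooth_sol_continuous(1)[OF assms] this]
    continuous_on_compose2[OF smooth_sol_continuous(2)[OF assms] this]
  have "continuous_on UNIV (\<lambda>x. p x t)" "continuous_on UNIV (\<lambda>x. q x t)" by auto
  then show "(\<lambda>x. p x t) \<in> borel_measurable borel" "(\<lambda>x. q x t) \<in> borel_measurable borel"
    by (auto intro: borel_measurable_continuous_onI)
qed

text \<open>Although no mesh occurs in the statement, the argument runs on one: on a fine grid the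
  smooth solution is an approximate scheme, and its forcing and sampling errors can be made
  arbitrarily small. No separate energy identity for the differential equation is used.\<close>

lemma smooth_sol_charge:
  assumes sol: "smooth_sol m \<alpha> \<beta> p q" and t: "0 \<le> a" "a \<le> t" "t \<le> a + h" and ce: "c \<le> e" and h: "0 < h" "h \<le> 1 / 2"
  shows "charge {c..e} p q t \<le> 12 * charge {c - 2 * h..e + 2 * h} p q a"
proof (rule ennreal_le_epsilon)
  fix \<eta> :: real assume \<eta>: "0 < \<eta>" and fin: "12 * charge {c - 2 * h..e + 2 * h} p q a < top"
  define len where "len = e - c + 4 * h"
  have len: "0 < len" using ce h by (simp add: len_def)
  \<comment> \<open>34 = 6 * 4 + 6 + 4 collects the sampling error at the initial time, the forcing,
    and the sampling error at the final time.\<close>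
  define \<omega> where "\<omega> = sqrt (\<eta> / (34 * len))"
  have \<omega>: "0 < \<omega>" "\<omega>\<^sup>2 * (34 * len) = \<eta>" using \<eta> len by (auto simp: \<omega>_def)
  obtain \<tau>0 where \<tau>0: "0 < \<tau>0" and samp: "\<And>\<tau> t. 0 < \<tau> \<Longrightarrow> \<tau> < \<tau>0 \<Longrightarrow> a \<le> t \<Longrightarrow> t \<le> a + h \<Longrightarrow> sampled m \<alpha> \<beta> p q \<omega> h c e a \<tau> t"
    using smooth_sol_sampling[OF sol \<omega>(1) h ce t(1)] by blast
  define \<tau> where "\<tau> = \<tau>0 / 2"
  have tau: "0 < \<tau>" "\<tau> < \<tau>0" using \<tau>0 by (auto simp: \<tau>_def)
  note S = samp[OF tau t(2,3), unfolded sampled_def]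
  have tau2: "\<tau> \<le> h / 10" using S by blast
  define n0 N A B where "n0 = nat \<lfloor>a / \<tau>\<rfloor>" and "N = nat \<lfloor>t / \<tau>\<rfloor> - nat \<lfloor>a / \<tau>\<rfloor>" and "A = \<lceil>(c - 2 * h) / \<tau>\<rceil> + 1" and "B = \<lfloor>(e + 2 * h) / \<tau>\<rfloor> - 2"
  note ci = cone_indices[OF tau(1) tau2 t ce h(2), folded n0_def N_def A_def B_def len_def]
  define P Q where "P n j = grid p \<tau> n0 n j" and "Q n j = grid q \<tau> n0 n j" for n j
  define M where "M n = \<tau> * (\<Sum>j\<in>{A + int n..B - int n}. (cmod (P n j))\<^sup>2 + (cmod (Q n j))\<^sup>2)" for n
  have M0: "0 \<le> M n" for n using tau by (auto simp: M_def intro!: mult_nonneg_nonneg sum_nonneg)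
  have sch: "approx_scheme m \<alpha> \<beta> \<omega> \<tau> N A B P Q"
    using S unfolding P_def[abs_def] Q_def[abs_def] Let_def n0_def N_def A_def B_def by blast
  have cl: "cmod (p x s - p (real_of_int j * \<tau>) (real (nat \<lfloor>s / \<tau>\<rfloor>) * \<tau>)) \<le> \<omega> \<and>
         cmod (q x s - q (real_of_int j * \<tau>) (real (nat \<lfloor>s / \<tau>\<rfloor>) * \<tau>)) \<le> \<omega>"
    if "s \<in> {a..a+h}" "j \<in> {A..B}" "\<bar>x - real_of_int j * \<tau>\<bar> \<le> 2 * \<tau>" for s j x
    using S that unfolding Let_def A_def B_def by blast
  have "energy {c..e} (\<lambda>x. 0 - p x t) (\<lambda>x. 0 - q x t)
    \<le> ennreal (2 * (\<tau> * (\<Sum>j\<in>{A + int N..B - int N}. (cmod (0 - P N j))\<^sup>2 + (cmod (0 - Q N j))\<^sup>2)) + 4 * (\<omega>\<^sup>2 * (\<tau> * real (card {A + int N..B - int N}))))"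
    by (rule energy_cells_upper[OF tau(1), where \<theta> = 0])
      (use tau ci(11) cl[of t] t in \<open>auto simp: P_def Q_def ci(1)\<close>)
  then have "charge {c..e} p q t \<le> ennreal (2 * M N + 4 * (\<omega>\<^sup>2 * (\<tau> * real (card {A + int N..B - int N}))))"
    unfolding energy_uminus by (simp add: M_def)
  also have "\<dots> \<le> ennreal (2 * M N + 4 * (\<omega>\<^sup>2 * len))"
    using ci(6) by (intro ennreal_leI add_mono mult_left_mono) auto
  finally have 1: "charge {c..e} p q t \<le> ennreal (2 * M N + 4 * (\<omega>\<^sup>2 * len))" .
  have c5: "\<omega>\<^sup>2 * (\<tau> * real (card {A..B})) \<le> \<omega>\<^sup>2 * len" using ci(5) by (intro mult_left_mono) auto
  have "M N \<le> 3 * (M 0 + \<omega>\<^sup>2 * (\<tau> * real (card {A..B})))" using approx_scheme_charge[OF sch less_imp_le[OF tau(1)] ci(2) order.refl] by (simp add: M_def)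
  then have MN: "M N \<le> 3 * (M 0 + \<omega>\<^sup>2 * len)" using c5 by argo
  obtain r where r: "0 \<le> r" "charge {c - 2 * h..e + 2 * h} p q a = ennreal r"
    using fin by (cases "charge {c - 2 * h..e + 2 * h} p q a") (auto simp: ennreal_mult_top)
  have "ennreal (\<tau> * (\<Sum>j=A..B. (cmod (0 - P 0 j))\<^sup>2 + (cmod (0 - Q 0 j))\<^sup>2))
       \<le> 2 * energy {c - 2 * h..e + 2 * h} (\<lambda>x. 0 - p x a) (\<lambda>x. 0 - q x a) + ennreal (4 * (\<omega>\<^sup>2 * (\<tau> * real (card {A..B}))))"
    by (rule energy_cells_lower[OF tau(1), where \<theta> = 0])
      (use tau ci(10) cl[of a] t h smooth_sol_measurable[OF sol] in \<open>auto simp: P_def Q_def n0_def\<close>)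
  also have "\<dots> = ennreal (2 * r + 4 * (\<omega>\<^sup>2 * (\<tau> * real (card {A..B}))))"
    unfolding energy_uminus r(2) using r(1) tau by (subst ennreal_plus) (auto simp: ennreal_mult)
  finally have "M 0 \<le> 2 * r + 4 * (\<omega>\<^sup>2 * (\<tau> * real (card {A..B})))"
    using r(1) tau by (subst (asm) ennreal_le_iff) (auto simp: M_def)
  then have "M 0 \<le> 2 * r + 4 * (\<omega>\<^sup>2 * len)" using c5 by argo
  then have "2 * M N + 4 * (\<omega>\<^sup>2 * len) \<le> 12 * r + \<omega>\<^sup>2 * (34 * len)" using MN by (simp add: algebra_simps)
  then have "ennreal (2 * M N + 4 * (\<omega>\<^sup>2 * len)) \<le> ennreal (12 * r + \<eta>)" unfolding \<omega>(2) by (rule ennreal_leI)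
  also have "\<dots> = 12 * charge {c - 2 * h..e + 2 * h} p q a + ennreal \<eta>"
    unfolding r(2) using r(1) \<eta> by (subst ennreal_plus) (auto simp: ennreal_mult)
  finally show "charge {c..e} p q t \<le> 12 * charge {c - 2 * h..e + 2 * h} p q a + ennreal \<eta>"
    using 1 by (meson order.trans)
qed

text \<open>The threshold \<open>\<tau>0\<close> depends on the smooth solution, the cone and
  \<eta>, but it is chosen before the scheme and serves all schemes with smaller mesh. The quantity
  \<open>e - c + 4 * h\<close> is the length of the base of the cone.\<close>

definition locally_stable :: "real \<Rightarrow> real \<Rightarrow> real \<Rightarrow> real \<Rightarrow> real \<Rightarrow> bool" where
  "locally_stable m \<alpha> \<beta> \<delta> K \<longleftrightarrow>
    (\<forall>p q h c e a \<eta>. smooth_sol m \<alpha> \<beta> p q \<longrightarrow> 0 < h \<longrightarrow> c \<le> e \<longrightarrow> e - c + 4 * h \<le> 1 / 2 \<longrightarrow> 0 \<le> a \<longrightarrow> 0 < \<eta> \<longrightarrow>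
    (\<exists>\<tau>0>0. \<forall>\<tau> U V a0 b0. 0 < \<tau> \<longrightarrow> \<tau> < \<tau>0 \<longrightarrow> ts_sol m \<alpha> \<beta> \<tau> a0 b0 U V \<longrightarrow>
      charge {c - 2 * h..e + 2 * h} U V a \<le> ennreal \<delta> \<longrightarrow>
      charge {c - 2 * h..e + 2 * h} p q a \<le> ennreal \<delta> \<longrightarrow>
      (\<forall>t\<in>{a..a+h}. gap {c..e} U V p q t
         \<le> ennreal K * gap {c - 2 * h..e + 2 * h} U V p q a + ennreal \<eta>)))"

lemma local_stability: "\<exists>\<delta>>0. \<exists>K>0. locally_stable m \<alpha> \<beta> \<delta> K"
proof -
  obtain \<delta>' K' where \<delta>': "0 < \<delta>'" and K': "0 < K'" and stable: "scheme_stable m \<alpha> \<beta> \<delta>' K'"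
    using approx_scheme_stability by blast
  note stab = stable[unfolded scheme_stable_def, rule_format]
  \<comment> \<open>A charge of \<delta>' / 8 becomes at most \<delta>' / 4 on the lattice, up to
    sampling; for two solutions this leaves \<delta>' / 2 for the errors of size \<omega>. The
    factor 4 in front of K' is 2 * 2, once for each passage between integrals and sums.\<close>
  show ?thesis unfolding locally_stable_def
  proof (rule exI[of _ "\<delta>' / 8"], rule conjI, use \<delta>' in simp, rule exI[of _ "4 * K'"], rule conjI, use K' in simp, intro allI impI)
    fix p q and h c e a \<eta> :: real
    assume sol: "smooth_sol m \<alpha> \<beta> p q" and h: "0 < h" and ce: "c \<le> e" and len: "e - c + 4 * h \<le> 1 / 2" and a: "0 \<le> a" and \<eta>: "0 < \<eta>"
    have h2: "h \<le> 1 / 2" using len ce h by linarith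
    \<comment> \<open>Three demands: the forcing is at most 1; the accumulated error, (6 K' + 2)
      times the square of \<omega>, is at most \<eta>; and three times that square fits into
      \<delta>' / 2.\<close>
    define \<omega> where "\<omega> = sqrt (min 1 (min (\<eta> / (6 * K' + 2)) (\<delta>' / 6)))"
    have \<omega>2: "\<omega>\<^sup>2 = min 1 (min (\<eta> / (6 * K' + 2)) (\<delta>' / 6))" using \<eta> K' \<delta>' by (simp add: \<omega>_def)
    have \<omega>: "0 < \<omega>" "\<omega> \<le> 1" using \<eta> K' \<delta>' by (auto simp: \<omega>_def)
    have "\<omega>\<^sup>2 \<le> \<eta> / (6 * K' + 2)" unfolding \<omega>2 by simp
    then have \<omega>\<eta>: "(6 * K' + 2) * \<omega>\<^sup>2 \<le> \<eta>" using K' by (simp add: field_simps)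
    have \<omega>\<delta>: "\<omega>\<^sup>2 \<le> \<delta>' / 6" unfolding \<omega>2 by linarith
    obtain \<tau>0 where \<tau>0: "0 < \<tau>0" and samp: "\<And>\<tau> t. 0 < \<tau> \<Longrightarrow> \<tau> < \<tau>0 \<Longrightarrow> a \<le> t \<Longrightarrow> t \<le> a + h \<Longrightarrow> sampled m \<alpha> \<beta> p q \<omega> h c e a \<tau> t"
      using smooth_sol_sampling[OF sol \<omega>(1) h h2 ce a] by blast
    show "\<exists>\<tau>0>0. \<forall>\<tau> U V a0 b0. 0 < \<tau> \<longrightarrow> \<tau> < \<tau>0 \<longrightarrow> ts_sol m \<alpha> \<beta> \<tau> a0 b0 U V \<longrightarrow>
      charge {c - 2 * h..e + 2 * h} U V a \<le> ennreal (\<delta>' / 8) \<longrightarrow>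
      charge {c - 2 * h..e + 2 * h} p q a \<le> ennreal (\<delta>' / 8) \<longrightarrow>
      (\<forall>t\<in>{a..a+h}. gap {c..e} U V p q t
         \<le> ennreal (4 * K') * gap {c - 2 * h..e + 2 * h} U V p q a + ennreal \<eta>)"
    proof (rule exI[of _ \<tau>0], rule conjI, rule \<tau>0, intro allI impI ballI)
      fix \<tau> U V a0 b0 t
      assume tau: "0 < \<tau>" "\<tau> < \<tau>0" and ts: "ts_sol m \<alpha> \<beta> \<tau> a0 b0 U V" and t': "t \<in> {a..a+h}"
        and mU: "charge {c - 2 * h..e + 2 * h} U V a \<le> ennreal (\<delta>' / 8)"
        and mp: "charge {c - 2 * h..e + 2 * h} p q a \<le> ennreal (\<delta>' / 8)"
      have t: "a \<le> t" "t \<le> a + h" and t0: "0 \<le> t" using t' a by auto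
      note S = samp[OF tau t, unfolded sampled_def]
      have tau2: "\<tau> \<le> h / 10" using S by blast
      let ?base = "{c - 2 * h..e + 2 * h}"
      define n0 N A B where "n0 = nat \<lfloor>a / \<tau>\<rfloor>" and "N = nat \<lfloor>t / \<tau>\<rfloor> - nat \<lfloor>a / \<tau>\<rfloor>" and "A = \<lceil>(c - 2 * h) / \<tau>\<rceil> + 1" and "B = \<lfloor>(e + 2 * h) / \<tau>\<rfloor> - 2"
      note ci = cone_indices[OF tau(1) tau2 a t ce h2, folded n0_def N_def A_def B_def]
      note bt = ts_sol_between[OF ts tau(1) t0] and ba = ts_sol_between[OF ts tau(1) a, folded n0_def]
      define P Q where "P n j = grid p \<tau> n0 n j" and "Q n j = grid q \<tau> n0 n j" for n j
      define F G where "F n j = grid U \<tau> n0 n j" and "G n j = grid V \<tau> n0 n j" for n j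
      define L where "L n = \<tau> * (\<Sum>j\<in>{A + int n..B - int n}. (cmod (F n j - P n j))\<^sup>2 + (cmod (G n j - Q n j))\<^sup>2)" for n
      have schP: "approx_scheme m \<alpha> \<beta> \<omega> \<tau> N A B P Q"
        using S unfolding P_def[abs_def] Q_def[abs_def] Let_def n0_def N_def A_def B_def by blast
      have "approx_scheme m \<alpha> \<beta> 0 \<tau> N A B F G"
        unfolding F_def[abs_def] G_def[abs_def] by (rule ts_sol_approx_scheme[OF ts])
      then have schF: "approx_scheme m \<alpha> \<beta> \<omega> \<tau> N A B F G" using \<omega> by (auto elim: approx_scheme_mono)
      have cl: "cmod (p x s - p (real_of_int j * \<tau>) (real (nat \<lfloor>s / \<tau>\<rfloor>) * \<tau>)) \<le> \<omega> \<and>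
             cmod (q x s - q (real_of_int j * \<tau>) (real (nat \<lfloor>s / \<tau>\<rfloor>) * \<tau>)) \<le> \<omega>"
        if "s \<in> {a..a+h}" "j \<in> {A..B}" "\<bar>x - real_of_int j * \<tau>\<bar> \<le> 2 * \<tau>" for s j x
        using S that unfolding Let_def A_def B_def by blast
      have card1: "\<omega>\<^sup>2 * (\<tau> * real (card {A..B})) \<le> \<omega>\<^sup>2 * (1/2)" using ci(5) len by (intro mult_left_mono) auto
      have card2: "\<omega>\<^sup>2 * (\<tau> * real (card {A + int N..B - int N})) \<le> \<omega>\<^sup>2 * (1/2)" using ci(6) len by (intro mult_left_mono) auto
      have massF: "\<tau> * (\<Sum>j=A..B. (cmod (F 0 j))\<^sup>2 + (cmod (G 0 j))\<^sup>2) \<le> \<delta>' / 4"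
      proof -
        have "ennreal (\<tau> * (\<Sum>j=A..B. (cmod (F 0 j - 0))\<^sup>2 + (cmod (G 0 j - 0))\<^sup>2))
           \<le> 2 * energy ?base (\<lambda>x. U x a - 0) (\<lambda>x. V x a - 0) + ennreal (4 * (0\<^sup>2 * (\<tau> * real (card {A..B}))))"
          by (rule energy_cells_lower[OF tau(1), where \<theta> = "a - real n0 * \<tau>"]) (use ba ci(10) in \<open>auto simp: F_def G_def\<close>)
        also have "\<dots> \<le> 2 * ennreal (\<delta>' / 8)" using mU by (simp add: mult_left_mono)
        also have "\<dots> = ennreal (\<delta>' / 4)" using \<delta>' ennreal_mult[of 2 "\<delta>' / 8"] by simp
        finally show ?thesis using \<delta>' by (subst (asm) ennreal_le_iff) auto
      qed
      have massP: "\<tau> * (\<Sum>j=A..B. (cmod (P 0 j))\<^sup>2 + (cmod (Q 0 j))\<^sup>2) \<le> \<delta>' / 4 + 2 * \<omega>\<^sup>2"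
      proof -
        have "ennreal (\<tau> * (\<Sum>j=A..B. (cmod (0 - P 0 j))\<^sup>2 + (cmod (0 - Q 0 j))\<^sup>2))
           \<le> 2 * energy ?base (\<lambda>x. 0 - p x a) (\<lambda>x. 0 - q x a) + ennreal (4 * (\<omega>\<^sup>2 * (\<tau> * real (card {A..B}))))"
          by (rule energy_cells_lower[OF tau(1), where \<theta> = 0])
            (use tau ci(10) cl[of a] a h smooth_sol_measurable[OF sol] in \<open>auto simp: P_def Q_def n0_def\<close>)
        also have "\<dots> \<le> 2 * ennreal (\<delta>' / 8) + ennreal (4 * (\<omega>\<^sup>2 * (1/2)))"
          unfolding energy_uminus using card1 by (intro add_mono mult_left_mono[OF mp] ennreal_leI mult_left_mono[OF card1]) auto
        also have "\<dots> = ennreal (\<delta>' / 4 + 2 * \<omega>\<^sup>2)" using \<delta>' ennreal_mult[of 2 "\<delta>' / 8"] by (simp add: ennreal_plus)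
        finally show ?thesis using \<delta>' by (subst (asm) ennreal_le_iff) auto
      qed
      have LN: "L N \<le> K' * (L 0 + \<omega>\<^sup>2)"
        unfolding L_def using stab[OF schF schP tau(1) less_imp_le[OF \<omega>(1)] \<omega>(2) ci(2) _ _ ci(3) _ order.refl] ci(4) len massF massP \<omega>\<delta> tau2 h2 by simp
      have "gap {c..e} U V p q t
          \<le> ennreal (2 * L N + 4 * (\<omega>\<^sup>2 * (\<tau> * real (card {A + int N..B - int N}))))"
        unfolding L_def by (rule energy_cells_upper[OF tau(1), where \<theta> = "t - real (nat \<lfloor>t / \<tau>\<rfloor>) * \<tau>"])
          (use bt ci(11) cl[of t] t' in \<open>auto simp: P_def Q_def F_def G_def ci(1)\<close>)
      also have "\<dots> \<le> ennreal (2 * (K' * (L 0 + \<omega>\<^sup>2)) + 2 * \<omega>\<^sup>2)"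
        using LN card2 by (intro ennreal_leI) argo
      finally have up: "gap {c..e} U V p q t \<le> ennreal (2 * (K' * (L 0 + \<omega>\<^sup>2)) + 2 * \<omega>\<^sup>2)" .
      have lo: "ennreal (L 0) \<le> 2 * gap ?base U V p q a + ennreal (4 * (\<omega>\<^sup>2 * (\<tau> * real (card {A..B}))))"
        unfolding L_def of_nat_0 add_0_right diff_0_right by (rule energy_cells_lower[OF tau(1), where \<theta> = "a - real n0 * \<tau>"])
          (use ba ci(10) cl[of a] h smooth_sol_measurable[OF sol] in \<open>auto simp: P_def Q_def F_def G_def n0_def\<close>)
      show "gap {c..e} U V p q t
         \<le> ennreal (4 * K') * gap ?base U V p q a + ennreal \<eta>"
      proof (cases "gap ?base U V p q a")
        case (real r)
        have "ennreal (L 0) \<le> ennreal (2 * r + 4 * (\<omega>\<^sup>2 * (\<tau> * real (card {A..B}))))"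
          using lo real tau by (simp add: ennreal_plus ennreal_mult)
        then have "L 0 \<le> 2 * r + 4 * (\<omega>\<^sup>2 * (\<tau> * real (card {A..B})))" using real tau by (subst (asm) ennreal_le_iff) auto
        then have "L 0 + \<omega>\<^sup>2 \<le> 2 * r + 3 * \<omega>\<^sup>2" using card1 by argo
        then have "K' * (L 0 + \<omega>\<^sup>2) \<le> K' * (2 * r + 3 * \<omega>\<^sup>2)" using K' by (intro mult_left_mono) auto
        then have "2 * (K' * (L 0 + \<omega>\<^sup>2)) + 2 * \<omega>\<^sup>2 \<le> 4 * K' * r + \<eta>" using \<omega>\<eta> by (simp add: algebra_simps)
        then have "ennreal (2 * (K' * (L 0 + \<omega>\<^sup>2)) + 2 * \<omega>\<^sup>2) \<le> ennreal (4 * K' * r + \<eta>)" by (rule ennreal_leI)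
        also have "\<dots> = ennreal (4 * K') * ennreal r + ennreal \<eta>" using K' real \<eta> by (simp add: ennreal_plus ennreal_mult)
        finally show ?thesis unfolding real(2)[symmetric] by (rule order.trans[OF up])
      next
        case top
        then show ?thesis using K' by (simp add: ennreal_mult_eq_top_iff top_unique ennreal_mult_top)
      qed
    qed
  qed
qed

subsection \<open>Energy on subsets of the line\<close>

lemma energy_add_le:
  assumes [measurable]: "f \<in> borel_measurable borel" "g \<in> borel_measurable borel" "p \<in> borel_measurable borel" "q \<in> borel_measurable borel" "S \<in> sets borel"
  shows "energy S (\<lambda>x. f x + p x) (\<lambda>x. g x + q x) \<le> 2 * energy S f g + 2 * energy S p q"
proof -
  have *: "sq_int S (\<lambda>x. f x + p x) \<le> 2 * sq_int S f + 2 * sq_int S p"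
    if [measurable]: "f \<in> borel_measurable borel" "p \<in> borel_measurable borel" for f p
  proof -
    have "sq_int S (\<lambda>x. f x + p x) \<le> (\<integral>\<^sup>+x. 2 * (ennreal ((cmod (f x))\<^sup>2) * indicator S x) + 2 * (ennreal ((cmod (p x))\<^sup>2) * indicator S x) \<partial>lborel)"
      unfolding sq_int_def
    proof (rule nn_integral_mono)
      fix x
      have "ennreal ((cmod (f x + p x))\<^sup>2) \<le> ennreal (2 * (cmod (f x))\<^sup>2 + 2 * (cmod (p x))\<^sup>2)"
        by (intro ennreal_leI cmod_add_square_le)
      also have "\<dots> = 2 * ennreal ((cmod (f x))\<^sup>2) + 2 * ennreal ((cmod (p x))\<^sup>2)"
        by (simp add: ennreal_plus ennreal_mult)
      finally show "ennreal ((cmod (f x + p x))\<^sup>2) * indicator S x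
          \<le> 2 * (ennreal ((cmod (f x))\<^sup>2) * indicator S x) + 2 * (ennreal ((cmod (p x))\<^sup>2) * indicator S x)"
        by (cases "x \<in> S") auto
    qed
    also have "\<dots> = 2 * sq_int S f + 2 * sq_int S p"
      unfolding sq_int_def by (subst nn_integral_add) (auto simp: nn_integral_cmult)
    finally show ?thesis .
  qed
  have "energy S (\<lambda>x. f x + p x) (\<lambda>x. g x + q x) \<le> (2 * sq_int S f + 2 * sq_int S p) + (2 * sq_int S g + 2 * sq_int S q)"
    unfolding energy_def by (intro add_mono *) auto
  then show ?thesis by (simp add: energy_def distrib_left ac_simps)
qed

lemma energy_triangle:
  assumes "f \<in> borel_measurable borel" "g \<in> borel_measurable borel" "p \<in> borel_measurable borel" "q \<in> borel_measurable borel"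
    "u \<in> borel_measurable borel" "v \<in> borel_measurable borel" "S \<in> sets borel"
  shows "energy S (\<lambda>x. f x - u x) (\<lambda>x. g x - v x)
    \<le> 2 * energy S (\<lambda>x. f x - p x) (\<lambda>x. g x - q x) + 2 * energy S (\<lambda>x. p x - u x) (\<lambda>x. q x - v x)"
  using energy_add_le[of "\<lambda>x. f x - p x" "\<lambda>x. g x - q x" "\<lambda>x. p x - u x" "\<lambda>x. q x - v x" S] assms by simp

lemma energy_commute: "energy S (\<lambda>x. f x - u x) (\<lambda>x. g x - v x) = energy S (\<lambda>x. u x - f x) (\<lambda>x. v x - g x)"
  by (simp add: energy_def sq_int_def norm_minus_commute)

lemma energy_Un_le:
  assumes [measurable]: "f \<in> borel_measurable borel" "g \<in> borel_measurable borel" "S \<in> sets borel" "T \<in> sets borel"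
  shows "energy (S \<union> T) f g \<le> energy S f g + energy T f g"
proof -
  have *: "sq_int (S \<union> T) f \<le> sq_int S f + sq_int T f" if [measurable]: "f \<in> borel_measurable borel" for f
  proof -
    have "sq_int (S \<union> T) f \<le> (\<integral>\<^sup>+x. ennreal ((cmod (f x))\<^sup>2) * indicator S x + ennreal ((cmod (f x))\<^sup>2) * indicator T x \<partial>lborel)"
      unfolding sq_int_def by (intro nn_integral_mono) (auto simp: indicator_def)
    also have "\<dots> = sq_int S f + sq_int T f"
      unfolding sq_int_def by (subst nn_integral_add) auto
    finally show ?thesis .
  qed
  have "energy (S \<union> T) f g \<le> (sq_int S f + sq_int T f) + (sq_int S g + sq_int T g)"
    unfolding energy_def by (intro add_mono *) auto
  then show ?thesis by (simp add: energy_def ac_simps)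
qed

lemma energy_UN_le:
  assumes [measurable]: "f \<in> borel_measurable borel" "g \<in> borel_measurable borel" and fin: "finite I" and S: "\<And>i. i \<in> I \<Longrightarrow> S i \<in> sets borel"
  shows "energy (\<Union>i\<in>I. S i) f g \<le> (\<Sum>i\<in>I. energy (S i) f g)"
  using fin S
proof (induction I rule: finite_induct)
  case empty
  show ?case by (simp add: energy_def sq_int_def)
next
  case (insert i I)
  have "energy (\<Union>i\<in>insert i I. S i) f g = energy (S i \<union> (\<Union>i\<in>I. S i)) f g" by simp
  also have "\<dots> \<le> energy (S i) f g + energy (\<Union>i\<in>I. S i) f g"
    using insert by (intro energy_Un_le) auto
  also have "\<dots> \<le> energy (S i) f g + (\<Sum>i\<in>I. energy (S i) f g)"
    using insert by (intro add_mono) auto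
  finally show ?case using insert by simp
qed

lemma energy_eq_emeasure:
  assumes [measurable]: "f \<in> borel_measurable borel" "g \<in> borel_measurable borel" "S \<in> sets borel"
  shows "energy S f g = emeasure (density lborel (\<lambda>x. ennreal ((cmod (f x))\<^sup>2 + (cmod (g x))\<^sup>2))) S"
proof -
  have "emeasure (density lborel (\<lambda>x. ennreal ((cmod (f x))\<^sup>2 + (cmod (g x))\<^sup>2))) S
     = (\<integral>\<^sup>+x. ennreal ((cmod (f x))\<^sup>2) * indicator S x + ennreal ((cmod (g x))\<^sup>2) * indicator S x \<partial>lborel)"
    by (subst emeasure_density) (auto simp: ennreal_plus distrib_right)
  also have "\<dots> = energy S f g" unfolding energy_def sq_int_def by (subst nn_integral_add) auto
  finally show ?thesis by simp
qed

text \<open>By monotone convergence along growing intervals. It reduces estimates on the line to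
  bounded intervals, where cones and compactness are at hand.\<close>

lemma energy_UNIV_le:
  assumes meas[measurable]: "f \<in> borel_measurable borel" "g \<in> borel_measurable borel"
    and le: "\<And>Y. 0 \<le> Y \<Longrightarrow> energy {-Y..Y} f g \<le> c"
  shows "energy UNIV f g \<le> c"
proof -
  let ?M = "density lborel (\<lambda>x. ennreal ((cmod (f x))\<^sup>2 + (cmod (g x))\<^sup>2))"
  have "(SUP n. emeasure ?M {- real n..real n}) = emeasure ?M (\<Union>n. {- real n..real n})"
    by (rule SUP_emeasure_incseq) (auto simp: incseq_def)
  moreover have "(\<Union>n. {- real n..real n}) = UNIV"
  proof (intro set_eqI iffI)
    fix x :: real
    obtain n where "\<bar>x\<bar> \<le> real n" using real_arch_simple by blast
    then show "x \<in> (\<Union>n. {- real n..real n})" by (auto simp: abs_le_iff intro!: exI[of _ n])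
  qed simp
  ultimately have "energy UNIV f g = (SUP n. energy {- real n..real n} f g)"
    by (simp add: energy_eq_emeasure)
  also have "\<dots> \<le> c" by (intro SUP_least le) auto
  finally show ?thesis .
qed

lemma energy_tail:
  assumes meas[measurable]: "f \<in> borel_measurable borel" "g \<in> borel_measurable borel"
    and fin: "energy UNIV f g < top" and \<epsilon>: "0 < \<epsilon>"
  shows "\<exists>R\<ge>0. energy (- {-R..R}) f g \<le> ennreal \<epsilon>"
proof -
  let ?M = "density lborel (\<lambda>x. ennreal ((cmod (f x))\<^sup>2 + (cmod (g x))\<^sup>2))"
  have "(\<lambda>n. emeasure ?M (- {- real n..real n})) \<longlonglongrightarrow> emeasure ?M (\<Inter>n. - {- real n..real n})"
  proof (rule Lim_emeasure_decseq)
    show "emeasure ?M (- {- real i..real i}) \<noteq> \<infinity>" for i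
    proof -
      have "energy (- {- real i..real i}) f g = emeasure ?M (- {- real i..real i})" by (intro energy_eq_emeasure) auto
      moreover have "energy (- {- real i..real i}) f g < top" by (rule le_less_trans[OF energy_mono fin]) simp
      ultimately show ?thesis by (simp only: infinity_ennreal_def less_top)
    qed
  qed (auto simp: decseq_def)
  moreover have "(\<Inter>n. - {- real n..real n}) = {}"
  proof -
    have "\<exists>n. x \<in> {- real n..real n}" for x :: real
    proof -
      obtain n where "\<bar>x\<bar> \<le> real n" using real_arch_simple by blast
      then show ?thesis by (auto simp: abs_le_iff intro!: exI[of _ n])
    qed
    then show ?thesis by blast
  qed
  ultimately have "(\<lambda>n. energy (- {- real n..real n}) f g) \<longlonglongrightarrow> 0" by (simp add: energy_eq_emeasure)
  then have "\<forall>\<^sub>F n in sequentially. energy (- {- real n..real n}) f g < ennreal \<epsilon>"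
    using \<epsilon> by (intro order_tendstoD(2)) auto
  then obtain n where "energy (- {- real n..real n}) f g < ennreal \<epsilon>" by (auto simp: eventually_sequentially)
  then show ?thesis by (intro exI[of _ "real n"]) auto
qed

text \<open>Uniformity in \<open>c\<close> comes from truncating the density: the set where it
  exceeds n carries little energy for large n, wherever the interval lies, and the remainder
  contributes at most n times the length.\<close>

lemma energy_equi_integrable:
  assumes meas[measurable]: "f \<in> borel_measurable borel" "g \<in> borel_measurable borel"
    and fin: "energy UNIV f g < top" and \<epsilon>: "0 < \<epsilon>"
  shows "\<exists>\<eta>>0. \<forall>c. energy {c..c+\<eta>} f g \<le> ennreal \<epsilon>"
proof -
  define \<rho> where "\<rho> x = (cmod (f x))\<^sup>2 + (cmod (g x))\<^sup>2" for x
  have [measurable]: "\<rho> \<in> borel_measurable borel" unfolding \<rho>_def by measurable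
  define S where "S n = {x. real n < \<rho> x}" for n
  have S[measurable]: "S n \<in> sets borel" for n unfolding S_def by measurable
  let ?M = "density lborel (\<lambda>x. ennreal (\<rho> x))"
  have en: "energy T f g = emeasure ?M T" if "T \<in> sets borel" for T unfolding \<rho>_def using that by (rule energy_eq_emeasure[OF meas])
  have "(\<lambda>n. emeasure ?M (S n)) \<longlonglongrightarrow> emeasure ?M (\<Inter>n. S n)"
  proof (rule Lim_emeasure_decseq)
    show "emeasure ?M (S i) \<noteq> \<infinity>" for i
      using fin energy_mono[of "S i" UNIV f g] by (auto simp: en[symmetric] top_unique)
    show "decseq S" by (auto simp: decseq_def S_def)
  qed auto
  moreover have "(\<Inter>n. S n) = {}"
  proof -
    have "\<exists>n. x \<notin> S n" for x using real_arch_simple[of "\<rho> x"] by (auto simp: S_def not_less)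
    then show ?thesis by blast
  qed
  ultimately have "(\<lambda>n. emeasure ?M (S n)) \<longlonglongrightarrow> 0" by simp
  then have "\<forall>\<^sub>F n in sequentially. emeasure ?M (S n) < ennreal (\<epsilon> / 2)"
    using \<epsilon> by (intro order_tendstoD(2)) auto
  then obtain n where n: "emeasure ?M (S n) < ennreal (\<epsilon> / 2)" by (auto simp: eventually_sequentially)
  define \<eta> where "\<eta> = \<epsilon> / (2 * (real n + 1))"
  have \<eta>: "0 < \<eta>" using \<epsilon> by (simp add: \<eta>_def)
  have "energy {c..c+\<eta>} f g \<le> ennreal \<epsilon>" for c
  proof -
    have "emeasure ?M ({c..c+\<eta>} - S n) = (\<integral>\<^sup>+x. ennreal (\<rho> x) * indicator ({c..c+\<eta>} - S n) x \<partial>lborel)"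
      by (subst emeasure_density) auto
    also have "\<dots> \<le> (\<integral>\<^sup>+x. ennreal (real n) * indicator {c..c+\<eta>} x \<partial>lborel)"
      by (intro nn_integral_mono) (auto simp: indicator_def S_def not_less intro!: ennreal_leI)
    also have "\<dots> = ennreal (real n * \<eta>)" using \<eta> by (subst nn_integral_cmult_indicator) (auto simp: ennreal_mult)
    also have "\<dots> \<le> ennreal (\<epsilon> / 2)" using \<epsilon> by (intro ennreal_leI) (simp add: \<eta>_def field_simps)
    finally have 1: "emeasure ?M ({c..c+\<eta>} - S n) \<le> ennreal (\<epsilon> / 2)" .
    have "energy {c..c+\<eta>} f g = emeasure ?M {c..c+\<eta>}" by (rule en) simp
    also have "\<dots> \<le> emeasure ?M (({c..c+\<eta>} - S n) \<union> S n)" by (intro emeasure_mono) auto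
    also have "\<dots> \<le> emeasure ?M ({c..c+\<eta>} - S n) + emeasure ?M (S n)" by (intro emeasure_subadditive) auto
    also have "\<dots> \<le> ennreal (\<epsilon> / 2) + ennreal (\<epsilon> / 2)" using n by (intro add_mono 1) auto
    also have "\<dots> = ennreal \<epsilon>" using \<epsilon> by (subst ennreal_plus[symmetric]) auto
    finally show ?thesis .
  qed
  then show ?thesis using \<eta> by blast
qed

lemma ts_sol_measurable:
  assumes "ts_sol m \<alpha> \<beta> \<tau> a0 b0 U V" "0 < \<tau>" "0 \<le> t"
  shows "(\<lambda>x. U x t) \<in> borel_measurable borel" "(\<lambda>x. V x t) \<in> borel_measurable borel"
proof -
  note b = ts_sol_between[OF assms]
  define n where "n = nat \<lfloor>t / \<tau>\<rfloor>"
  define \<theta> where "\<theta> = t - real n * \<tau>"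
  have "U x t = (\<lambda>j. U (real_of_int j * \<tau>) (real n * \<tau>)) \<lfloor>(x - \<theta>) / \<tau>\<rfloor>"
    "V x t = (\<lambda>j. V (real_of_int j * \<tau>) (real n * \<tau>)) \<lfloor>(x - (- \<theta>)) / \<tau>\<rfloor>" for x
    using b(1,2)[of x] unfolding n_def[symmetric] \<theta>_def[symmetric] diff_minus_eq_add by auto
  then show "(\<lambda>x. U x t) \<in> borel_measurable borel" "(\<lambda>x. V x t) \<in> borel_measurable borel"
    using floor_measurable_real[of "\<lambda>j. U (real_of_int j * \<tau>) (real n * \<tau>)" \<theta> \<tau>]
      floor_measurable_real[of "\<lambda>j. V (real_of_int j * \<tau>) (real n * \<tau>)" "- \<theta>" \<tau>] by simp_all
qed

subsection \<open>Comparison of time-splitting and smooth solutions\<close>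

lemma energy_triangle_le:
  assumes "f \<in> borel_measurable borel" "g \<in> borel_measurable borel" "p \<in> borel_measurable borel" "q \<in> borel_measurable borel"
    "u \<in> borel_measurable borel" "v \<in> borel_measurable borel" "S \<in> sets borel"
    and le: "energy S (\<lambda>x. f x - p x) (\<lambda>x. g x - q x) \<le> ennreal X" "energy S (\<lambda>x. p x - u x) (\<lambda>x. q x - v x) \<le> ennreal Y"
    and nn: "0 \<le> X" "0 \<le> Y"
  shows "energy S (\<lambda>x. f x - u x) (\<lambda>x. g x - v x) \<le> ennreal (2 * X + 2 * Y)"
proof -
  have "energy S (\<lambda>x. f x - u x) (\<lambda>x. g x - v x)
    \<le> 2 * energy S (\<lambda>x. f x - p x) (\<lambda>x. g x - q x) + 2 * energy S (\<lambda>x. p x - u x) (\<lambda>x. q x - v x)"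
    using assms(1-7) by (rule energy_triangle)
  also have "\<dots> \<le> 2 * ennreal X + 2 * ennreal Y" using le by (intro add_mono mult_left_mono) auto
  also have "\<dots> = ennreal (2 * X + 2 * Y)" using nn by (simp add: ennreal_plus ennreal_mult)
  finally show ?thesis .
qed

lemma energy_triangle_0:
  assumes "f \<in> borel_measurable borel" "g \<in> borel_measurable borel" "p \<in> borel_measurable borel" "q \<in> borel_measurable borel" "S \<in> sets borel"
    and "energy S (\<lambda>x. f x - p x) (\<lambda>x. g x - q x) \<le> ennreal X" "energy S p q \<le> ennreal Y" "0 \<le> X" "0 \<le> Y"
  shows "energy S f g \<le> ennreal (2 * X + 2 * Y)"
  using energy_triangle_le[of f g p q "\<lambda>x. 0" "\<lambda>x. 0" S X Y] assms by simp

lemma energy_triangle_diff: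
  assumes "f \<in> borel_measurable borel" "g \<in> borel_measurable borel" "p \<in> borel_measurable borel" "q \<in> borel_measurable borel" "S \<in> sets borel"
    and "energy S f g \<le> ennreal X" "energy S p q \<le> ennreal Y" "0 \<le> X" "0 \<le> Y"
  shows "energy S (\<lambda>x. f x - p x) (\<lambda>x. g x - q x) \<le> ennreal (2 * X + 2 * Y)"
  using energy_triangle_le[of f g "\<lambda>x. 0" "\<lambda>x. 0" p q S X Y] assms energy_uminus[of S p q] by simp

lemma mult_ennreal_le:
  "0 \<le> c \<Longrightarrow> 0 \<le> X \<Longrightarrow> E \<le> ennreal X \<Longrightarrow> ennreal c * E \<le> ennreal (c * X)"
  using mult_left_mono[of E "ennreal X" "ennreal c"] by (simp add: ennreal_mult)

text \<open>The pair \<open>f\<close>, \<open>g\<close> stands for the state at time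
  \<open>a\<close>; it is the given initial data at first and the strong solution later. Its charge
  on intervals of length 5 h, the base of a cone over a tile of length h, controls the charges of
  both solutions because both are close to it. The condition \<open>10 * h \<le> 1\<close> says that
  such a base has length at most 1/2.\<close>

definition comparable :: "real \<Rightarrow> real \<Rightarrow> real \<Rightarrow> real \<Rightarrow> bool" where
  "comparable m \<alpha> \<beta> \<delta> \<longleftrightarrow>
    (\<forall>h a f g U V a0 b0 uk vk \<epsilon>. 0 < h \<longrightarrow> 10 * h \<le> 1 \<longrightarrow> 0 \<le> a \<longrightarrow>
     f \<in> borel_measurable borel \<longrightarrow> g \<in> borel_measurable borel \<longrightarrow> energy UNIV f g < top \<longrightarrow>
     (\<forall>c. energy {c..c + 5 * h} f g \<le> ennreal \<delta>) \<longrightarrow>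
     (\<forall>\<tau>>0. ts_sol m \<alpha> \<beta> \<tau> (a0 \<tau>) (b0 \<tau>) (U \<tau>) (V \<tau>)) \<longrightarrow> (\<forall>k::nat. smooth_sol m \<alpha> \<beta> (uk k) (vk k)) \<longrightarrow>
     (\<forall>\<epsilon>>0. \<forall>\<^sub>F \<tau> in at_right 0. energy UNIV (\<lambda>x. U \<tau> x a - f x) (\<lambda>x. V \<tau> x a - g x) \<le> ennreal \<epsilon>) \<longrightarrow>
     (\<forall>\<epsilon>>0. \<forall>\<^sub>F k in sequentially. energy UNIV (\<lambda>x. uk k x a - f x) (\<lambda>x. vk k x a - g x) \<le> ennreal \<epsilon>) \<longrightarrow>
     0 < \<epsilon> \<longrightarrow>
     (\<forall>\<^sub>F k in sequentially. \<forall>\<^sub>F \<tau> in at_right 0. \<forall>t\<in>{a..a+h}.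
        gap UNIV (U \<tau>) (V \<tau>) (uk k) (vk k) t \<le> ennreal \<epsilon>))"

text \<open>Local stability can be summed over finitely many tiles only: its mesh threshold depends
  on the tile, and the errors \<eta> add up. Beyond a large interval the reference pair has little
  charge, which spreads no faster than the cones, so both solutions are small there and their
  difference is too.\<close>

lemma global_comparison: "\<exists>\<delta>>0. comparable m \<alpha> \<beta> \<delta>"
proof -
  obtain \<delta> K where \<delta>: "0 < \<delta>" and K: "0 < K" and stable: "locally_stable m \<alpha> \<beta> \<delta> K"
    using local_stability by blast
  show ?thesis unfolding comparable_def
  proof (rule exI[of _ "\<delta> / 4"], rule conjI, use \<delta> in simp, intro allI impI)
    fix h a :: real and f g U V a0 b0 uk vk and \<epsilon> :: real
    assume h: "0 < h" "10 * h \<le> 1" and a: "0 \<le> a" and meas[measurable]: "f \<in> borel_measurable borel" "g \<in> borel_measurable borel"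
      and fin: "energy UNIV f g < top" and equi: "\<forall>c. energy {c..c + 5 * h} f g \<le> ennreal (\<delta> / 4)"
      and ts: "\<forall>\<tau>>0. ts_sol m \<alpha> \<beta> \<tau> (a0 \<tau>) (b0 \<tau>) (U \<tau>) (V \<tau>)" and sol: "\<forall>k::nat. smooth_sol m \<alpha> \<beta> (uk k) (vk k)"
      and convU: "\<forall>\<epsilon>>0. \<forall>\<^sub>F \<tau> in at_right 0. energy UNIV (\<lambda>x. U \<tau> x a - f x) (\<lambda>x. V \<tau> x a - g x) \<le> ennreal \<epsilon>"
      and convu: "\<forall>\<epsilon>>0. \<forall>\<^sub>F k in sequentially. energy UNIV (\<lambda>x. uk k x a - f x) (\<lambda>x. vk k x a - g x) \<le> ennreal \<epsilon>"
      and \<epsilon>: "0 < \<epsilon>"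
    \<comment> \<open>The total will be 386 \<epsilon>1: the tiles give 2, each of the two tails 192
      = 4 * 48, where 48 is the factor 12 of the charge estimates times 4.\<close>
    define \<epsilon>1 where "\<epsilon>1 = \<epsilon> / 400"
    have \<epsilon>1: "0 < \<epsilon>1" using \<epsilon> by (simp add: \<epsilon>1_def)
    obtain R where R: "0 \<le> R" "energy (- {-R..R}) f g \<le> ennreal \<epsilon>1" using energy_tail[OF meas fin \<epsilon>1] by blast
    \<comment> \<open>The base of a tail cone reaches 2 h further inwards and must still avoid the
      interval from -R to R; 3 h makes this strict.\<close>
    define R' where "R' = R + 3 * h"
    define n where "n = nat \<lceil>R' / h\<rceil> + 1"
    define I where "I = {- int n..int n}"
    define T where "T i = {real_of_int i * h..real_of_int i * h + h}" for i
    have cI: "0 < real (card I)" by (simp add: I_def)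
    have cover: "{-R'..R'} \<subseteq> (\<Union>i\<in>I. T i)"
    proof
      fix x assume x: "x \<in> {-R'..R'}"
      have "R' / h \<le> real n" unfolding n_def by linarith
      then have nR: "R' \<le> real n * h" using h by (simp add: field_simps)
      have "\<lfloor>x / h\<rfloor> \<in> I"
      proof -
        have "- real n \<le> x / h" "x / h \<le> real n" using x nR h by (auto simp: field_simps)
        then show ?thesis unfolding I_def by (auto simp: le_floor_iff floor_le_iff)
      qed
      moreover have "x \<in> T \<lfloor>x / h\<rfloor>"
        using floor_divide_lower[OF h(1), of x] floor_divide_upper[OF h(1), of x] by (simp add: T_def distrib_right)
      ultimately show "x \<in> (\<Union>i\<in>I. T i)" by blast
    qed
    \<comment> \<open>The distance at time \<open>a\<close> is at most 4 \<epsilon>2 on the base of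
      every tile, and the last bound keeps the sum over all tiles, amplified by K, below
      \<epsilon>1. The bound \<delta> / 4 preserves small charge on the tiles.\<close>
    define \<epsilon>2 where "\<epsilon>2 = min (min \<epsilon>1 (\<delta> / 4)) (\<epsilon>1 / (4 * K * real (card I)))"
    have \<epsilon>2: "0 < \<epsilon>2" "\<epsilon>2 \<le> \<epsilon>1" "\<epsilon>2 \<le> \<delta> / 4" "\<epsilon>2 \<le> \<epsilon>1 / (4 * K * real (card I))"
      unfolding \<epsilon>2_def using \<epsilon>1 \<delta> K cI by (simp_all only: min.coboundedI1 min.coboundedI2 order.refl min.cobounded1 min.cobounded2) auto
    define \<eta> where "\<eta> = \<epsilon>1 / real (card I)"
    have \<eta>: "0 < \<eta>" using \<epsilon>1 cI by (simp add: \<eta>_def)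
    have tot: "real (card I) * (K * (4 * \<epsilon>2) + \<eta>) \<le> 2 * \<epsilon>1"
    proof -
      have "\<epsilon>2 * (4 * K * real (card I)) \<le> \<epsilon>1" using \<epsilon>2(4) K cI by (simp add: pos_le_divide_eq)
      moreover have "real (card I) * \<eta> = \<epsilon>1" using cI by (simp add: \<eta>_def)
      ultimately show ?thesis by (simp add: algebra_simps)
    qed
    show "\<forall>\<^sub>F k in sequentially. \<forall>\<^sub>F \<tau> in at_right 0. \<forall>t\<in>{a..a+h}.
        gap UNIV (U \<tau>) (V \<tau>) (uk k) (vk k) t \<le> ennreal \<epsilon>"
      using convu[rule_format, OF \<epsilon>2(1)]
    proof eventually_elim
      case (elim k)
      note solk = sol[rule_format, of k]
      note mk[measurable] = smooth_sol_measurable[OF solk]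
      let ?tile = "\<lambda>i \<tau>. charge {real_of_int i * h - 2 * h..real_of_int i * h + h + 2 * h} (U \<tau>) (V \<tau>) a \<le> ennreal \<delta> \<longrightarrow>
          charge {real_of_int i * h - 2 * h..real_of_int i * h + h + 2 * h} (uk k) (vk k) a \<le> ennreal \<delta> \<longrightarrow>
          (\<forall>t\<in>{a..a+h}. gap (T i) (U \<tau>) (V \<tau>) (uk k) (vk k) t
           \<le> ennreal K * gap {real_of_int i * h - 2 * h..real_of_int i * h + h + 2 * h} (U \<tau>) (V \<tau>) (uk k) (vk k) a + ennreal \<eta>)"
      have "\<forall>\<^sub>F \<tau> in at_right 0. ?tile i \<tau>" for i
      proof -
        have "\<exists>\<tau>0>0. \<forall>\<tau> U V a0 b0. 0 < \<tau> \<longrightarrow> \<tau> < \<tau>0 \<longrightarrow> ts_sol m \<alpha> \<beta> \<tau> a0 b0 U V \<longrightarrow>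
          charge {real_of_int i * h - 2 * h..real_of_int i * h + h + 2 * h} U V a \<le> ennreal \<delta> \<longrightarrow>
          charge {real_of_int i * h - 2 * h..real_of_int i * h + h + 2 * h} (uk k) (vk k) a \<le> ennreal \<delta> \<longrightarrow>
          (\<forall>t\<in>{a..a+h}. gap {real_of_int i * h..real_of_int i * h + h} U V (uk k) (vk k) t
           \<le> ennreal K * gap {real_of_int i * h - 2 * h..real_of_int i * h + h + 2 * h} U V (uk k) (vk k) a + ennreal \<eta>)"
          using h a \<eta> by (intro stable[unfolded locally_stable_def, rule_format] solk) auto
        then obtain \<tau>0 where \<tau>0: "0 < \<tau>0" and P: "\<forall>\<tau> U V a0 b0. 0 < \<tau> \<longrightarrow> \<tau> < \<tau>0 \<longrightarrow> ts_sol m \<alpha> \<beta> \<tau> a0 b0 U V \<longrightarrow>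
          charge {real_of_int i * h - 2 * h..real_of_int i * h + h + 2 * h} U V a \<le> ennreal \<delta> \<longrightarrow>
          charge {real_of_int i * h - 2 * h..real_of_int i * h + h + 2 * h} (uk k) (vk k) a \<le> ennreal \<delta> \<longrightarrow>
          (\<forall>t\<in>{a..a+h}. gap {real_of_int i * h..real_of_int i * h + h} U V (uk k) (vk k) t
           \<le> ennreal K * gap {real_of_int i * h - 2 * h..real_of_int i * h + h + 2 * h} U V (uk k) (vk k) a + ennreal \<eta>)"
          by (elim exE conjE) (rule that)
        have "?tile i \<tau>" if "0 < \<tau>" "\<tau> < \<tau>0" for \<tau>
          unfolding T_def using P[THEN spec, of \<tau>, THEN spec, of "U \<tau>", THEN spec, of "V \<tau>", THEN spec, of "a0 \<tau>", THEN spec, of "b0 \<tau>"] that ts by blast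
        then show ?thesis using \<tau>0 unfolding eventually_at_right_field by blast
      qed
      then have "\<forall>\<^sub>F \<tau> in at_right 0. \<forall>i\<in>I. ?tile i \<tau>" by (intro eventually_ball_finite) (auto simp: I_def)
      moreover have "\<forall>\<^sub>F \<tau> in at_right 0. 0 < \<tau> \<and> \<tau> \<le> h / 10"
        unfolding eventually_at_right_field using h by (intro exI[of _ "h / 10"]) auto
      ultimately show ?case using convU[rule_format, OF \<epsilon>2(1)]
      proof eventually_elim
        case (elim \<tau>)
        note tile = elim(1) and Ua = elim(3)
        have tau: "0 < \<tau>" "\<tau> \<le> h / 10" using elim(2) by auto
        note uka = \<open>energy UNIV (\<lambda>x. uk k x a - f x) (\<lambda>x. vk k x a - g x) \<le> ennreal \<epsilon>2\<close>
        have ts\<tau>: "ts_sol m \<alpha> \<beta> \<tau> (a0 \<tau>) (b0 \<tau>) (U \<tau>) (V \<tau>)" using ts tau by blast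
        note mU = ts_sol_measurable[OF ts\<tau> tau(1)]
        have diff0: "gap UNIV (U \<tau>) (V \<tau>) (uk k) (vk k) a \<le> ennreal (4 * \<epsilon>2)"
        proof -
          have "energy UNIV (\<lambda>x. f x - uk k x a) (\<lambda>x. g x - vk k x a) \<le> ennreal \<epsilon>2" using uka by (subst energy_commute)
          then have "gap UNIV (U \<tau>) (V \<tau>) (uk k) (vk k) a \<le> ennreal (2 * \<epsilon>2 + 2 * \<epsilon>2)"
            using Ua \<epsilon>2(1) by (intro energy_triangle_le[OF mU[OF a] meas mk]) auto
          then show ?thesis by simp
        qed
        have small: "charge S (U \<tau>) (V \<tau>) a \<le> ennreal (2 * \<epsilon>2 + 2 * z)"
            "charge S (uk k) (vk k) a \<le> ennreal (2 * \<epsilon>2 + 2 * z)"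
          if "energy S f g \<le> ennreal z" "0 \<le> z" "S \<in> sets borel" for S z
          by (rule energy_triangle_0[OF mU[OF a] meas that(3) order.trans[OF energy_mono[OF subset_UNIV] Ua] that(1) less_imp_le[OF \<epsilon>2(1)] that(2)],
              rule energy_triangle_0[OF mk meas that(3) order.trans[OF energy_mono[OF subset_UNIV] uka] that(1) less_imp_le[OF \<epsilon>2(1)] that(2)])
        show ?case
        proof
          fix t assume t: "t \<in> {a..a+h}"
          then have t': "a \<le> t" "t \<le> a + h" "0 \<le> t" using a by auto
          note mUt = mU[OF t'(3)]
          have mD: "(\<lambda>x. U \<tau> x t - uk k x t) \<in> borel_measurable borel" "(\<lambda>x. V \<tau> x t - vk k x t) \<in> borel_measurable borel"
            using mUt mk by (auto intro: borel_measurable_diff)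
          have Tile: "gap (T i) (U \<tau>) (V \<tau>) (uk k) (vk k) t \<le> ennreal (K * (4 * \<epsilon>2) + \<eta>)" if i: "i \<in> I" for i
          proof -
            let ?b = "{real_of_int i * h - 2 * h..real_of_int i * h + h + 2 * h}"
            have "?b = {(real_of_int i * h - 2 * h)..(real_of_int i * h - 2 * h) + 5 * h}" by auto
            then have "energy ?b f g \<le> ennreal (\<delta> / 4)" using equi by metis
            from small[OF this] have "charge ?b (U \<tau>) (V \<tau>) a \<le> ennreal (2 * \<epsilon>2 + 2 * (\<delta> / 4))"
              "charge ?b (uk k) (vk k) a \<le> ennreal (2 * \<epsilon>2 + 2 * (\<delta> / 4))" using \<delta> by auto
            moreover have "ennreal (2 * \<epsilon>2 + 2 * (\<delta> / 4)) \<le> ennreal \<delta>" using \<epsilon>2(3) by (intro ennreal_leI) simp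
            ultimately have "charge ?b (U \<tau>) (V \<tau>) a \<le> ennreal \<delta>" "charge ?b (uk k) (vk k) a \<le> ennreal \<delta>"
              by (meson order.trans)+
            then have "gap (T i) (U \<tau>) (V \<tau>) (uk k) (vk k) t
               \<le> ennreal K * gap ?b (U \<tau>) (V \<tau>) (uk k) (vk k) a + ennreal \<eta>"
              using tile i t by blast
            also have "\<dots> \<le> ennreal (K * (4 * \<epsilon>2)) + ennreal \<eta>"
              using K \<epsilon>2(1) order.trans[OF energy_mono[of ?b UNIV] diff0] by (intro add_mono mult_ennreal_le) auto
            also have "\<dots> = ennreal (K * (4 * \<epsilon>2) + \<eta>)" using K \<epsilon>2(1) \<eta> by (simp add: ennreal_plus)
            finally show ?thesis .
          qed
          have center: "gap (\<Union>i\<in>I. T i) (U \<tau>) (V \<tau>) (uk k) (vk k) t \<le> ennreal (2 * \<epsilon>1)"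
          proof -
            have "gap (\<Union>i\<in>I. T i) (U \<tau>) (V \<tau>) (uk k) (vk k) t
                \<le> (\<Sum>i\<in>I. gap (T i) (U \<tau>) (V \<tau>) (uk k) (vk k) t)"
              by (rule energy_UN_le[OF mD]) (auto simp: I_def T_def)
            also have "\<dots> \<le> (\<Sum>i\<in>I. ennreal (K * (4 * \<epsilon>2) + \<eta>))" by (rule sum_mono) (rule Tile)
            also have "\<dots> = ennreal (\<Sum>i\<in>I. K * (4 * \<epsilon>2) + \<eta>)" using K \<epsilon>2(1) \<eta> by (intro sum_ennreal) auto
            also have "\<dots> \<le> ennreal (2 * \<epsilon>1)" using tot by (intro ennreal_leI) simp
            finally show ?thesis .
          qed
          have tail: "gap {c..e} (U \<tau>) (V \<tau>) (uk k) (vk k) t \<le> ennreal (192 * \<epsilon>1)"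
            if ce: "c \<le> e" and sub: "{c - 2 * h..e + 2 * h} \<subseteq> - {-R..R}" for c e
          proof -
            have "energy {c - 2 * h..e + 2 * h} f g \<le> ennreal \<epsilon>1" using order.trans[OF energy_mono[OF sub] R(2)] .
            from small[OF this] have s: "charge {c - 2 * h..e + 2 * h} (U \<tau>) (V \<tau>) a \<le> ennreal (2 * \<epsilon>2 + 2 * \<epsilon>1)"
              "charge {c - 2 * h..e + 2 * h} (uk k) (vk k) a \<le> ennreal (2 * \<epsilon>2 + 2 * \<epsilon>1)" using \<epsilon>1 by auto
            have e4: "ennreal 12 * E \<le> ennreal (48 * \<epsilon>1)" if "E \<le> ennreal (2 * \<epsilon>2 + 2 * \<epsilon>1)" for E
            proof -
              have "ennreal 12 * E \<le> ennreal (12 * (2 * \<epsilon>2 + 2 * \<epsilon>1))" using that \<epsilon>1 \<epsilon>2(1) by (intro mult_ennreal_le) auto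
              also have "\<dots> \<le> ennreal (48 * \<epsilon>1)" using \<epsilon>2(2) by (intro ennreal_leI) simp
              finally show ?thesis .
            qed
            have h2: "h \<le> 1 / 2" using h by simp
            have "charge {c..e} (U \<tau>) (V \<tau>) t \<le> ennreal (48 * \<epsilon>1)"
              using order.trans[OF ts_sol_charge[OF ts\<tau> tau a t'(1,2) ce h2] e4[OF s(1), simplified]] .
            moreover have "charge {c..e} (uk k) (vk k) t \<le> ennreal (48 * \<epsilon>1)"
              using order.trans[OF smooth_sol_charge[OF solk a t'(1,2) ce h(1) h2] e4[OF s(2), simplified]] .
            ultimately have "gap {c..e} (U \<tau>) (V \<tau>) (uk k) (vk k) t \<le> ennreal (2 * (48 * \<epsilon>1) + 2 * (48 * \<epsilon>1))"
              using \<epsilon>1 by (intro energy_triangle_diff[OF mUt mk]) auto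
            then show ?thesis by simp
          qed
          show "gap UNIV (U \<tau>) (V \<tau>) (uk k) (vk k) t \<le> ennreal \<epsilon>"
          proof (rule energy_UNIV_le[OF mD])
            fix Y0 :: real assume "0 \<le> Y0"
            define Y where "Y = max Y0 R'"
            let ?E = "\<lambda>S. gap S (U \<tau>) (V \<tau>) (uk k) (vk k) t"
            have YR: "R' \<le> Y" by (simp add: Y_def)
            have "{-Y0..Y0} \<subseteq> ({-Y..-R'} \<union> {R'..Y}) \<union> {-R'..R'}" by (auto simp: Y_def)
            then have "{-Y0..Y0} \<subseteq> ({-Y..-R'} \<union> {R'..Y}) \<union> (\<Union>i\<in>I. T i)" using cover by blast
            then have "?E {-Y0..Y0} \<le> ?E (({-Y..-R'} \<union> {R'..Y}) \<union> (\<Union>i\<in>I. T i))" by (rule energy_mono)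
            also have "\<dots> \<le> ?E ({-Y..-R'} \<union> {R'..Y}) + ?E (\<Union>i\<in>I. T i)"
              by (rule energy_Un_le[OF mD]) (auto simp: I_def T_def)
            also have "\<dots> \<le> (?E {-Y..-R'} + ?E {R'..Y}) + ?E (\<Union>i\<in>I. T i)"
              by (intro add_mono energy_Un_le[OF mD]) auto
            also have "\<dots> \<le> (ennreal (192 * \<epsilon>1) + ennreal (192 * \<epsilon>1)) + ennreal (2 * \<epsilon>1)"
              using YR R(1) h by (intro add_mono center tail) (auto simp: R'_def)
            also have "\<dots> = ennreal (386 * \<epsilon>1)" using \<epsilon>1 by (simp add: ennreal_plus[symmetric] del: ennreal_plus)
            also have "\<dots> \<le> ennreal \<epsilon>" using \<epsilon> by (intro ennreal_leI) (simp add: \<epsilon>1_def)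
            finally show "?E {-Y0..Y0} \<le> ennreal \<epsilon>" .
          qed
        qed
      qed
    qed
  qed
qed

subsection \<open>Convergence to the strong solution\<close>

lemma nn_integral_memL2:
  assumes "memL2 M f"
  shows "(\<integral>\<^sup>+x. ennreal ((cmod (f x))\<^sup>2) \<partial>M) = ennreal ((L2norm M f)\<^sup>2)"
  using assms unfolding memL2_def L2norm_def by (subst nn_integral_eq_integral) auto

lemma sq_int_memL2: "memL2 lborel f \<Longrightarrow> sq_int UNIV f = ennreal ((L2norm lborel f)\<^sup>2)"
  unfolding sq_int_def using nn_integral_memL2[of lborel f] by simp

lemma energy_memL2:
  "memL2 lborel f \<Longrightarrow> memL2 lborel g \<Longrightarrow> energy UNIV f g = ennreal ((L2norm lborel f)\<^sup>2 + (L2norm lborel g)\<^sup>2)"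
  by (simp add: energy_def sq_int_memL2)

lemma L2norm_nonneg: "0 \<le> L2norm M f"
  by (simp add: L2norm_def)

lemma memL2_I:
  assumes "f \<in> borel_measurable borel" "sq_int UNIV f < top"
  shows "memL2 lborel f"
  unfolding memL2_def
proof
  show "f \<in> borel_measurable lborel" using assms by simp
  then show "integrable lborel (\<lambda>x. (cmod (f x))\<^sup>2)"
    using assms(2) by (intro integrableI_nonneg) (auto simp: sq_int_def)
qed

lemma L2norm_le_of_sq_int:
  assumes "sq_int UNIV f \<le> ennreal (c\<^sup>2)" "0 \<le> c"
  shows "L2norm lborel f \<le> c"
proof (cases "integrable lborel (\<lambda>x. (cmod (f x))\<^sup>2)")
  case True
  then have "ennreal (\<integral>x. (cmod (f x))\<^sup>2 \<partial>lborel) \<le> ennreal (c\<^sup>2)"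
    using assms(1) by (subst nn_integral_eq_integral[symmetric]) (auto simp: sq_int_def)
  then have "(\<integral>x. (cmod (f x))\<^sup>2 \<partial>lborel) \<le> c\<^sup>2" by (simp add: ennreal_le_iff)
  then show ?thesis unfolding L2norm_def using assms(2) by (simp add: real_le_lsqrt)
\<comment> \<open>Without integrability the Bochner integral has the default value 0, and so has the
  norm.\<close>
qed (use assms(2) in \<open>simp add: L2norm_def not_integrable_integral_eq\<close>)

lemma memL2_diff:
  fixes f g :: "real \<Rightarrow> complex"
  assumes "memL2 lborel f" "memL2 lborel g"
  shows "memL2 lborel (\<lambda>x. f x - g x)"
proof (rule memL2_I)
  have m[measurable]: "f \<in> borel_measurable borel" "g \<in> borel_measurable borel" using assms by (auto simp: memL2_def)
  show "(\<lambda>x. f x - g x) \<in> borel_measurable borel" by measurable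
  have "energy UNIV (\<lambda>x. f x - g x) (\<lambda>x. f x - g x) \<le> 2 * energy UNIV f f + 2 * energy UNIV g g"
    using energy_triangle[of f f "\<lambda>x. 0" "\<lambda>x. 0" g g UNIV] m energy_uminus[of UNIV g g] by simp
  also have "\<dots> < top" using assms by (simp add: energy_memL2 ennreal_mult_less_top)
  finally show "sq_int UNIV (\<lambda>x. f x - g x) < top" by (simp add: energy_def)
qed

section \<open>From convergence in space-time to convergence at every time\<close>

lemma strip_sq_int:
  assumes "memL2 (strip T) (\<lambda>(x, t). w x t)"
  shows "(\<lambda>t. sq_int UNIV (\<lambda>x. w x t) * indicator {0..T} t) \<in> borel_measurable lborel"
    and "(\<integral>\<^sup>+t. sq_int UNIV (\<lambda>x. w x t) * indicator {0..T} t \<partial>lborel) = ennreal ((L2norm (strip T) (\<lambda>(x, t). w x t))\<^sup>2)"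
proof -
  let ?\<Omega> = "(UNIV :: real set) \<times> {0..T}"
  let ?F = "\<lambda>z. ennreal ((cmod ((\<lambda>(x, t). w x t) z))\<^sup>2) * indicator ?\<Omega> z"
  have \<Omega>: "?\<Omega> \<in> sets borel" by (intro borel_closed closed_Times) auto
  then have \<Omega>': "?\<Omega> \<inter> space lborel \<in> sets (lborel :: (real \<times> real) measure)" by simp
  have "(\<lambda>z. ennreal ((cmod ((\<lambda>(x, t). w x t) z))\<^sup>2)) \<in> borel_measurable (strip T)"
  proof -
    have [measurable]: "(\<lambda>(x, t). w x t) \<in> borel_measurable (strip T)" using assms unfolding memL2_def by blast
    show ?thesis by (rule measurable_compose[of "\<lambda>(x, t). w x t" "strip T" borel "\<lambda>z. ennreal ((cmod z)\<^sup>2)"]) measurable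
  qed
  then have F: "?F \<in> borel_measurable (lborel \<Otimes>\<^sub>M lborel)"
    unfolding strip_def borel_measurable_restrict_space_iff_ennreal[OF \<Omega>'] lborel_prod .
  have eq: "(\<integral>\<^sup>+x. ?F (x, t) \<partial>lborel) = sq_int UNIV (\<lambda>x. w x t) * indicator {0..T} t" for t
    by (cases "t \<in> {0..T}") (auto simp: sq_int_def)
  have "(\<lambda>t. \<integral>\<^sup>+x. ?F (x, t) \<partial>lborel) \<in> borel_measurable lborel"
    using lborel.borel_measurable_nn_integral_fst[OF measurable_pair_swap[OF F]] by (simp add: case_prod_beta)
  then show "(\<lambda>t. sq_int UNIV (\<lambda>x. w x t) * indicator {0..T} t) \<in> borel_measurable lborel" unfolding eq .
  have "(\<integral>\<^sup>+t. sq_int UNIV (\<lambda>x. w x t) * indicator {0..T} t \<partial>lborel) = (\<integral>\<^sup>+t. (\<integral>\<^sup>+x. ?F (x, t) \<partial>lborel) \<partial>lborel)"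
    unfolding eq ..
  also have "\<dots> = integral\<^sup>N (lborel \<Otimes>\<^sub>M lborel) ?F" by (rule lborel_pair.nn_integral_snd[OF F])
  also have "\<dots> = (\<integral>\<^sup>+z. ennreal ((cmod ((\<lambda>(x, t). w x t) z))\<^sup>2) \<partial>strip T)"
    unfolding strip_def nn_integral_restrict_space[OF \<Omega>'] lborel_prod ..
  also have "\<dots> = ennreal ((L2norm (strip T) (\<lambda>(x, t). w x t))\<^sup>2)" by (rule nn_integral_memL2[OF assms])
  finally show "(\<integral>\<^sup>+t. sq_int UNIV (\<lambda>x. w x t) * indicator {0..T} t \<partial>lborel) = ennreal ((L2norm (strip T) (\<lambda>(x, t). w x t))\<^sup>2)" .
qed

text \<open>A mean value argument: if the energy exceeded \<epsilon> throughout the interval, its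
  integral over time would be at least \<epsilon> (d - c), contrary to the bound on the space-time
  norms.\<close>

lemma strip_energy_small:
  assumes mem: "memL2 (strip T) (\<lambda>(x, t). w x t)" "memL2 (strip T) (\<lambda>(x, t). z x t)"
    and small: "(L2norm (strip T) (\<lambda>(x, t). w x t) + L2norm (strip T) (\<lambda>(x, t). z x t))\<^sup>2 < \<epsilon> * (d - c)"
    and cd: "0 \<le> c" "c \<le> d" "d \<le> T" and \<epsilon>: "0 \<le> \<epsilon>"
  shows "\<exists>t\<in>{c..d}. charge UNIV w z t \<le> ennreal \<epsilon>"
proof (rule ccontr)
  assume "\<not> ?thesis"
  then have gt: "ennreal \<epsilon> < charge UNIV w z t" if "t \<in> {c..d}" for t using that by (auto simp: not_le)
  let ?L = "L2norm (strip T) (\<lambda>(x, t). w x t)" and ?L' = "L2norm (strip T) (\<lambda>(x, t). z x t)"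
  have "ennreal (\<epsilon> * (d - c)) = (\<integral>\<^sup>+t. ennreal \<epsilon> * indicator {c..d} t \<partial>lborel)"
    using cd \<epsilon> by (simp add: nn_integral_cmult_indicator ennreal_mult)
  also have "\<dots> \<le> (\<integral>\<^sup>+t. sq_int UNIV (\<lambda>x. w x t) * indicator {0..T} t + sq_int UNIV (\<lambda>x. z x t) * indicator {0..T} t \<partial>lborel)"
    using gt cd by (intro nn_integral_mono) (auto simp: indicator_def energy_def less_imp_le)
  also have "\<dots> = ennreal (?L\<^sup>2) + ennreal (?L'\<^sup>2)"
    using strip_sq_int[OF mem(1)] strip_sq_int[OF mem(2)] by (subst nn_integral_add) auto
  also have "\<dots> \<le> ennreal ((?L + ?L')\<^sup>2)"
  proof -
    have "0 \<le> ?L * ?L'" by (intro mult_nonneg_nonneg L2norm_nonneg)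
    then have "?L\<^sup>2 + ?L'\<^sup>2 \<le> (?L + ?L')\<^sup>2" by (simp add: power2_sum)
    then show ?thesis by (simp add: ennreal_plus[symmetric] ennreal_leI del: ennreal_plus)
  qed
  finally have "\<epsilon> * (d - c) \<le> (?L + ?L')\<^sup>2" by (simp add: ennreal_le_iff)
  then show False using small by simp
qed

lemma L2_continuous_energy:
  fixes u v :: "real \<Rightarrow> real \<Rightarrow> complex" and t0 :: real
  assumes mem: "\<And>t. 0 \<le> t \<Longrightarrow> memL2 lborel (\<lambda>x. u x t) \<and> memL2 lborel (\<lambda>x. v x t)"
    and cont: "((\<lambda>t. L2norm lborel (\<lambda>x. u x t - u x t0)) \<longlongrightarrow> 0) (at t0 within {0..})"
      "((\<lambda>t. L2norm lborel (\<lambda>x. v x t - v x t0)) \<longlongrightarrow> 0) (at t0 within {0..})"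
    and t0: "0 \<le> t0" and \<epsilon>: "0 < \<epsilon>"
  shows "\<exists>d>0. \<forall>t\<ge>0. \<bar>t - t0\<bar> < d \<longrightarrow> energy UNIV (\<lambda>x. u x t - u x t0) (\<lambda>x. v x t - v x t0) \<le> ennreal \<epsilon>"
proof -
  let ?f = "\<lambda>t. (L2norm lborel (\<lambda>x. u x t - u x t0))\<^sup>2 + (L2norm lborel (\<lambda>x. v x t - v x t0))\<^sup>2"
  have "(?f \<longlongrightarrow> 0\<^sup>2 + 0\<^sup>2) (at t0 within {0..})" by (intro tendsto_intros cont)
  then have "\<forall>\<^sub>F t in at t0 within {0..}. dist (?f t) 0 < \<epsilon>" using \<epsilon> by (intro tendstoD) auto
  then obtain d where d: "0 < d" "\<And>t. 0 \<le> t \<Longrightarrow> t \<noteq> t0 \<Longrightarrow> dist t t0 < d \<Longrightarrow> dist (?f t) 0 < \<epsilon>"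
    unfolding eventually_at by auto
  have "energy UNIV (\<lambda>x. u x t - u x t0) (\<lambda>x. v x t - v x t0) \<le> ennreal \<epsilon>" if t: "0 \<le> t" "\<bar>t - t0\<bar> < d" for t
  proof (cases "t = t0")
    case True
    then show ?thesis by (simp add: energy_def sq_int_def)
  next
    case False
    then have "?f t \<le> \<epsilon>" using d(2)[OF t(1)] t by (auto simp: dist_real_def)
    then show ?thesis
      using mem[OF t(1)] mem[OF t0] by (subst energy_memL2) (auto intro: memL2_diff ennreal_leI simp del: ennreal_plus)
  qed
  then show ?thesis using d(1) by blast
qed

text \<open>Space-time convergence provides closeness at some time t' near t, and only for a late
  index l; the Cauchy property moves it to the index k at the same t'. The step from t' back to t
  uses continuity in L^2 of \<open>u\<close> and \<open>v\<close>, and uniform continuity of the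
  smooth solution. The latter holds on compact sets only, so everything happens on a bounded
  interval, with t' and l depending on it, before the interval grows to the line. The constant is 2
  * (2 + 2 * 4) + 2.\<close>

lemma limit_identification:
  fixes u v :: "real \<Rightarrow> real \<Rightarrow> complex" and uk vk :: "nat \<Rightarrow> real \<Rightarrow> real \<Rightarrow> complex"
  assumes sol: "\<And>k. smooth_sol m \<alpha> \<beta> (uk k) (vk k)" and ab: "0 \<le> a" "a < b"
    and mem: "\<And>t. 0 \<le> t \<Longrightarrow> memL2 lborel (\<lambda>x. u x t) \<and> memL2 lborel (\<lambda>x. v x t)"
    and cont: "\<And>t0. 0 \<le> t0 \<Longrightarrow> ((\<lambda>t. L2norm lborel (\<lambda>x. u x t - u x t0)) \<longlongrightarrow> 0) (at t0 within {0..})"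
      "\<And>t0. 0 \<le> t0 \<Longrightarrow> ((\<lambda>t. L2norm lborel (\<lambda>x. v x t - v x t0)) \<longlongrightarrow> 0) (at t0 within {0..})"
    and strip_mem: "\<forall>\<^sub>F k in sequentially. memL2 (strip b) (\<lambda>(x, t). uk k x t - u x t) \<and> memL2 (strip b) (\<lambda>(x, t). vk k x t - v x t)"
    and strip_lim: "(\<lambda>k. L2norm (strip b) (\<lambda>(x, t). uk k x t - u x t) + L2norm (strip b) (\<lambda>(x, t). vk k x t - v x t)) \<longlonglongrightarrow> 0"
    and cauchy: "\<And>k l t. k0 \<le> k \<Longrightarrow> k0 \<le> l \<Longrightarrow> t \<in> {a..b} \<Longrightarrow>
      gap UNIV (uk k) (vk k) (uk l) (vk l) t \<le> ennreal \<epsilon>"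
    and \<epsilon>: "0 < \<epsilon>" and k: "k0 \<le> k" and t: "t \<in> {a..b}"
  shows "gap UNIV (uk k) (vk k) u v t \<le> ennreal (22 * \<epsilon>)"
proof -
  have t0: "0 \<le> t" using t ab by auto
  note mk = smooth_sol_measurable[OF sol]
  have mu: "(\<lambda>x. u x t) \<in> borel_measurable borel" "(\<lambda>x. v x t) \<in> borel_measurable borel" if "0 \<le> t" for t
    using mem[OF that] by (auto simp: memL2_def)
  show ?thesis
  proof (rule energy_UNIV_le)
    show "(\<lambda>x. uk k x t - u x t) \<in> borel_measurable borel" "(\<lambda>x. vk k x t - v x t) \<in> borel_measurable borel"
      using mk mu[OF t0] by (auto intro: borel_measurable_diff)
    fix Y :: real assume Y: "0 \<le> Y"
    define \<omega> where "\<omega> = sqrt (\<epsilon> / (4 * Y + 4))"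
    have \<omega>: "0 < \<omega>" "\<omega>\<^sup>2 * (4 * Y) \<le> \<epsilon>" using \<epsilon> Y by (auto simp: \<omega>_def field_simps)
    obtain d1 where d1: "0 < d1" "\<And>x t'. \<bar>x\<bar> \<le> Y \<Longrightarrow> 0 \<le> t' \<Longrightarrow> t' \<le> b \<Longrightarrow> \<bar>t - t'\<bar> < d1 \<Longrightarrow> cmod (uk k x t - uk k x t') \<le> \<omega>"
    proof -
      obtain \<tau>0 where "0 < \<tau>0" and P: "\<And>\<tau> x x' t t'. \<tau> < \<tau>0 \<Longrightarrow> \<bar>x\<bar> \<le> Y \<Longrightarrow> \<bar>x'\<bar> \<le> Y \<Longrightarrow> 0 \<le> t \<Longrightarrow> t \<le> b \<Longrightarrow> 0 \<le> t' \<Longrightarrow> t' \<le> b \<Longrightarrow>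
        \<bar>x - x'\<bar> \<le> 2 * \<tau> \<Longrightarrow> \<bar>t - t'\<bar> \<le> \<tau> \<Longrightarrow> cmod (uk k x t - uk k x' t') \<le> \<omega>"
        using uniformly_close[OF smooth_sol_continuous(1)[OF sol[of k]] \<omega>(1), of Y b] by blast
      then show thesis using that[of \<tau>0] t t0 by auto
    qed
    obtain d2 where d2: "0 < d2" "\<And>x t'. \<bar>x\<bar> \<le> Y \<Longrightarrow> 0 \<le> t' \<Longrightarrow> t' \<le> b \<Longrightarrow> \<bar>t - t'\<bar> < d2 \<Longrightarrow> cmod (vk k x t - vk k x t') \<le> \<omega>"
    proof -
      obtain \<tau>0 where "0 < \<tau>0" and P: "\<And>\<tau> x x' t t'. \<tau> < \<tau>0 \<Longrightarrow> \<bar>x\<bar> \<le> Y \<Longrightarrow> \<bar>x'\<bar> \<le> Y \<Longrightarrow> 0 \<le> t \<Longrightarrow> t \<le> b \<Longrightarrow> 0 \<le> t' \<Longrightarrow> t' \<le> b \<Longrightarrow>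
        \<bar>x - x'\<bar> \<le> 2 * \<tau> \<Longrightarrow> \<bar>t - t'\<bar> \<le> \<tau> \<Longrightarrow> cmod (vk k x t - vk k x' t') \<le> \<omega>"
        using uniformly_close[OF smooth_sol_continuous(2)[OF sol[of k]] \<omega>(1), of Y b] by blast
      then show thesis using that[of \<tau>0] t t0 by auto
    qed
    obtain d3 where d3: "0 < d3" "\<And>t'. 0 \<le> t' \<Longrightarrow> \<bar>t' - t\<bar> < d3 \<Longrightarrow> energy UNIV (\<lambda>x. u x t' - u x t) (\<lambda>x. v x t' - v x t) \<le> ennreal \<epsilon>"
      using L2_continuous_energy[OF mem cont[OF t0] t0 \<epsilon>] by blast
    define \<rho> where "\<rho> = min (min d1 d2) d3 / 2"
    have \<rho>: "0 < \<rho>" "\<rho> < d1" "\<rho> < d2" "\<rho> < d3" using d1 d2 d3 by (auto simp: \<rho>_def)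
    \<comment> \<open>The window around t is clipped to the time interval; since a < b it keeps
      positive length even if t is an endpoint.\<close>
    define c d where "c = max a (t - \<rho>)" and "d = min b (t + \<rho>)"
    have cd: "c < d" "a \<le> c" "d \<le> b" using t ab \<rho> by (auto simp: c_def d_def)
    have near: "\<bar>t' - t\<bar> \<le> \<rho>" if "t' \<in> {c..d}" for t' using that by (auto simp: c_def d_def)
    have "(\<lambda>k. (L2norm (strip b) (\<lambda>(x, t). uk k x t - u x t) + L2norm (strip b) (\<lambda>(x, t). vk k x t - v x t))\<^sup>2) \<longlonglongrightarrow> 0\<^sup>2"
      by (intro tendsto_power strip_lim)
    from order_tendstoD(2)[OF this, of "\<epsilon> * (d - c)"] have "\<forall>\<^sub>F l in sequentially. (L2norm (strip b) (\<lambda>(x, t). uk l x t - u x t) + L2norm (strip b) (\<lambda>(x, t). vk l x t - v x t))\<^sup>2 < \<epsilon> * (d - c)"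
      using \<epsilon> cd by simp
    then have "\<forall>\<^sub>F l in sequentially. k0 \<le> l \<and> memL2 (strip b) (\<lambda>(x, t). uk l x t - u x t) \<and> memL2 (strip b) (\<lambda>(x, t). vk l x t - v x t) \<and>
        (L2norm (strip b) (\<lambda>(x, t). uk l x t - u x t) + L2norm (strip b) (\<lambda>(x, t). vk l x t - v x t))\<^sup>2 < \<epsilon> * (d - c)"
      using strip_mem eventually_ge_at_top[of k0] by eventually_elim auto
    then obtain l where l: "k0 \<le> l" "memL2 (strip b) (\<lambda>(x, t). uk l x t - u x t)" "memL2 (strip b) (\<lambda>(x, t). vk l x t - v x t)"
        "(L2norm (strip b) (\<lambda>(x, t). uk l x t - u x t) + L2norm (strip b) (\<lambda>(x, t). vk l x t - v x t))\<^sup>2 < \<epsilon> * (d - c)"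
      unfolding eventually_sequentially by blast
    obtain t' where t': "t' \<in> {c..d}" "gap UNIV (uk l) (vk l) u v t' \<le> ennreal \<epsilon>"
      using strip_energy_small[OF l(2-4)] cd ab \<epsilon> by auto
    have t'ab: "t' \<in> {a..b}" "0 \<le> t'" "t' \<le> b" using t' cd ab by auto
    have "gap UNIV (uk k) (vk k) u v t' \<le> ennreal (2 * \<epsilon> + 2 * \<epsilon>)"
      using cauchy[OF k l(1) t'ab(1)] t'(2) \<epsilon> by (intro energy_triangle_le[OF mk mk mu[OF t'ab(2)]]) auto
    then have 2: "gap {-Y..Y} (uk k) (vk k) u v t' \<le> ennreal (4 * \<epsilon>)"
      using order.trans[OF energy_mono[OF subset_UNIV]] by simp
    have 1: "energy {-Y..Y} (\<lambda>x. uk k x t - uk k x t') (\<lambda>x. vk k x t - vk k x t') \<le> ennreal \<epsilon>"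
    proof -
      have sq: "sq_int {-Y..Y} f \<le> ennreal (\<omega>\<^sup>2 * (2 * Y))" if "\<And>x. \<bar>x\<bar> \<le> Y \<Longrightarrow> cmod (f x) \<le> \<omega>" for f
      proof -
        have "sq_int {-Y..Y} f \<le> (\<integral>\<^sup>+x. ennreal (\<omega>\<^sup>2) * indicator {-Y..Y} x \<partial>lborel)"
          unfolding sq_int_def using that by (intro nn_integral_mono) (auto simp: indicator_def abs_le_iff intro!: ennreal_leI power_mono)
        also have "\<dots> = ennreal (\<omega>\<^sup>2 * (2 * Y))" using Y by (subst nn_integral_cmult_indicator) (auto simp: ennreal_mult)
        finally show ?thesis .
      qed
      have "\<bar>t - t'\<bar> < d1" "\<bar>t - t'\<bar> < d2" using near[OF t'(1)] \<rho> by auto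
      then have "energy {-Y..Y} (\<lambda>x. uk k x t - uk k x t') (\<lambda>x. vk k x t - vk k x t') \<le> ennreal (\<omega>\<^sup>2 * (2 * Y)) + ennreal (\<omega>\<^sup>2 * (2 * Y))"
        unfolding energy_def using d1(2) d2(2) t'ab by (intro add_mono sq) auto
      also have "\<dots> = ennreal (\<omega>\<^sup>2 * (4 * Y))" using Y by (subst ennreal_plus[symmetric]) auto
      also have "\<dots> \<le> ennreal \<epsilon>" using \<omega>(2) by (rule ennreal_leI)
      finally show ?thesis .
    qed
    have 3: "energy {-Y..Y} (\<lambda>x. u x t' - u x t) (\<lambda>x. v x t' - v x t) \<le> ennreal \<epsilon>"
      using d3(2)[OF t'ab(2)] near[OF t'(1)] \<rho> order.trans[OF energy_mono[OF subset_UNIV]] by fastforce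
    have 4: "energy {-Y..Y} (\<lambda>x. uk k x t - u x t') (\<lambda>x. vk k x t - v x t') \<le> ennreal (2 * \<epsilon> + 2 * (4 * \<epsilon>))"
      using \<epsilon> 1 2 by (intro energy_triangle_le[OF mk mk mu[OF t'ab(2)]]) auto
    have "gap {-Y..Y} (uk k) (vk k) u v t \<le> ennreal (2 * (2 * \<epsilon> + 2 * (4 * \<epsilon>)) + 2 * \<epsilon>)"
      using \<epsilon> 3 4 by (intro energy_triangle_le[OF mk mu[OF t'ab(2)] mu[OF t0]]) auto
    then show "gap {-Y..Y} (uk k) (vk k) u v t \<le> ennreal (22 * \<epsilon>)" by simp
  qed
qed

text \<open>\<open>L2norm\<close> is 0 on functions whose square is not integrable, so convergence
  of norms at time 0 carries information only once membership is established. It comes from the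
  summability of the grid data.\<close>

lemma ts_sol_initial_memL2:
  assumes ts: "ts_sol m \<alpha> \<beta> \<tau> a b U V" and tau: "0 < \<tau>"
  shows "memL2 lborel (\<lambda>x. U x 0)" "memL2 lborel (\<lambda>x. V x 0)"
proof -
  let ?s = "\<lambda>j. (cmod (a j))\<^sup>2 + (cmod (b j))\<^sup>2"
  have sum: "?s summable_on UNIV" and U0: "\<And>x. U x 0 = a \<lfloor>x / \<tau>\<rfloor>" and V0: "\<And>x. V x 0 = b \<lfloor>x / \<tau>\<rfloor>"
    using ts unfolding ts_sol_def by blast+
  note meas = ts_sol_measurable[OF ts tau order.refl]
  have "charge UNIV U V 0 \<le> ennreal (2 * (\<tau> * infsum ?s UNIV))"
  proof (rule energy_UNIV_le[OF meas])
    fix Y :: real assume "0 \<le> Y"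
    define A B where "A = \<lfloor>- Y / \<tau>\<rfloor> - 1" and "B = \<lfloor>Y / \<tau>\<rfloor> + 1"
    have "real_of_int A \<le> - Y / \<tau> - 1" "Y / \<tau> + 1 \<le> real_of_int B + 1" unfolding A_def B_def by linarith+
    then have AB: "real_of_int A * \<tau> + \<tau> \<le> - Y" "Y + \<tau> \<le> (real_of_int B + 1) * \<tau>" using tau by (auto simp: field_simps)
    have "energy {-Y..Y} (\<lambda>x. U x 0 - 0) (\<lambda>x. V x 0 - 0)
      \<le> ennreal (2 * (\<tau> * (\<Sum>j=A..B. (cmod (a j - 0))\<^sup>2 + (cmod (b j - 0))\<^sup>2)) + 4 * (0\<^sup>2 * (\<tau> * real (card {A..B}))))"
      by (rule energy_cells_upper[OF tau, where \<theta> = 0]) (use tau AB in \<open>auto simp: U0 V0\<close>)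
    also have "\<dots> \<le> ennreal (2 * (\<tau> * infsum ?s UNIV))"
      using tau finite_sum_le_infsum[OF sum, of "{A..B}"] by (intro ennreal_leI) auto
    finally show "charge {-Y..Y} U V 0 \<le> ennreal (2 * (\<tau> * infsum ?s UNIV))" by simp
  qed
  then have "charge UNIV U V 0 < top" by (rule le_less_trans) simp
  then show "memL2 lborel (\<lambda>x. U x 0)" "memL2 lborel (\<lambda>x. V x 0)"
    using meas by (auto intro!: memL2_I simp: energy_def)
qed

text \<open>A restart at a later time compares the scheme with the smooth approximations again and
  needs both to be close to the strong solution there. Hence uniform convergence of the
  approximations is proved along with that of the scheme.\<close>

lemma ts_sol_converges_in_energy:
  fixes u v :: "real \<Rightarrow> real \<Rightarrow> complex" and uk vk :: "nat \<Rightarrow> real \<Rightarrow> real \<Rightarrow> complex" and U V :: "real \<Rightarrow> real \<Rightarrow> real \<Rightarrow> complex"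
  assumes ts: "\<And>\<tau>. 0 < \<tau> \<Longrightarrow> ts_sol m \<alpha> \<beta> \<tau> (a0 \<tau>) (b0 \<tau>) (U \<tau>) (V \<tau>)"
    and sol: "\<And>k. smooth_sol m \<alpha> \<beta> (uk k) (vk k)"
    and mem: "\<And>t. 0 \<le> t \<Longrightarrow> memL2 lborel (\<lambda>x. u x t) \<and> memL2 lborel (\<lambda>x. v x t)"
    and cont: "\<And>t0. 0 \<le> t0 \<Longrightarrow> ((\<lambda>t. L2norm lborel (\<lambda>x. u x t - u x t0)) \<longlongrightarrow> 0) (at t0 within {0..})"
      "\<And>t0. 0 \<le> t0 \<Longrightarrow> ((\<lambda>t. L2norm lborel (\<lambda>x. v x t - v x t0)) \<longlongrightarrow> 0) (at t0 within {0..})"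
    and strip_mem: "\<And>b. 0 < b \<Longrightarrow> \<forall>\<^sub>F k in sequentially. memL2 (strip b) (\<lambda>(x, t). uk k x t - u x t) \<and> memL2 (strip b) (\<lambda>(x, t). vk k x t - v x t)"
    and strip_lim: "\<And>b. 0 < b \<Longrightarrow>
      (\<lambda>k. L2norm (strip b) (\<lambda>(x, t). uk k x t - u x t) + L2norm (strip b) (\<lambda>(x, t). vk k x t - v x t)) \<longlonglongrightarrow> 0"
    and init: "memL2 lborel u0" "memL2 lborel v0"
    and initU: "\<And>\<epsilon>. 0 < \<epsilon> \<Longrightarrow> \<forall>\<^sub>F \<tau> in at_right 0. energy UNIV (\<lambda>x. U \<tau> x 0 - u0 x) (\<lambda>x. V \<tau> x 0 - v0 x) \<le> ennreal \<epsilon>"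
    and initu: "\<And>\<epsilon>. 0 < \<epsilon> \<Longrightarrow> \<forall>\<^sub>F k in sequentially. energy UNIV (\<lambda>x. uk k x 0 - u0 x) (\<lambda>x. vk k x 0 - v0 x) \<le> ennreal \<epsilon>"
    and T: "0 \<le> T" and \<epsilon>: "0 < \<epsilon>"
  shows "\<forall>\<^sub>F \<tau> in at_right 0. \<forall>t\<in>{0..T}. gap UNIV (U \<tau>) (V \<tau>) u v t \<le> ennreal \<epsilon>"
proof -
  define EU where "EU \<tau> t f g = energy UNIV (\<lambda>x. U \<tau> x t - f x) (\<lambda>x. V \<tau> x t - g x)" for \<tau> t f g
  define Eu where "Eu k t f g = energy UNIV (\<lambda>x. uk k x t - f x) (\<lambda>x. vk k x t - g x)" for k t f g
  define conv where "conv t f g \<longleftrightarrow> (\<forall>\<epsilon>>0. \<forall>\<^sub>F \<tau> in at_right 0. EU \<tau> t f g \<le> ennreal \<epsilon>) \<and> (\<forall>\<epsilon>>0. \<forall>\<^sub>F k in sequentially. Eu k t f g \<le> ennreal \<epsilon>)" for t f g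
  define P where "P a b \<longleftrightarrow> (\<forall>\<epsilon>>0. (\<forall>\<^sub>F \<tau> in at_right 0. \<forall>t\<in>{a..b}. EU \<tau> t (\<lambda>x. u x t) (\<lambda>x. v x t) \<le> ennreal \<epsilon>) \<and>
      (\<forall>\<^sub>F k in sequentially. \<forall>t\<in>{a..b}. Eu k t (\<lambda>x. u x t) (\<lambda>x. v x t) \<le> ennreal \<epsilon>))" for a b
  have P_conv: "conv t (\<lambda>x. u x t) (\<lambda>x. v x t)" if "P a b" "t \<in> {a..b}" for a b t
    using that unfolding P_def conv_def by (auto elim!: eventually_mono)
  have P_mono: "P a b" if "P a b'" "b \<le> b'" for a b b'
    using that unfolding P_def by (fastforce elim!: eventually_mono)
  note mk = smooth_sol_measurable[OF sol]
  have mu: "(\<lambda>x. u x t) \<in> borel_measurable borel" "(\<lambda>x. v x t) \<in> borel_measurable borel" if "0 \<le> t" for t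
    using mem[OF that] by (auto simp: memL2_def)
  have finu: "charge UNIV u v t < top" if "0 \<le> t" for t
    using mem[OF that] by (simp add: energy_memL2)
  obtain \<delta> where \<delta>: "0 < \<delta>" and comp: "comparable m \<alpha> \<beta> \<delta>" using global_comparison by blast
  \<comment> \<open>The reference pair is left free: at time 0 closeness is given to the prescribed
    data, at later times to the strong solution.\<close>
  have step: "P a (a + h)" if h: "0 < h" "10 * h \<le> 1" and a: "0 \<le> a" and fg: "f \<in> borel_measurable borel" "g \<in> borel_measurable borel" "energy UNIV f g < top"
    and equi: "\<And>c. energy {c..c + 5 * h} f g \<le> ennreal \<delta>" and cv: "conv a f g" for h a f g
    unfolding P_def
  proof (intro allI impI)
    fix \<epsilon> :: real assume \<epsilon>: "0 < \<epsilon>"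
    \<comment> \<open>178 = 2 + 2 * 88 from the triangle inequality through a smooth solution, and
      88 = 22 * 4 from the identification of the limit applied to a Cauchy bound of 4
      \<epsilon>'.\<close>
    define \<epsilon>' where "\<epsilon>' = \<epsilon> / 178"
    have \<epsilon>': "0 < \<epsilon>'" using \<epsilon> by (simp add: \<epsilon>'_def)
    have cv': "\<forall>\<epsilon>>0. \<forall>\<^sub>F \<tau> in at_right 0. energy UNIV (\<lambda>x. U \<tau> x a - f x) (\<lambda>x. V \<tau> x a - g x) \<le> ennreal \<epsilon>"
        "\<forall>\<epsilon>>0. \<forall>\<^sub>F k in sequentially. energy UNIV (\<lambda>x. uk k x a - f x) (\<lambda>x. vk k x a - g x) \<le> ennreal \<epsilon>"
      using cv unfolding conv_def EU_def Eu_def by blast+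
    have ts': "\<forall>\<tau>>0. ts_sol m \<alpha> \<beta> \<tau> (a0 \<tau>) (b0 \<tau>) (U \<tau>) (V \<tau>)" and sol': "\<forall>k. smooth_sol m \<alpha> \<beta> (uk k) (vk k)"
      and equi': "\<forall>c. energy {c..c + 5 * h} f g \<le> ennreal \<delta>" using ts sol equi by blast+
    have "\<forall>\<^sub>F k in sequentially. \<forall>\<^sub>F \<tau> in at_right 0. \<forall>t\<in>{a..a+h}.
        gap UNIV (U \<tau>) (V \<tau>) (uk k) (vk k) t \<le> ennreal \<epsilon>'"
      by (rule comp[unfolded comparable_def, THEN spec, of h, THEN spec, of a, THEN spec, of f, THEN spec, of g, THEN spec, of U, THEN spec, of V, THEN spec, of a0,
            THEN spec, of b0, THEN spec, of uk, THEN spec, of vk, THEN spec, of \<epsilon>', THEN mp, OF h(1), THEN mp, OF h(2), THEN mp, OF a,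
            THEN mp, OF fg(1), THEN mp, OF fg(2), THEN mp, OF fg(3), THEN mp, OF equi', THEN mp, OF ts', THEN mp, OF sol',
            THEN mp, OF cv'(1), THEN mp, OF cv'(2), THEN mp, OF \<epsilon>'])
    then obtain k0 where k0: "\<And>k. k0 \<le> k \<Longrightarrow> \<forall>\<^sub>F \<tau> in at_right 0. \<forall>t\<in>{a..a+h}.
        gap UNIV (U \<tau>) (V \<tau>) (uk k) (vk k) t \<le> ennreal \<epsilon>'"
      unfolding eventually_sequentially by blast
    \<comment> \<open>The scheme is absent from the conclusion and acts as intermediary: for given
      k, l and t one sufficiently small mesh close to both smooth solutions is enough.\<close>
    have cauchy: "gap UNIV (uk k) (vk k) (uk l) (vk l) t \<le> ennreal (4 * \<epsilon>')"
      if "k0 \<le> k" "k0 \<le> l" "t \<in> {a..a+h}" for k l t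
    proof -
      have "\<forall>\<^sub>F \<tau> in at_right 0. 0 < \<tau> \<and> gap UNIV (U \<tau>) (V \<tau>) (uk k) (vk k) t \<le> ennreal \<epsilon>' \<and>
          gap UNIV (U \<tau>) (V \<tau>) (uk l) (vk l) t \<le> ennreal \<epsilon>'"
        using k0[OF that(1)] k0[OF that(2)] eventually_at_right_less[of "0::real"] by eventually_elim (use that(3) in auto)
      then obtain \<tau> where \<tau>: "0 < \<tau>" "gap UNIV (U \<tau>) (V \<tau>) (uk k) (vk k) t \<le> ennreal \<epsilon>'"
          "gap UNIV (U \<tau>) (V \<tau>) (uk l) (vk l) t \<le> ennreal \<epsilon>'"
        using eventually_happens'[OF trivial_limit_at_right_real] by blast
      have t0: "0 \<le> t" using that(3) a by auto
      have "gap UNIV (uk k) (vk k) (U \<tau>) (V \<tau>) t \<le> ennreal \<epsilon>'" using \<tau>(2) by (subst energy_commute)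
      then have "gap UNIV (uk k) (vk k) (uk l) (vk l) t \<le> ennreal (2 * \<epsilon>' + 2 * \<epsilon>')"
        using \<tau>(3) \<epsilon>' by (intro energy_triangle_le[OF mk ts_sol_measurable[OF ts[OF \<tau>(1)] \<tau>(1) t0] mk]) auto
      then show ?thesis by simp
    qed
    have uk_u: "gap UNIV (uk k) (vk k) u v t \<le> ennreal (88 * \<epsilon>')" if "k0 \<le> k" "t \<in> {a..a+h}" for k t
    proof -
      have ah: "a < a + h" "0 < a + h" "0 < 4 * \<epsilon>'" using a h \<epsilon>' by auto
      have "gap UNIV (uk k) (vk k) u v t \<le> ennreal (22 * (4 * \<epsilon>'))"
        by (rule limit_identification[OF sol a ah(1) mem cont strip_mem[OF ah(2)] strip_lim[OF ah(2)] cauchy ah(3) that])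
      then show ?thesis by simp
    qed
    have "\<forall>\<^sub>F \<tau> in at_right 0. \<forall>t\<in>{a..a+h}. EU \<tau> t (\<lambda>x. u x t) (\<lambda>x. v x t) \<le> ennreal \<epsilon>"
      using k0[OF order.refl] eventually_at_right_less[of "0::real"]
    proof eventually_elim
      case (elim \<tau>)
      show ?case
      proof
        fix t assume t: "t \<in> {a..a+h}"
        then have t0: "0 \<le> t" using a by auto
        have "gap UNIV (U \<tau>) (V \<tau>) u v t \<le> ennreal (2 * \<epsilon>' + 2 * (88 * \<epsilon>'))"
          using elim(1) t uk_u[OF order.refl t] \<epsilon>'
          by (intro energy_triangle_le[OF ts_sol_measurable[OF ts[OF elim(2)] elim(2) t0] mk mu[OF t0]]) auto
        then show "EU \<tau> t (\<lambda>x. u x t) (\<lambda>x. v x t) \<le> ennreal \<epsilon>" by (simp add: EU_def \<epsilon>'_def)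
      qed
    qed
    moreover have "\<forall>\<^sub>F k in sequentially. \<forall>t\<in>{a..a+h}. Eu k t (\<lambda>x. u x t) (\<lambda>x. v x t) \<le> ennreal \<epsilon>"
    proof -
      have "ennreal (88 * \<epsilon>') \<le> ennreal \<epsilon>" using \<epsilon> by (intro ennreal_leI) (simp add: \<epsilon>'_def)
      then have "Eu k t (\<lambda>x. u x t) (\<lambda>x. v x t) \<le> ennreal \<epsilon>" if "k0 \<le> k" "t \<in> {a..a+h}" for k t
        using uk_u[OF that] unfolding Eu_def by (rule order.trans[rotated])
      then show ?thesis unfolding eventually_sequentially by blast
    qed
    ultimately show "(\<forall>\<^sub>F \<tau> in at_right 0. \<forall>t\<in>{a..a+h}. EU \<tau> t (\<lambda>x. u x t) (\<lambda>x. v x t) \<le> ennreal \<epsilon>) \<and>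
        (\<forall>\<^sub>F k in sequentially. \<forall>t\<in>{a..a+h}. Eu k t (\<lambda>x. u x t) (\<lambda>x. v x t) \<le> ennreal \<epsilon>)" by blast
  qed
  \<comment> \<open>The definition of a strong solution does not state outright that its value at
    time 0 is the given data. A first step started from the given data yields convergence to the
    strong solution on a short interval, and evaluation at its left end gives the required statement
    at time 0.\<close>
  have conv0: "conv 0 (\<lambda>x. u x 0) (\<lambda>x. v x 0)"
  proof -
    have m0: "u0 \<in> borel_measurable borel" "v0 \<in> borel_measurable borel" using init by (auto simp: memL2_def)
    have fin0: "energy UNIV u0 v0 < top" using init by (simp add: energy_memL2)
    obtain \<eta> where \<eta>: "0 < \<eta>" "\<And>c. energy {c..c+\<eta>} u0 v0 \<le> ennreal \<delta>" using energy_equi_integrable[OF m0 fin0 \<delta>] by blast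
    define h where "h = min (\<eta> / 5) (1 / 10)"
    have h: "0 < h" "10 * h \<le> 1" "5 * h \<le> \<eta>" using \<eta> by (auto simp: h_def)
    have "energy {c..c + 5 * h} u0 v0 \<le> ennreal \<delta>" for c
      using order.trans[OF energy_mono \<eta>(2)[of c], of "{c..c + 5 * h}"] h by auto
    moreover have "conv 0 u0 v0" unfolding conv_def EU_def Eu_def using initU initu by blast
    ultimately have "P 0 (0 + h)" using h m0 fin0 by (intro step) auto
    then show ?thesis by (rule P_conv) (use h in auto)
  qed
  \<comment> \<open>The induction principle considers arbitrary subintervals, whose left ends need
    not have been reached yet; convergence at the left end is therefore a premise.\<close>
  define PP where "PP a b \<longleftrightarrow> (0 \<le> a \<longrightarrow> conv a (\<lambda>x. u x a) (\<lambda>x. v x a) \<longrightarrow> P a b)" for a b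
  have "PP 0 T"
    using T
  proof (induction rule: Bolzano)
    case (trans a b c)
    show ?case unfolding PP_def
    proof (intro impI)
      assume a: "0 \<le> a" and ca: "conv a (\<lambda>x. u x a) (\<lambda>x. v x a)"
      have Pab: "P a b" using trans(1) a ca by (simp add: PP_def)
      have "conv b (\<lambda>x. u x b) (\<lambda>x. v x b)" using P_conv[OF Pab] trans(3) by auto
      then have Pbc: "P b c" using trans(2,3) a by (simp add: PP_def)
      show "P a c" unfolding P_def
      proof (intro allI impI conjI)
        fix \<epsilon> :: real assume \<epsilon>: "0 < \<epsilon>"
        have "\<forall>\<^sub>F \<tau> in at_right 0. \<forall>t\<in>{a..b}. EU \<tau> t (\<lambda>x. u x t) (\<lambda>x. v x t) \<le> ennreal \<epsilon>"
          "\<forall>\<^sub>F \<tau> in at_right 0. \<forall>t\<in>{b..c}. EU \<tau> t (\<lambda>x. u x t) (\<lambda>x. v x t) \<le> ennreal \<epsilon>"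
          using Pab Pbc \<epsilon> unfolding P_def by blast+
        then show "\<forall>\<^sub>F \<tau> in at_right 0. \<forall>t\<in>{a..c}. EU \<tau> t (\<lambda>x. u x t) (\<lambda>x. v x t) \<le> ennreal \<epsilon>"
          by eventually_elim (meson atLeastAtMost_iff linear)
        have "\<forall>\<^sub>F k in sequentially. \<forall>t\<in>{a..b}. Eu k t (\<lambda>x. u x t) (\<lambda>x. v x t) \<le> ennreal \<epsilon>"
          "\<forall>\<^sub>F k in sequentially. \<forall>t\<in>{b..c}. Eu k t (\<lambda>x. u x t) (\<lambda>x. v x t) \<le> ennreal \<epsilon>"
          using Pab Pbc \<epsilon> unfolding P_def by blast+
        then show "\<forall>\<^sub>F k in sequentially. \<forall>t\<in>{a..c}. Eu k t (\<lambda>x. u x t) (\<lambda>x. v x t) \<le> ennreal \<epsilon>"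
          by eventually_elim (meson atLeastAtMost_iff linear)
      qed
    qed
  next
    case (local x)
    then have x: "0 \<le> x" by simp
    have \<delta>4: "0 < \<delta> / 4" using \<delta> by simp
    obtain \<eta> where \<eta>: "0 < \<eta>" "\<And>c. energy {c..c+\<eta>} (\<lambda>y. u y x) (\<lambda>y. v y x) \<le> ennreal (\<delta> / 4)"
      using energy_equi_integrable[OF mu[OF x] finu[OF x] \<delta>4] by blast
    \<comment> \<open>One length h must serve all starting times a near x. The charge bound at x is
      transported to a by continuity in L^2, and twice a quarter plus twice a quarter restores
      \<delta>.\<close>
    obtain d' where d': "0 < d'" "\<And>t. 0 \<le> t \<Longrightarrow> \<bar>t - x\<bar> < d' \<Longrightarrow> energy UNIV (\<lambda>y. u y t - u y x) (\<lambda>y. v y t - v y x) \<le> ennreal (\<delta> / 4)"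
      using L2_continuous_energy[OF mem cont[OF x] x \<delta>4] by blast
    define h where "h = min (\<eta> / 5) (1 / 10)"
    have h: "0 < h" "10 * h \<le> 1" "5 * h \<le> \<eta>" using \<eta> by (auto simp: h_def)
    have "PP a b" if ab: "a \<le> x" "x \<le> b" "b - a < min d' h" for a b
      unfolding PP_def
    proof (intro impI)
      assume a: "0 \<le> a" and ca: "conv a (\<lambda>x. u x a) (\<lambda>x. v x a)"
      have near: "energy UNIV (\<lambda>y. u y a - u y x) (\<lambda>y. v y a - v y x) \<le> ennreal (\<delta> / 4)" using d'(2)[OF a] ab by auto
      have "energy {c..c + 5 * h} (\<lambda>y. u y a) (\<lambda>y. v y a) \<le> ennreal (2 * (\<delta> / 4) + 2 * (\<delta> / 4))" for c
      proof (rule energy_triangle_0[OF mu[OF a] mu[OF x]])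
        show "energy {c..c + 5 * h} (\<lambda>y. u y a - u y x) (\<lambda>y. v y a - v y x) \<le> ennreal (\<delta> / 4)"
          using order.trans[OF energy_mono[OF subset_UNIV] near] .
        show "energy {c..c + 5 * h} (\<lambda>y. u y x) (\<lambda>y. v y x) \<le> ennreal (\<delta> / 4)"
          using order.trans[OF energy_mono \<eta>(2)[of c], of "{c..c + 5 * h}"] h by auto
      qed (use \<delta> in auto)
      then have "P a (a + h)" using h a mu[OF a] finu[OF a] ca by (intro step) auto
      then show "P a b" by (rule P_mono) (use ab in auto)
    qed
    then show ?case using d' h by (intro exI[of _ "min d' h"]) auto
  qed
  then have "P 0 T" using conv0 by (simp add: PP_def)
  then show ?thesis using \<epsilon> unfolding P_def EU_def by blast
qed

theorem theorem1p1:
  fixes m \<alpha> \<beta> :: real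
    and u0 v0 :: "real \<Rightarrow> complex"
    and a b :: "real \<Rightarrow> int \<Rightarrow> complex"
    and U V :: "real \<Rightarrow> real \<Rightarrow> real \<Rightarrow> complex"
    and u v :: "real \<Rightarrow> real \<Rightarrow> complex"
  assumes "m \<ge> 0"
    and "memL2 lborel u0" and "memL2 lborel v0"
    and "\<forall>\<tau>>0. ts_sol m \<alpha> \<beta> \<tau> (a \<tau>) (b \<tau>) (U \<tau>) (V \<tau>)"
    and "((\<lambda>\<tau>. L2norm lborel (\<lambda>x. U \<tau> x 0 - u0 x) + L2norm lborel (\<lambda>x. V \<tau> x 0 - v0 x))
           \<longlongrightarrow> 0) (at_right 0)"
    and "strong_sol m \<alpha> \<beta> u0 v0 u v"
    and "T > 0"
  shows "((\<lambda>\<tau>. (SUP t\<in>{0..T}. L2norm lborel (\<lambda>x. U \<tau> x t - u x t))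
              + (SUP t\<in>{0..T}. L2norm lborel (\<lambda>x. V \<tau> x t - v x t))) \<longlongrightarrow> 0) (at_right 0)"
proof -
  note ts = assms(4)[rule_format]
  obtain uk vk where sol: "\<And>k. smooth_sol m \<alpha> \<beta> (uk k) (vk k)"
    and init_mem: "\<forall>\<^sub>F k in sequentially. memL2 lborel (\<lambda>x. uk k x 0 - u0 x) \<and> memL2 lborel (\<lambda>x. vk k x 0 - v0 x)"
    and init_lim: "(\<lambda>k. L2norm lborel (\<lambda>x. uk k x 0 - u0 x) + L2norm lborel (\<lambda>x. vk k x 0 - v0 x)) \<longlonglongrightarrow> 0"
    and strip: "\<And>T. 0 < T \<Longrightarrow>
           eventually (\<lambda>k. memL2 (strip T) (\<lambda>(x, t). uk k x t - u x t) \<and> memL2 (strip T) (\<lambda>(x, t). vk k x t - v x t)) sequentially \<and>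
           (\<lambda>k. L2norm (strip T) (\<lambda>(x, t). uk k x t - u x t) + L2norm (strip T) (\<lambda>(x, t). vk k x t - v x t)) \<longlonglongrightarrow> 0"
    using assms(6) unfolding strong_sol_def by blast
  have mem: "\<And>t. 0 \<le> t \<Longrightarrow> memL2 lborel (\<lambda>x. u x t) \<and> memL2 lborel (\<lambda>x. v x t)"
    and cont: "\<And>t0. 0 \<le> t0 \<Longrightarrow> ((\<lambda>t. L2norm lborel (\<lambda>x. u x t - u x t0)) \<longlongrightarrow> 0) (at t0 within {0..})"
      "\<And>t0. 0 \<le> t0 \<Longrightarrow> ((\<lambda>t. L2norm lborel (\<lambda>x. v x t - v x t0)) \<longlongrightarrow> 0) (at t0 within {0..})"
    using assms(6) unfolding strong_sol_def by blast+
  have energy_le: "energy UNIV f g \<le> ennreal \<epsilon>"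
    if "memL2 lborel f" "memL2 lborel g" "L2norm lborel f + L2norm lborel g < sqrt \<epsilon>" "0 < \<epsilon>" for f g \<epsilon>
  proof -
    have nn: "0 \<le> L2norm lborel f" "0 \<le> L2norm lborel g" by (rule L2norm_nonneg)+
    then have "(L2norm lborel f)\<^sup>2 + (L2norm lborel g)\<^sup>2 \<le> (L2norm lborel f + L2norm lborel g)\<^sup>2" by (simp add: power2_sum)
    also have "\<dots> \<le> (sqrt \<epsilon>)\<^sup>2" using nn that(3) by (intro power_mono) auto
    finally show ?thesis using that by (simp add: energy_memL2 ennreal_leI del: ennreal_plus)
  qed
  have initU: "\<forall>\<^sub>F \<tau> in at_right 0. energy UNIV (\<lambda>x. U \<tau> x 0 - u0 x) (\<lambda>x. V \<tau> x 0 - v0 x) \<le> ennreal \<epsilon>" if \<epsilon>: "0 < \<epsilon>" for \<epsilon>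
  proof -
    have "\<forall>\<^sub>F \<tau> in at_right 0. L2norm lborel (\<lambda>x. U \<tau> x 0 - u0 x) + L2norm lborel (\<lambda>x. V \<tau> x 0 - v0 x) < sqrt \<epsilon>"
      using order_tendstoD(2)[OF assms(5), of "sqrt \<epsilon>"] \<epsilon> by simp
    then show ?thesis using eventually_at_right_less[of "0::real"]
    proof eventually_elim
      case (elim \<tau>)
      show ?case
        using ts_sol_initial_memL2[OF ts[OF elim(2)] elim(2)] elim(1) \<epsilon> assms(2,3) by (intro energy_le memL2_diff)
    qed
  qed
  have initu: "\<forall>\<^sub>F k in sequentially. energy UNIV (\<lambda>x. uk k x 0 - u0 x) (\<lambda>x. vk k x 0 - v0 x) \<le> ennreal \<epsilon>" if \<epsilon>: "0 < \<epsilon>" for \<epsilon>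
  proof -
    have "\<forall>\<^sub>F k in sequentially. L2norm lborel (\<lambda>x. uk k x 0 - u0 x) + L2norm lborel (\<lambda>x. vk k x 0 - v0 x) < sqrt \<epsilon>"
      using order_tendstoD(2)[OF init_lim, of "sqrt \<epsilon>"] \<epsilon> by simp
    then show ?thesis using init_mem by eventually_elim (use \<epsilon> in \<open>auto intro: energy_le\<close>)
  qed
  show ?thesis
  proof (rule tendstoI)
    fix \<epsilon> :: real assume \<epsilon>: "0 < \<epsilon>"
    \<comment> \<open>Both suprema are bounded by \<eta> in the weak sense only; a third instead of
      a half makes the final inequality strict.\<close>
    define \<eta> where "\<eta> = \<epsilon> / 3"
    have \<eta>: "0 < \<eta>" using \<epsilon> by (simp add: \<eta>_def)
    have "\<forall>\<^sub>F \<tau> in at_right 0. \<forall>t\<in>{0..T}. gap UNIV (U \<tau>) (V \<tau>) u v t \<le> ennreal (\<eta>\<^sup>2)"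
      by (rule ts_sol_converges_in_energy[where ?a0.0 = a and ?b0.0 = b and ?u0.0 = u0 and ?v0.0 = v0 and uk = uk and vk = vk, OF ts sol mem cont])
        (use strip assms(2,3,7) initU initu \<eta> in auto)
    then show "\<forall>\<^sub>F \<tau> in at_right 0. dist ((SUP t\<in>{0..T}. L2norm lborel (\<lambda>x. U \<tau> x t - u x t))
              + (SUP t\<in>{0..T}. L2norm lborel (\<lambda>x. V \<tau> x t - v x t))) 0 < \<epsilon>"
    proof eventually_elim
      case (elim \<tau>)
      \<comment> \<open>A real supremum says something only for bounded nonempty families, so the
        bound for each t comes first; nonnegativity is read off at t = 0.\<close>
      have sup: "0 \<le> (SUP t\<in>{0..T}. L2norm lborel (f t)) \<and> (SUP t\<in>{0..T}. L2norm lborel (f t)) \<le> \<eta>"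
        if "\<And>t. t \<in> {0..T} \<Longrightarrow> L2norm lborel (f t) \<le> \<eta>" for f :: "real \<Rightarrow> real \<Rightarrow> complex"
      proof
        show "(SUP t\<in>{0..T}. L2norm lborel (f t)) \<le> \<eta>" using assms(7) that by (intro cSUP_least) auto
        have "bdd_above ((\<lambda>t. L2norm lborel (f t)) ` {0..T})" using that by (intro bdd_aboveI2) auto
        then show "0 \<le> (SUP t\<in>{0..T}. L2norm lborel (f t))"
          using assms(7) by (intro cSUP_upper2[of _ _ 0] L2norm_nonneg) auto
      qed
      have "sq_int UNIV (\<lambda>x. U \<tau> x t - u x t) \<le> ennreal (\<eta>\<^sup>2)" "sq_int UNIV (\<lambda>x. V \<tau> x t - v x t) \<le> ennreal (\<eta>\<^sup>2)" if "t \<in> {0..T}" for t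
        using elim that unfolding energy_def by (meson order.trans add_increasing add_increasing2 order.refl zero_le)+
      then have le: "L2norm lborel (\<lambda>x. U \<tau> x t - u x t) \<le> \<eta>" "L2norm lborel (\<lambda>x. V \<tau> x t - v x t) \<le> \<eta>" if "t \<in> {0..T}" for t
        using that \<eta> by (auto intro: L2norm_le_of_sq_int)
      show ?case
        using sup[of "\<lambda>t x. U \<tau> x t - u x t", OF le(1)] sup[of "\<lambda>t x. V \<tau> x t - v x t", OF le(2)] \<epsilon>
        by (simp add: \<eta>_def)
    qed
  qed
qed

end
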